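(* There exists a constant $\tau^*>0$ such that, when $\tau\le\tau^*$, the solution $(u_h^n,\phi_h^n)\in\widetilde V_h\times V_h$ ($n=1,2,\dots,N$) to the fully discrete scheme (S) described in the context is unique.
   Context: Let $\Omega\subset\mathbb{R}^d$ ($d=2,3$) be an open bounded convex polygonal ($d=2$) or polyhedral ($d=3$) domain, $T>0$, and let $\alpha,\beta\ge0$ be real constants such that either $\alpha\ne0$ and $\beta\ne0$ (Schrödinger–Helmholtz case) or $\alpha=0$ and $\beta=1$ (Schrödinger–Poisson case). Write $\mathbf i=\sqrt{-1}$. The initial data are $u_0\in H_0^1(\Omega)$ (complex-valued) and $\phi_0\in H_0^1(\Omega)$ (real-valued). The scheme below discretizes the system $\mathbf i u_t+\Delta u-\phi u=0$, $\alpha\phi-\beta^2\Delta\phi=|u|^2$ in $\Omega\times(0,T]$ with $u(\cdot,0)=u_0$, $\phi(\cdot,0)=\phi_0$ and homogeneous Dirichlet boundary conditions. The constant $\tau^*$ is chosen for these fixed data, before the mesh and the time step. Finite element spaces: $\mathcal T_h$ is a quasi-uniform partition of $\Omega$ into triangles ($d=2$) or tetrahedra ($d=3$) $\mathcal K_j$, with mesh size $h=\max_j \mathrm{diam}\,\mathcal K_j$ (a quasi-uniform family of partitions indexed by $h$). For a fixed integer $r\ge1$, $V_h$ is the space of real-valued functions $v_h\in C(\overline\Omega)$ with $v_h=0$ on $\partial\Omega$ whose restriction to each $\mathcal K_j$ is a polynomial of degree at most $r$, and $\widetilde V_h=V_h\oplus\mathbf i V_h$. The inner product is $(u,v)=\int_\Omega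 u\,v^*\,d\mathbf x$, where $v^*$ is the complex conjugate of $v$. The Ritz projection $R_h:H_0^1(\Omega)\to V_h$ is defined by $(\nabla(v-R_hv),\nabla w_h)=0$ for all $w_h\in V_h$ (for complex-valued functions, applied to real and imaginary parts, with values in $\widetilde V_h$). Time discretization: $N$ is a positive integer, $\tau=T/N$. For a sequence $\omega^n$, $D_\tau\omega^n=(\omega^n-\omega^{n-1})/\tau$ and $\overline\omega^{\,n-\frac12}=(\omega^n+\omega^{n-1})/2$. Scheme (S): $u_h^0=R_hu_0$, $\phi_h^0=R_h\phi_0$, and for $n=1,\dots,N$, $(u_h^n,\phi_h^n)\in\widetilde V_h\times V_h$ satisfies $$\mathbf i(D_\tau u_h^n,v_h)-(\nabla\overline u_h^{\,n-\frac12},\nabla v_h)-(\overline\phi_h^{\,n-\frac12}\,\overline u_h^{\,n-\frac12},v_h)=0\quad\forall v_h\in\widetilde V_h,$$ $$\alpha(\phi_h^n,w_h)+\beta^2(\nabla\phi_h^n,\nabla w_h)=(|u_h^n|^2,w_h)\quad\forall w_h\in V_h.$$ *)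

theory Defs
  imports "HOL-Analysis.Analysis"
begin

section \<open>Domains and meshes\<close>

text \<open>For \<open>CARD('d) = 2\<close> these are the open convex polygons, for \<open>CARD('d) = 3\<close> the open convex
  polyhedra.\<close>

definition convex_polytopal_domain :: "(real^'d) set \<Rightarrow> bool" where
  "convex_polytopal_domain \<Omega> \<longleftrightarrow>
     open \<Omega> \<and> \<Omega> \<noteq> {} \<and> bounded \<Omega> \<and> convex \<Omega> \<and> polytope (closure \<Omega>)"

text \<open>Cells are closed simplices with pairwise disjoint interiors. Hanging nodes are not excluded;
  in particular every face-to-face triangulation of the domain is a partition in this sense.\<close>

definition simplicial_partition :: "(real^'d) set \<Rightarrow> (real^'d) set set \<Rightarrow> bool" where
  "simplicial_partition \<Omega> \<T> \<longleftrightarrow>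
     finite \<T> \<and> (\<forall>K\<in>\<T>. int CARD('d) simplex K) \<and>
     pairwise (\<lambda>K L. interior K \<inter> interior L = {}) \<T> \<and> \<Union>\<T> = closure \<Omega>"

definition mesh_size :: "(real^'d) set set \<Rightarrow> real" where
  "mesh_size \<T> = Max (diameter ` \<T>)"

text \<open>Quasi-uniformity: every cell of every mesh contains a ball whose radius is at least a
  mesh-independent multiple of the mesh size (which bounds the diameters of all cells from above).\<close>

definition quasi_uniform_family :: "(real^'d) set \<Rightarrow> (real^'d) set set set \<Rightarrow> bool" where
  "quasi_uniform_family \<Omega> \<F> \<longleftrightarrow>
     (\<forall>\<T>\<in>\<F>. simplicial_partition \<Omega> \<T>) \<and>
     (\<exists>\<rho>>0. \<forall>\<T>\<in>\<F>. \<forall>K\<in>\<T>. \<exists>z. cball z (\<rho> * mesh_size \<T>) \<subseteq> K)"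


section \<open>Sobolev spaces\<close>

definition partial_deriv :: "'d::finite \<Rightarrow> (real^'d \<Rightarrow> 'b::real_normed_vector) \<Rightarrow> real^'d \<Rightarrow> 'b" where
  "partial_deriv i f x = frechet_derivative f (at x) (axis i 1)"

text \<open>All iterated partial derivatives exist and are (totally) differentiable, hence continuous.\<close>

definition smooth :: "(real^'d \<Rightarrow> 'b::real_normed_vector) \<Rightarrow> bool" where
  "smooth f \<longleftrightarrow> (\<forall>is x. (foldr partial_deriv is f) differentiable (at x))"

definition test_functions :: "(real^'d) set \<Rightarrow> (real^'d \<Rightarrow> 'b::real_normed_vector) set" where
  "test_functions \<Omega> =
     {\<psi>. smooth \<psi> \<and> compact (closure {x. \<psi> x \<noteq> 0}) \<and> closure {x. \<psi> x \<noteq> 0} \<subseteq> \<Omega>}"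

definition locally_integrable :: "(real^'d) set \<Rightarrow> (real^'d \<Rightarrow> 'b::euclidean_space) \<Rightarrow> bool" where
  "locally_integrable \<Omega> f \<longleftrightarrow> (\<forall>K. compact K \<and> K \<subseteq> \<Omega> \<longrightarrow> integrable (lebesgue_on K) f)"

definition square_integrable :: "(real^'d) set \<Rightarrow> (real^'d \<Rightarrow> 'b::euclidean_space) \<Rightarrow> bool" where
  "square_integrable \<Omega> f \<longleftrightarrow>
     f \<in> borel_measurable (lebesgue_on \<Omega>) \<and> integrable (lebesgue_on \<Omega>) (\<lambda>x. (norm (f x))\<^sup>2)"

definition has_weak_gradient ::
    "(real^'d) set \<Rightarrow> (real^'d \<Rightarrow> 'b::euclidean_space) \<Rightarrow> (real^'d \<Rightarrow> 'b^'d) \<Rightarrow> bool" where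
  "has_weak_gradient \<Omega> v g \<longleftrightarrow>
     locally_integrable \<Omega> v \<and> locally_integrable \<Omega> g \<and>
     (\<forall>\<psi>\<in>test_functions \<Omega>. \<forall>i.
        (LINT x|lebesgue_on \<Omega>. partial_deriv i \<psi> x *\<^sub>R v x) =
        - (LINT x|lebesgue_on \<Omega>. (\<psi> x :: real) *\<^sub>R (g x $ i)))"

text \<open>The weak gradient is determined up to null sets only; \<open>grad \<Omega> v\<close> is one representative. It
  depends on the values of \<open>v\<close> in \<open>\<Omega>\<close> only.\<close>

definition grad :: "(real^'d) set \<Rightarrow> (real^'d \<Rightarrow> 'b::euclidean_space) \<Rightarrow> real^'d \<Rightarrow> 'b^'d" where
  "grad \<Omega> v = (SOME g. has_weak_gradient \<Omega> v g)"

definition sobolev_H1 :: "(real^'d) set \<Rightarrow> (real^'d \<Rightarrow> 'b::euclidean_space) set" where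
  "sobolev_H1 \<Omega> =
     {v. square_integrable \<Omega> v \<and> (\<exists>g. has_weak_gradient \<Omega> v g \<and> square_integrable \<Omega> g)}"

definition H1_norm :: "(real^'d) set \<Rightarrow> (real^'d \<Rightarrow> 'b::euclidean_space) \<Rightarrow> real" where
  "H1_norm \<Omega> v =
     sqrt ((LINT x|lebesgue_on \<Omega>. (norm (v x))\<^sup>2) + (LINT x|lebesgue_on \<Omega>. (norm (grad \<Omega> v x))\<^sup>2))"

definition sobolev_H1_0 :: "(real^'d) set \<Rightarrow> (real^'d \<Rightarrow> 'b::euclidean_space) set" where
  "sobolev_H1_0 \<Omega> =
     {v \<in> sobolev_H1 \<Omega>.
        \<exists>\<psi>. (\<forall>k::nat. \<psi> k \<in> test_functions \<Omega>) \<and> (\<lambda>k. H1_norm \<Omega> (\<lambda>x. v x - \<psi> k x)) \<longlonglongrightarrow> 0}"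


section \<open>Inner products\<close>

definition L2_inner :: "(real^'d) set \<Rightarrow> (real^'d \<Rightarrow> complex) \<Rightarrow> (real^'d \<Rightarrow> complex) \<Rightarrow> complex" where
  "L2_inner \<Omega> u v = (LINT x|lebesgue_on \<Omega>. u x * cnj (v x))"

definition grad_inner :: "(real^'d) set \<Rightarrow> (real^'d \<Rightarrow> complex) \<Rightarrow> (real^'d \<Rightarrow> complex) \<Rightarrow> complex" where
  "grad_inner \<Omega> u v = (LINT x|lebesgue_on \<Omega>. (\<Sum>i\<in>UNIV. grad \<Omega> u x $ i * cnj (grad \<Omega> v x $ i)))"

text \<open>The same inner products on real-valued functions, where conjugation plays no role.\<close>

definition real_L2_inner :: "(real^'d) set \<Rightarrow> (real^'d \<Rightarrow> real) \<Rightarrow> (real^'d \<Rightarrow> real) \<Rightarrow> real" where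
  "real_L2_inner \<Omega> u v = (LINT x|lebesgue_on \<Omega>. u x * v x)"

definition real_grad_inner :: "(real^'d) set \<Rightarrow> (real^'d \<Rightarrow> real) \<Rightarrow> (real^'d \<Rightarrow> real) \<Rightarrow> real" where
  "real_grad_inner \<Omega> u v = (LINT x|lebesgue_on \<Omega>. grad \<Omega> u x \<bullet> grad \<Omega> v x)"


section \<open>Finite element spaces and the Ritz projection\<close>

definition polynomial_of_degree_le :: "nat \<Rightarrow> (real^'d \<Rightarrow> real) \<Rightarrow> bool" where
  "polynomial_of_degree_le r p \<longleftrightarrow>
     (\<exists>c :: ('d \<Rightarrow> nat) \<Rightarrow> real.
        \<forall>x. p x = (\<Sum>k | sum k UNIV \<le> r. c k * (\<Prod>i\<in>UNIV. (x $ i) ^ k i)))"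

text \<open>Elements of the finite element spaces are functions on \<open>closure \<Omega>\<close>; their values elsewhere
  are unconstrained and must be disregarded when comparing two elements.\<close>

definition fe_space :: "(real^'d) set \<Rightarrow> (real^'d) set set \<Rightarrow> nat \<Rightarrow> (real^'d \<Rightarrow> real) set" where
  "fe_space \<Omega> \<T> r =
     {v. continuous_on (closure \<Omega>) v \<and> (\<forall>x\<in>frontier \<Omega>. v x = 0) \<and>
         (\<forall>K\<in>\<T>. \<exists>p. polynomial_of_degree_le r p \<and> (\<forall>x\<in>K. v x = p x))}"

definition complex_fe_space :: "(real^'d) set \<Rightarrow> (real^'d) set set \<Rightarrow> nat \<Rightarrow> (real^'d \<Rightarrow> complex) set" where
  "complex_fe_space \<Omega> \<T> r =
     {\<lambda>x. complex_of_real (v x) + \<i> * complex_of_real (w x) | v w.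
        v \<in> fe_space \<Omega> \<T> r \<and> w \<in> fe_space \<Omega> \<T> r}"

text \<open>\<open>is_ritz_projection \<Omega> V v p\<close> says that \<open>p\<close> is the Ritz projection of \<open>v\<close> onto \<open>V\<close>.\<close>

definition is_ritz_projection ::
    "(real^'d) set \<Rightarrow> (real^'d \<Rightarrow> real) set \<Rightarrow> (real^'d \<Rightarrow> real) \<Rightarrow> (real^'d \<Rightarrow> real) \<Rightarrow> bool" where
  "is_ritz_projection \<Omega> V v p \<longleftrightarrow>
     p \<in> V \<and> (\<forall>w\<in>V. real_grad_inner \<Omega> (\<lambda>x. v x - p x) w = 0)"

definition is_complex_ritz_projection ::
    "(real^'d) set \<Rightarrow> (real^'d \<Rightarrow> real) set \<Rightarrow> (real^'d \<Rightarrow> complex) \<Rightarrow> (real^'d \<Rightarrow> complex) \<Rightarrow> bool" where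
  "is_complex_ritz_projection \<Omega> V v p \<longleftrightarrow>
     is_ritz_projection \<Omega> V (\<lambda>x. Re (v x)) (\<lambda>x. Re (p x)) \<and>
     is_ritz_projection \<Omega> V (\<lambda>x. Im (v x)) (\<lambda>x. Im (p x))"


section \<open>The fully discrete scheme\<close>

definition backward_diff :: "real \<Rightarrow> (nat \<Rightarrow> 'a \<Rightarrow> 'b::real_vector) \<Rightarrow> nat \<Rightarrow> 'a \<Rightarrow> 'b" where
  "backward_diff \<tau> \<omega> n = (\<lambda>x. (\<omega> n x - \<omega> (n - 1) x) /\<^sub>R \<tau>)"

definition midpoint_avg :: "(nat \<Rightarrow> 'a \<Rightarrow> 'b::real_vector) \<Rightarrow> nat \<Rightarrow> 'a \<Rightarrow> 'b" where
  "midpoint_avg \<omega> n = (\<lambda>x. (\<omega> n x + \<omega> (n - 1) x) /\<^sub>R 2)"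

definition scheme_solution ::
    "(real^'d) set \<Rightarrow> (real^'d) set set \<Rightarrow> nat \<Rightarrow> real \<Rightarrow> real \<Rightarrow>
     (real^'d \<Rightarrow> complex) \<Rightarrow> (real^'d \<Rightarrow> real) \<Rightarrow> real \<Rightarrow> nat \<Rightarrow>
     (nat \<Rightarrow> real^'d \<Rightarrow> complex) \<Rightarrow> (nat \<Rightarrow> real^'d \<Rightarrow> real) \<Rightarrow> bool" where
  "scheme_solution \<Omega> \<T> r \<alpha> \<beta> u0 \<phi>0 \<tau> N u \<phi> \<longleftrightarrow>
     is_complex_ritz_projection \<Omega> (fe_space \<Omega> \<T> r) u0 (u 0) \<and>
     is_ritz_projection \<Omega> (fe_space \<Omega> \<T> r) \<phi>0 (\<phi> 0) \<and>
     (\<forall>n\<in>{1..N}.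
        u n \<in> complex_fe_space \<Omega> \<T> r \<and> \<phi> n \<in> fe_space \<Omega> \<T> r \<and>
        (\<forall>v\<in>complex_fe_space \<Omega> \<T> r.
           \<i> * L2_inner \<Omega> (backward_diff \<tau> u n) v
           - grad_inner \<Omega> (midpoint_avg u n) v
           - L2_inner \<Omega> (\<lambda>x. complex_of_real (midpoint_avg \<phi> n x) * midpoint_avg u n x) v = 0) \<and>
        (\<forall>w\<in>fe_space \<Omega> \<T> r.
           \<alpha> * real_L2_inner \<Omega> (\<phi> n) w + \<beta>\<^sup>2 * real_grad_inner \<Omega> (\<phi> n) w
           = real_L2_inner \<Omega> (\<lambda>x. (cmod (u n x))\<^sup>2) w))"

end

theory Submission
  imports Defs
begin

text \<open>Subtracting two solutions at one time level and testing with the difference gives a bound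
\<open>\<parallel>e\<parallel>\<^sup>2 \<le> \<tau> C \<parallel>e\<parallel>\<^sup>2\<close> for the difference \<open>e\<close> of the wave functions, hence \<open>e = 0\<close> for small \<open>\<tau>\<close>. The whole
difficulty is to make \<open>C\<close> independent of the mesh, the time step and the time level, and that takes
two ingredients.

The first is the inequality \<open>\<parallel>v\<parallel>\<^sub>4 \<le> S \<parallel>\<nabla>v\<parallel>\<^sub>2\<close> for finite element functions, with \<open>S\<close> depending
on the domain only. It bounds every trilinear term by \<open>|(f g, h)| \<le> S\<^sup>2 \<parallel>\<nabla>f\<parallel> \<parallel>\<nabla>g\<parallel> \<parallel>h\<parallel>\<close>, so that the
difference of the potentials satisfies \<open>\<parallel>\<nabla>\<psi>\<parallel> \<le> C \<parallel>e\<parallel>\<close> and \<open>C\<close> depends on the gradients of the two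
solutions alone. The second is a bound on these gradients. The scheme conserves the mass \<open>\<parallel>u\<parallel>\<^sup>2\<close> and,
from the first time level on, the energy \<open>\<parallel>\<nabla>u\<parallel>\<^sup>2 + (\<alpha> \<parallel>\<phi>\<parallel>\<^sup>2 + \<beta>\<^sup>2 \<parallel>\<nabla>\<phi>\<parallel>\<^sup>2) / 2\<close>. The initial potential is
prescribed and unrelated to \<open>|u\<^sub>0|\<^sup>2\<close>, so the first step does not conserve the energy; there it is
estimated by the trilinear bound and Young's inequality from the initial gradients, which the Ritz
projection does not increase. The lemmas \<open>step_unique\<close>, \<open>kinetic_bound\<close> and \<open>first_step_energy_bound\<close>
carry this argument; it takes place in an abstract real Galerkin space, after \<open>u = p + \<i> q\<close> has been
split into real and imaginary parts.

The Sobolev inequality is proved for Lipschitz functions \<open>V\<close> on the whole space that vanish outside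
the domain and are differentiable almost everywhere; zero extensions of finite element functions are
of this kind. For them \<open>\<parallel>V(\<cdot> + y) - V\<parallel>\<^sub>2 \<le> |y| \<parallel>\<nabla>V\<parallel>\<^sub>2\<close> (\<open>translation_estimate\<close>), by translation
invariance and dominated convergence. The inequality follows by comparing \<open>V\<close> with its averages over
cubes of side \<open>s = 16\<^sup>-\<^sup>k\<close>: the difference of two consecutive averages has \<open>L\<^sup>2\<close> norm of order
\<open>s\<close> and sup norm of order \<open>s\<^sup>1\<^sup>-\<^sup>d\<^sup>/\<^sup>2\<close>, hence \<open>L\<^sup>4\<close> norm of order \<open>s\<^sup>1\<^sup>-\<^sup>d\<^sup>/\<^sup>4\<close>, which is
summable over the scales exactly when \<open>d \<le> 3\<close>.

The gradient in the Dirichlet form is an arbitrarily chosen weak gradient. That the form is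
nevertheless bilinear, and is computed on finite element functions from the classical gradient inside
the cells, rests on the almost everywhere uniqueness of weak gradients (\<open>weak_gradient_unique\<close>),
for which enough test functions are constructed from \<open>exp (- 1 / t)\<close>.\<close>

section \<open>Integration tools\<close>

lemma cauchy_schwarz_integral:
  fixes f g :: "'a \<Rightarrow> real"
  assumes [measurable]: "f \<in> borel_measurable M" "g \<in> borel_measurable M"
    and f2: "integrable M (\<lambda>x. (f x)\<^sup>2)" and g2: "integrable M (\<lambda>x. (g x)\<^sup>2)"
  shows "integrable M (\<lambda>x. f x * g x)"
    and "(LINT x|M. f x * g x)\<^sup>2 \<le> (LINT x|M. (f x)\<^sup>2) * (LINT x|M. (g x)\<^sup>2)"
proof -
  have "\<bar>a * b\<bar> \<le> a\<^sup>2 + b\<^sup>2" for a b :: real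
  proof -
    have "0 \<le> (\<bar>a\<bar> - \<bar>b\<bar>)\<^sup>2" by simp
    then have "2 * \<bar>a * b\<bar> \<le> a\<^sup>2 + b\<^sup>2" by (simp add: power2_diff abs_mult)
    then show ?thesis using abs_ge_zero[of "a * b"] by linarith
  qed
  then show fg: "integrable M (\<lambda>x. f x * g x)"
    by (intro Bochner_Integration.integrable_bound[OF Bochner_Integration.integrable_add[OF f2 g2]])
       (auto intro!: AE_I2 order_trans[OF _ abs_ge_self])
  define P Q R where "P = (LINT x|M. (f x)\<^sup>2)" and "Q = (LINT x|M. f x * g x)"
    and "R = (LINT x|M. (g x)\<^sup>2)"
  have pos: "0 \<le> P - 2 * t * Q + t\<^sup>2 * R" for t
  proof -
    have "0 \<le> (LINT x|M. (f x - t * g x)\<^sup>2)" by simp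
    also have "\<dots> = (LINT x|M. (f x)\<^sup>2 - 2 * t * (f x * g x) + t\<^sup>2 * (g x)\<^sup>2)"
      by (rule Bochner_Integration.integral_cong) (auto simp: power2_eq_square algebra_simps)
    also have "\<dots> = P - 2 * t * Q + t\<^sup>2 * R"
      using f2 g2 fg by (simp add: P_def Q_def R_def)
    finally show ?thesis .
  qed
  have R0: "0 \<le> R" by (simp add: R_def)
  have "Q\<^sup>2 \<le> P * R"
  proof (cases "R = 0")
    case True
    have "Q = 0"
    proof (rule ccontr)
      assume "Q \<noteq> 0"
      with pos[of "(P + 1) / (2 * Q)"] True show False by (simp add: field_simps)
    qed
    with True show ?thesis by simp
  next
    case False
    with R0 have "R > 0" by simp
    with pos[of "Q / R"] show ?thesis by (simp add: field_simps power2_eq_square)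
  qed
  then show "(LINT x|M. f x * g x)\<^sup>2 \<le> (LINT x|M. (f x)\<^sup>2) * (LINT x|M. (g x)\<^sup>2)"
    by (simp add: P_def Q_def R_def)
qed

lemma bounded_subset_cball_0:
  fixes S :: "'a::real_normed_vector set"
  assumes "bounded S" shows "\<exists>R. S \<subseteq> cball 0 R"
  using assms unfolding bounded_iff by (auto simp: subset_iff)

lemma integrable_bounded_support:
  fixes f :: "'a::euclidean_space \<Rightarrow> 'b::{banach,second_countable_topology}"
  assumes "f \<in> borel_measurable lebesgue" "\<And>x. norm (f x) \<le> B" "bounded S" "\<And>x. x \<notin> S \<Longrightarrow> f x = 0"
  shows "integrable lebesgue f"
proof -
  obtain R where R: "S \<subseteq> cball 0 R" using bounded_subset_cball_0[OF assms(3)] by blast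
  show ?thesis
    by (rule integrableI_bounded_set[where A="cball 0 R" and B=B])
       (use assms R emeasure_lborel_cball_finite[of 0 R] in \<open>auto simp: less_top[symmetric] subset_iff intro!: AE_I2\<close>)
qed

lemma borel_measurable_lebesgueI: "f \<in> borel_measurable borel \<Longrightarrow> f \<in> borel_measurable lebesgue"
  by (simp add: measurable_completion)

lemma integrable_continuous_supported:
  fixes f :: "'a::euclidean_space \<Rightarrow> real"
  assumes S: "bounded S" and "continuous_on UNIV f" "\<And>x. x \<notin> S \<Longrightarrow> f x = 0"
  shows "integrable lebesgue f"
proof -
  have "f \<in> borel_measurable lebesgue"
    by (intro borel_measurable_lebesgueI borel_measurable_continuous_onI assms(2))
  moreover obtain R where R: "S \<subseteq> cball 0 R" using bounded_subset_cball_0[OF S] by blast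
  have "compact (f ` cball 0 R)"
    by (rule compact_continuous_image) (use assms(2) continuous_on_subset in auto)
  then have "bounded (f ` cball 0 R)" by (rule compact_imp_bounded)
  then obtain C where C: "\<And>x. x \<in> cball 0 R \<Longrightarrow> norm (f x) \<le> C"
    unfolding bounded_iff by blast
  have "norm (f x) \<le> max C 0" for x
    using C[of x] assms(3)[of x] R by (cases "x \<in> S") (auto simp: le_max_iff_disj subset_iff)
  ultimately show ?thesis by (rule integrable_bounded_support[OF _ _ S assms(3)])
qed

lemma integral_lebesgue_translate:
  fixes f :: "'a::euclidean_space \<Rightarrow> real"
  assumes [measurable]: "f \<in> borel_measurable borel"
  shows "(LINT x|lebesgue. f (x + y)) = (LINT x|lebesgue. f x)"
proof -
  have "(LINT x|lborel. f x) = (LINT x|distr lborel borel ((+) y). f x)"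
    by (simp add: lborel_distr_plus)
  also have "\<dots> = (LINT x|lborel. f (x + y))"
    by (subst integral_distr) (auto simp: add.commute)
  finally show ?thesis
    by (simp add: integral_completion)
qed

lemma integral_lebesgue_affine:
  fixes f :: "'a::euclidean_space \<Rightarrow> real"
  assumes [measurable]: "f \<in> borel_measurable borel" and s: "s > 0"
  shows "(LINT z|lebesgue. f (x + s *\<^sub>R z)) = (LINT x|lebesgue. f x) / s ^ DIM('a)"
proof -
  have "(LINT z|lborel. f z) = (LINT z|density (distr lborel borel (\<lambda>z. x + s *\<^sub>R z)) (\<lambda>_. \<bar>s\<bar> ^ DIM('a)). f z)"
    using lborel_affine[of s x] s by simp
  also have "\<dots> = s ^ DIM('a) * (LINT z|lborel. f (x + s *\<^sub>R z))"
    using s by (subst integral_density) (auto simp: integral_distr)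
  finally show ?thesis
    using s by (simp add: integral_completion field_simps)
qed

lemma integrable_lebesgue_on_subset:
  fixes f :: "'a::euclidean_space \<Rightarrow> 'b::euclidean_space"
  assumes "integrable lebesgue f" "K \<in> sets lebesgue"
  shows "integrable (lebesgue_on K) f"
  using assms by (simp add: integrable_restrict_space integrable_mult_indicator)

lemma integral_lebesgue_on_supported:
  fixes f :: "'a::euclidean_space \<Rightarrow> 'b::euclidean_space"
  assumes "K \<in> sets lebesgue" "\<And>x. x \<notin> K \<Longrightarrow> f x = 0"
  shows "(LINT x|lebesgue_on K. f x) = (LINT x|lebesgue. f x)"
proof -
  have "(LINT x|lebesgue_on K. f x) = (LINT x|lebesgue. indicator K x *\<^sub>R f x)"
    using assms(1) by (simp add: integral_restrict_space)
  also have "(\<lambda>x. indicator K x *\<^sub>R f x) = f" using assms(2) by (auto simp: indicator_def fun_eq_iff)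
  finally show ?thesis .
qed

lemma integral_product_square_le:
  fixes f g :: "'a \<Rightarrow> real"
  assumes m: "f \<in> borel_measurable M" "g \<in> borel_measurable M"
    and f4: "integrable M (\<lambda>x. f x ^ 4)" and g4: "integrable M (\<lambda>x. g x ^ 4)"
  shows "integrable M (\<lambda>x. (f x * g x)\<^sup>2)"
    and "(LINT x|M. (f x * g x)\<^sup>2)\<^sup>2 \<le> (LINT x|M. f x ^ 4) * (LINT x|M. g x ^ 4)"
proof -
  have 4: "a ^ 4 = (a\<^sup>2)\<^sup>2" for a :: real by simp
  have m2: "(\<lambda>x. (f x)\<^sup>2) \<in> borel_measurable M" "(\<lambda>x. (g x)\<^sup>2) \<in> borel_measurable M"
    using m by measurable
  note cs = cauchy_schwarz_integral[OF m2 f4[unfolded 4] g4[unfolded 4]]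
  show "integrable M (\<lambda>x. (f x * g x)\<^sup>2)" using cs(1) by (simp add: power_mult_distrib)
  show "(LINT x|M. (f x * g x)\<^sup>2)\<^sup>2 \<le> (LINT x|M. f x ^ 4) * (LINT x|M. g x ^ 4)"
    using cs(2) by (simp only: power_mult_distrib 4)
qed

text \<open>Hoelder's inequality with exponents \<open>4/3\<close> and \<open>4\<close>, obtained from two applications of the
Cauchy-Schwarz inequality to \<open>f\<^sup>3 g = f\<^sup>2 \<cdot> (f g)\<close>. The Sobolev inequality is proved by
duality with \<open>V\<^sup>3\<close>, which calls for this form.\<close>

lemma holder_cubic:
  fixes f g :: "'a \<Rightarrow> real"
  assumes m: "f \<in> borel_measurable M" "g \<in> borel_measurable M"
    and f4: "integrable M (\<lambda>x. f x ^ 4)" and g4: "integrable M (\<lambda>x. g x ^ 4)"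
    and X: "X \<ge> 0" "(LINT x|M. f x ^ 4) = X ^ 4" and Y: "Y \<ge> 0" "(LINT x|M. g x ^ 4) \<le> Y ^ 4"
  shows "integrable M (\<lambda>x. f x ^ 3 * g x)" and "(LINT x|M. f x ^ 3 * g x) \<le> X ^ 3 * Y"
proof -
  have 4: "a ^ 4 = (a\<^sup>2)\<^sup>2" for a :: real by simp
  have 3: "(a\<^sup>2) * (a * b) = a ^ 3 * b" for a b :: real by (simp add: power2_eq_square power3_eq_cube)
  note fg = integral_product_square_le[OF m f4 g4]
  have m2: "(\<lambda>x. (f x)\<^sup>2) \<in> borel_measurable M" "(\<lambda>x. f x * g x) \<in> borel_measurable M"
    using m by measurable
  note cs = cauchy_schwarz_integral[OF m2 f4[unfolded 4] fg(1), unfolded 3]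
  show "integrable M (\<lambda>x. f x ^ 3 * g x)" by (rule cs(1))
  have "(LINT x|M. (f x * g x)\<^sup>2)\<^sup>2 \<le> X ^ 4 * Y ^ 4"
    using fg(2) X Y by (smt (verit) mult_left_mono zero_le_power)
  also have "\<dots> = (X\<^sup>2 * Y\<^sup>2)\<^sup>2" by (simp add: power_mult_distrib)
  finally have "(LINT x|M. (f x * g x)\<^sup>2) \<le> X\<^sup>2 * Y\<^sup>2"
    by (rule power2_le_imp_le) simp
  then have "(LINT x|M. f x ^ 3 * g x)\<^sup>2 \<le> X ^ 4 * (X\<^sup>2 * Y\<^sup>2)"
    using cs(2) X(2) by (smt (verit) 4 mult_left_mono zero_le_power X(1) Bochner_Integration.integral_cong)
  also have "\<dots> = (X ^ 3 * Y)\<^sup>2" by (simp add: power_mult_distrib power_mult[symmetric] power_add[symmetric] mult.assoc[symmetric])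
  finally show "(LINT x|M. f x ^ 3 * g x) \<le> X ^ 3 * Y"
    by (rule power2_le_imp_le) (use X Y in simp)
qed

section \<open>Lipschitz functions with compact support\<close>

text \<open>The value 0 at the points of non-differentiability makes the gradient an everywhere limit of
measurable functions.\<close>

definition classical_gradient :: "(real^'d \<Rightarrow> real) \<Rightarrow> real^'d \<Rightarrow> real^'d" where
  "classical_gradient V x =
     (if V differentiable (at x) then (\<chi> i. partial_deriv i V x) else 0)"

text \<open>On this class calculus reduces to difference quotients: they are bounded by the Lipschitz
constant and converge almost everywhere, so identities and estimates for translations pass to the
gradient by dominated convergence.\<close>

definition lip_ae_diff :: "(real^'d) set \<Rightarrow> (real^'d \<Rightarrow> real) \<Rightarrow> bool" where
  "lip_ae_diff S V \<longleftrightarrow> (\<exists>L. L-lipschitz_on UNIV V) \<and>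
     negligible {x. \<not> V differentiable (at x)} \<and> (\<forall>x. x \<notin> S \<longrightarrow> V x = 0)"

lemma has_derivative_classical_gradient:
  assumes "V differentiable (at x)"
  shows "(V has_derivative (\<lambda>h. classical_gradient V x \<bullet> h)) (at x)"
proof -
  let ?D = "frechet_derivative V (at x)"
  have D: "(V has_derivative ?D) (at x)" using assms frechet_derivative_works by blast
  then have lin: "linear ?D" using has_derivative_linear by blast
  have "?D h = classical_gradient V x \<bullet> h" for h
  proof -
    have "?D h = ?D (\<Sum>i\<in>UNIV. h $ i *\<^sub>R axis i 1)"
      using basis_expansion[of h] by (simp add: scalar_mult_eq_scaleR)
    also have "\<dots> = (\<Sum>i\<in>UNIV. h $ i * ?D (axis i 1))"
      using lin by (simp add: linear_sum linear_scale)
    also have "\<dots> = classical_gradient V x \<bullet> h"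
      using assms by (simp add: classical_gradient_def inner_vec_def partial_deriv_def mult.commute)
    finally show ?thesis .
  qed
  then have "?D = (\<lambda>h. classical_gradient V x \<bullet> h)" by (rule ext)
  with D show ?thesis by metis
qed

lemma classical_gradient_unique:
  assumes "(V has_derivative (\<lambda>h. g \<bullet> h)) (at x)"
  shows "classical_gradient V x = g"
proof -
  have "V differentiable (at x)" using assms differentiable_def by blast
  from has_derivative_unique[OF has_derivative_classical_gradient[OF this] assms]
  have "classical_gradient V x \<bullet> h = g \<bullet> h" for h by (rule fun_cong)
  then have "\<forall>h. classical_gradient V x \<bullet> h = g \<bullet> h" by blast
  then show ?thesis unfolding vector_eq_rdot .
qed

lemma difference_quotient_tendsto:
  assumes "V differentiable (at x)"
  shows "(\<lambda>n. real (Suc n) * (V (x + y /\<^sub>R real (Suc n)) - V x)) \<longlonglongrightarrow> classical_gradient V x \<bullet> y"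
proof -
  have "((\<lambda>t. x + t *\<^sub>R y) has_derivative (\<lambda>t. t *\<^sub>R y)) (at 0)"
    by (auto intro!: derivative_eq_intros)
  from has_derivative_compose[OF this, of V "\<lambda>h. classical_gradient V x \<bullet> h"]
  have "((\<lambda>t. V (x + t *\<^sub>R y)) has_derivative (\<lambda>t. (classical_gradient V x \<bullet> y) * t)) (at 0)"
    using has_derivative_classical_gradient[OF assms] by (simp add: mult.commute)
  then have "((\<lambda>t. V (x + t *\<^sub>R y)) has_real_derivative classical_gradient V x \<bullet> y) (at 0)"
    by (simp add: has_field_derivative_def)
  then have lim: "((\<lambda>h. (V (x + h *\<^sub>R y) - V x) / h) \<longlongrightarrow> classical_gradient V x \<bullet> y) (at 0)"
    by (simp add: DERIV_def)
  have "filterlim (\<lambda>n. inverse (real (Suc n))) (at 0) sequentially"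
    using LIMSEQ_inverse_real_of_nat by (simp add: filterlim_at)
  from filterlim_compose[OF lim this] show ?thesis
    by (simp add: field_simps)
qed

context
  fixes S :: "(real^'d) set" and V :: "real^'d \<Rightarrow> real"
  assumes V: "lip_ae_diff S V"
begin

lemma lip_ae_diff_continuous: "continuous_on A V"
  using V lipschitz_on_continuous_on continuous_on_subset unfolding lip_ae_diff_def by blast

lemma lip_ae_diff_borel: "V \<in> borel_measurable borel"
  using lip_ae_diff_continuous[of UNIV] by (simp add: borel_measurable_continuous_onI)

lemma lip_ae_diff_bound:
  obtains L where "L \<ge> 0" "\<And>x y. \<bar>V x - V y\<bar> \<le> L * norm (x - y)"
proof -
  obtain L where L: "L-lipschitz_on UNIV V" using V by (auto simp: lip_ae_diff_def)
  show ?thesis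
    using that[of L] lipschitz_on_nonneg[OF L] lipschitz_onD[OF L] by (auto simp: dist_norm)
qed

lemma AE_differentiable: "AE x in lebesgue. V differentiable (at x)"
  using V unfolding lip_ae_diff_def
  by (simp add: negligible_iff_null_sets AE_iff_null_sets completion.AE_iff_null_sets)

lemma AE_difference_quotient_tendsto:
  "AE x in lebesgue. (\<lambda>n. real (Suc n) * (V (x + y /\<^sub>R real (Suc n)) - V x))
     \<longlonglongrightarrow> classical_gradient V x \<bullet> y"
  using AE_differentiable by eventually_elim (rule difference_quotient_tendsto)

lemma classical_gradient_measurable:
  "classical_gradient V \<in> borel_measurable lebesgue"
proof -
  note [measurable] = lip_ae_diff_borel
  let ?D = "{x. V differentiable (at x)}"
  have "- ?D \<in> sets lebesgue"
    using V unfolding lip_ae_diff_def by (simp add: negligible_imp_sets Compl_eq)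
  then have D [measurable]: "?D \<in> sets lebesgue"
    using sets.compl_sets[of "- ?D" lebesgue] by (simp add: Compl_eq_Diff_UNIV[symmetric])
  have "(\<lambda>x. classical_gradient V x \<bullet> b) \<in> borel_measurable lebesgue" for b
  proof (rule borel_measurable_LIMSEQ_real)
    fix n
    have "(\<lambda>x. real (Suc n) * (V (x + b /\<^sub>R real (Suc n)) - V x)) \<in> borel_measurable lebesgue"
      by (rule borel_measurable_lebesgueI) measurable
    then show "(\<lambda>x. indicator ?D x * (real (Suc n) * (V (x + b /\<^sub>R real (Suc n)) - V x)))
        \<in> borel_measurable lebesgue"
      using D by (intro borel_measurable_times[OF borel_measurable_indicator])
  next
    fix x
    show "(\<lambda>n. indicator ?D x * (real (Suc n) * (V (x + b /\<^sub>R real (Suc n)) - V x)))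
        \<longlonglongrightarrow> classical_gradient V x \<bullet> b"
      using difference_quotient_tendsto[of V x b]
      by (cases "V differentiable (at x)") (auto simp: classical_gradient_def)
  qed
  then show ?thesis
    by (subst borel_measurable_euclidean_space) auto
qed

lemma classical_gradient_bounded:
  obtains L where "L \<ge> 0" "\<And>x. norm (classical_gradient V x) \<le> L"
proof -
  obtain L where L: "L \<ge> 0" "\<And>x y. \<bar>V x - V y\<bar> \<le> L * norm (x - y)" using lip_ae_diff_bound by blast
  have "norm (classical_gradient V x) \<le> L" for x
  proof (cases "V differentiable (at x)")
    case True
    let ?g = "classical_gradient V x"
    have "?g \<bullet> ?g \<le> L * norm ?g"
    proof (rule LIMSEQ_le_const2[OF difference_quotient_tendsto[OF True]], intro exI allI impI)
      fix n
      have "\<bar>V (x + ?g /\<^sub>R real (Suc n)) - V x\<bar> \<le> L * (norm ?g / real (Suc n))"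
        using L(2)[of "x + ?g /\<^sub>R real (Suc n)" x] by (simp add: divide_inverse mult.commute)
      then have "V (x + ?g /\<^sub>R real (Suc n)) - V x \<le> L * norm ?g / real (Suc n)" by simp
      then show "real (Suc n) * (V (x + ?g /\<^sub>R real (Suc n)) - V x) \<le> L * norm ?g"
        by (simp only: pos_le_divide_eq of_nat_0_less_iff zero_less_Suc mult.commute)
    qed
    then show ?thesis
      by (cases "?g = 0") (auto simp: dot_square_norm power2_eq_square L(1))
  qed (simp add: classical_gradient_def L(1))
  with L(1) that show ?thesis by blast
qed

lemma classical_gradient_outside:
  assumes "x \<notin> closure S"
  shows "classical_gradient V x = 0"
proof (rule classical_gradient_unique)
  have "eventually (\<lambda>y. V y = 0) (nhds x)"
  proof -
    have "eventually (\<lambda>y. y \<in> - closure S) (nhds x)"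
      using assms by (intro eventually_nhds_in_open) auto
    then show ?thesis
      by eventually_elim (use V closure_subset in \<open>auto simp: lip_ae_diff_def\<close>)
  qed
  then have "eventually (\<lambda>y. 0 = V y) (at x)" "V x = 0"
    by (auto simp: eventually_at_filter elim: eventually_mono dest: eventually_nhds_x_imp_x)
  then have "(V has_derivative (\<lambda>h. 0)) (at x)"
    by (intro has_derivative_transform_eventually[OF has_derivative_const[of 0]]) auto
  then show "(V has_derivative (\<lambda>h. 0 \<bullet> h)) (at x)" by simp
qed

context
  assumes S: "bounded S"
begin

lemma lip_ae_diff_bounded:
  obtains B where "B \<ge> 0" "\<And>x. \<bar>V x\<bar> \<le> B"
proof -
  obtain L where L: "L \<ge> 0" "\<And>x y. \<bar>V x - V y\<bar> \<le> L * norm (x - y)" using lip_ae_diff_bound by blast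
  obtain R where R: "S \<subseteq> cball 0 R" using bounded_subset_cball_0[OF S] by blast
  have "\<bar>V x\<bar> \<le> \<bar>V 0\<bar> + L * \<bar>R\<bar>" for x
  proof (cases "x \<in> S")
    case True
    then have "norm x \<le> \<bar>R\<bar>" using R by auto
    then have "L * norm (x - 0) \<le> L * \<bar>R\<bar>" using L(1) by (simp add: mult_left_mono)
    then show ?thesis using L(2)[of x 0] by linarith
  next
    case False
    then show ?thesis using V L(1) by (simp add: lip_ae_diff_def)
  qed
  then show ?thesis using that[of "\<bar>V 0\<bar> + L * \<bar>R\<bar>"] L(1) by simp
qed

text \<open>The quotients are bounded by the Lipschitz constant times \<open>norm y\<close> and vanish outside a fixed
ball, which provides a dominating function. The identity for \<open>F\<close> leads to integration by parts, the
square to the translation estimate.\<close>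

lemma integral_difference_quotient_tendsto:
  fixes F :: "real \<Rightarrow> real"
  assumes "continuous_on UNIV F" "F 0 = 0"
  shows "(\<lambda>n. LINT x|lebesgue. F (real (Suc n) * (V (x + y /\<^sub>R real (Suc n)) - V x)))
     \<longlonglongrightarrow> (LINT x|lebesgue. F (classical_gradient V x \<bullet> y))"
proof -
  note [measurable] = lip_ae_diff_borel classical_gradient_measurable
  obtain L where L: "L \<ge> 0" "\<And>x y. \<bar>V x - V y\<bar> \<le> L * norm (x - y)" using lip_ae_diff_bound by blast
  obtain R where R: "S \<subseteq> cball 0 R" using bounded_subset_cball_0[OF S] by blast
  have F [measurable]: "F \<in> borel_measurable borel"
    using assms(1) by (rule borel_measurable_continuous_onI)
  have "compact (F ` {- L * norm y..L * norm y})"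
    by (rule compact_continuous_image) (use assms(1) continuous_on_subset in auto)
  then have "bounded (F ` {- L * norm y..L * norm y})" by (rule compact_imp_bounded)
  then obtain C where C: "\<And>t. t \<in> {- L * norm y..L * norm y} \<Longrightarrow> \<bar>F t\<bar> \<le> C"
    unfolding bounded_iff real_norm_def by blast
  let ?q = "\<lambda>n x. real (Suc n) * (V (x + y /\<^sub>R real (Suc n)) - V x)"
  have q: "\<bar>?q n x\<bar> \<le> L * norm y" for n x
  proof -
    have "\<bar>V (x + y /\<^sub>R real (Suc n)) - V x\<bar> \<le> L * (norm y / real (Suc n))"
      using L(2)[of "x + y /\<^sub>R real (Suc n)" x] by (simp add: divide_inverse mult.commute)
    then have "\<bar>V (x + y /\<^sub>R real (Suc n)) - V x\<bar> \<le> L * norm y / real (Suc n)" by simp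
    then show ?thesis
      by (simp only: pos_le_divide_eq of_nat_0_less_iff zero_less_Suc mult.commute abs_mult abs_of_nat)
  qed
  have q0: "?q n x = 0" if "x \<notin> cball 0 (R + norm y)" for n x
  proof -
    have "norm (y /\<^sub>R real (Suc n)) \<le> norm y" by (simp add: field_simps mult_left_le_one_le)
    moreover have "norm x \<le> norm (x + y /\<^sub>R real (Suc n)) + norm (y /\<^sub>R real (Suc n))"
      using norm_triangle_ineq4[of "x + y /\<^sub>R real (Suc n)" "y /\<^sub>R real (Suc n)"] by simp
    moreover have "norm x > R + norm y" using that by simp
    moreover have "norm y \<ge> 0" by simp
    ultimately have "norm (x + y /\<^sub>R real (Suc n)) > R" "norm x > R" by linarith+
    then have "x + y /\<^sub>R real (Suc n) \<notin> S" "x \<notin> S" using R by (auto simp: subset_iff)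
    then have "V (x + y /\<^sub>R real (Suc n)) = 0" "V x = 0" using V by (auto simp: lip_ae_diff_def)
    then show ?thesis by simp
  qed
  show ?thesis
  proof (rule integral_dominated_convergence[where w="\<lambda>x. C * indicator (cball 0 (R + norm y)) x"])
    have "(\<lambda>x. classical_gradient V x \<bullet> y) \<in> borel_measurable lebesgue" by measurable
    then show "(\<lambda>x. F (classical_gradient V x \<bullet> y)) \<in> borel_measurable lebesgue"
      using F by (rule measurable_compose)
    show "(\<lambda>x. F (?q n x)) \<in> borel_measurable lebesgue" for n
      by (rule borel_measurable_lebesgueI) measurable
    show "integrable lebesgue (\<lambda>x. C * indicator (cball 0 (R + norm y)) x :: real)"
      by (intro integrable_mult_right integrable_real_indicator)
         (use emeasure_lborel_cball_finite[of 0 "R + norm y"] in \<open>auto simp: less_top[symmetric]\<close>)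
    show "AE x in lebesgue. (\<lambda>n. F (?q n x)) \<longlonglongrightarrow> F (classical_gradient V x \<bullet> y)"
      using AE_difference_quotient_tendsto[of y]
    proof eventually_elim
      case (elim x)
      have "isCont F (classical_gradient V x \<bullet> y)"
        using assms(1) continuous_on_eq_continuous_at open_UNIV by blast
      from isCont_tendsto_compose[OF this elim] show ?case .
    qed
    show "AE x in lebesgue. norm (F (?q n x)) \<le> C * indicator (cball 0 (R + norm y)) x" for n
    proof (rule AE_I2)
      fix x :: "real^'d"
      show "norm (F (?q n x)) \<le> C * indicator (cball 0 (R + norm y)) x"
      proof (cases "x \<in> cball 0 (R + norm y)")
        case True
        have "?q n x \<in> {- L * norm y..L * norm y}"
          using q[of n x] unfolding atLeastAtMost_iff abs_le_iff by linarith
        from C[OF this] True show ?thesis by simp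
      next
        case False
        show ?thesis unfolding q0[OF False] assms(2) using False by simp
      qed
    qed
  qed
qed

text \<open>By translation invariance of Lebesgue measure each difference quotient has integral 0. Applied to
the product of a Lipschitz function and a test function this is integration by parts.\<close>

lemma integral_classical_gradient_eq_0: "(LINT x|lebesgue. classical_gradient V x \<bullet> y) = 0"
proof -
  note [measurable] = lip_ae_diff_borel
  have V0: "integrable lebesgue V"
    using integrable_continuous_supported[OF S lip_ae_diff_continuous] V by (auto simp: lip_ae_diff_def)
  have "(LINT x|lebesgue. real (Suc n) * (V (x + y /\<^sub>R real (Suc n)) - V x)) = 0" for n
  proof -
    let ?y = "y /\<^sub>R real (Suc n)"
    have eq: "(LINT x|lebesgue. V (x + ?y)) = (LINT x|lebesgue. V x)"
      by (rule integral_lebesgue_translate) measurable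
    obtain B where B: "\<And>x. \<bar>V x\<bar> \<le> B" using lip_ae_diff_bounded by blast
    have "integrable lebesgue (\<lambda>x. V (x + ?y))"
    proof (rule integrable_bounded_support[where B=B and S="(\<lambda>x. x - ?y) ` S"])
      show "(\<lambda>x. V (x + ?y)) \<in> borel_measurable lebesgue"
        by (rule borel_measurable_lebesgueI) measurable
      show "bounded ((\<lambda>x. x - ?y) ` S)" using S by (rule bounded_translation_minus)
      fix x assume "x \<notin> (\<lambda>x. x - ?y) ` S"
      then have "x + ?y \<notin> S" by (metis add_diff_cancel imageI)
      then show "V (x + ?y) = 0" using V by (simp add: lip_ae_diff_def)
    qed (use B in auto)
    with V0 eq show ?thesis by simp
  qed
  then show ?thesis
    using integral_difference_quotient_tendsto[of "\<lambda>x. x" y] by (simp add: LIMSEQ_const_iff)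
qed

lemma integrable_gradient_square: "integrable lebesgue (\<lambda>x. (norm (classical_gradient V x))\<^sup>2)"
proof -
  note [measurable] = lip_ae_diff_borel classical_gradient_measurable
  obtain L where L: "L \<ge> 0" "\<And>x. norm (classical_gradient V x) \<le> L"
    using classical_gradient_bounded by blast
  show ?thesis
    by (rule integrable_bounded_support[where B="L\<^sup>2" and S="closure S"])
       (use L S classical_gradient_outside in \<open>auto simp: power_mono\<close>)
qed

end
end

lemma integrable_translate_diff_square:
  fixes V :: "real^'d \<Rightarrow> real"
  assumes V: "lip_ae_diff S V" and S: "bounded S"
  shows "integrable lebesgue (\<lambda>x. (V (x + a) - V (x + b))\<^sup>2)"
proof -
  obtain B where B: "\<And>x. \<bar>V x\<bar> \<le> B" using lip_ae_diff_bounded[OF V S] by blast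
  note [measurable] = lip_ae_diff_borel[OF V]
  show ?thesis
  proof (rule integrable_bounded_support[where B="(2 * B)\<^sup>2" and S="(\<lambda>x. x - a) ` S \<union> (\<lambda>x. x - b) ` S"])
    show "(\<lambda>x. (V (x + a) - V (x + b))\<^sup>2) \<in> borel_measurable lebesgue"
      by (rule borel_measurable_lebesgueI) measurable
    show "norm ((V (x + a) - V (x + b))\<^sup>2) \<le> (2 * B)\<^sup>2" for x
    proof -
      have "\<bar>V (x + a) - V (x + b)\<bar> \<le> 2 * B" using B[of "x + a"] B[of "x + b"] by linarith
      then have "\<bar>V (x + a) - V (x + b)\<bar>\<^sup>2 \<le> (2 * B)\<^sup>2" by (rule power_mono) simp
      then show ?thesis by simp
    qed
    show "bounded ((\<lambda>x. x - a) ` S \<union> (\<lambda>x. x - b) ` S)"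
      using S by (simp add: bounded_translation_minus)
    fix x assume x: "x \<notin> (\<lambda>x. x - a) ` S \<union> (\<lambda>x. x - b) ` S"
    have "x + a \<notin> S"
    proof
      assume "x + a \<in> S"
      then have "x + a - a \<in> (\<lambda>x. x - a) ` S" by (rule imageI)
      with x show False by simp
    qed
    moreover have "x + b \<notin> S"
    proof
      assume "x + b \<in> S"
      then have "x + b - b \<in> (\<lambda>x. x - b) ` S" by (rule imageI)
      with x show False by simp
    qed
    ultimately show "(V (x + a) - V (x + b))\<^sup>2 = 0" using V by (simp add: lip_ae_diff_def)
  qed
qed

text \<open>The shift by \<open>y\<close> is composed of \<open>n\<close> shifts by \<open>y / n\<close>. By convexity of the square and translation
invariance the left-hand side is at most the integral of the squared difference quotient with step
\<open>y / n\<close>, for every \<open>n\<close>, and this converges to the integral of \<open>(\<nabla>V \<bullet> y)\<^sup>2\<close>. Integrating the gradient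
along segments instead would fail for segments inside the exceptional null set.\<close>

lemma translation_estimate:
  fixes V :: "real^'d \<Rightarrow> real"
  assumes V: "lip_ae_diff S V" and S: "bounded S"
  shows "(LINT x|lebesgue. (V (x + y) - V x)\<^sup>2)
    \<le> (norm y)\<^sup>2 * (LINT x|lebesgue. (norm (classical_gradient V x))\<^sup>2)"
proof -
  note [measurable] = lip_ae_diff_borel[OF V] classical_gradient_measurable[OF V]
  have "(LINT x|lebesgue. (V (x + y) - V x)\<^sup>2) \<le>
      (LINT x|lebesgue. (real (Suc n) * (V (x + y /\<^sub>R real (Suc n)) - V x))\<^sup>2)" for n
  proof -
    let ?h = "y /\<^sub>R real (Suc n)"
    let ?d = "\<lambda>k x. V (x + real (Suc k) *\<^sub>R ?h) - V (x + real k *\<^sub>R ?h)"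
    have pt: "(V (x + y) - V x)\<^sup>2 \<le> (\<Sum>k<Suc n. (?d k x)\<^sup>2) * real (Suc n)" for x
    proof -
      have "(\<Sum>k<Suc n. ?d k x) = V (x + real (Suc n) *\<^sub>R ?h) - V (x + real 0 *\<^sub>R ?h)"
        by (rule sum_lessThan_telescope)
      also have "\<dots> = V (x + y) - V x" by (simp del: of_nat_Suc)
      finally show ?thesis
        using sum_squared_le_sum_of_squares[of "\<lambda>k. ?d k x" "{..<Suc n}"] by (simp only: card_lessThan)
    qed
    have int: "integrable lebesgue (\<lambda>x. (?d k x)\<^sup>2)" for k
      by (rule integrable_translate_diff_square[OF V S])
    have eq: "(LINT x|lebesgue. (?d k x)\<^sup>2) = (LINT x|lebesgue. (V (x + ?h) - V x)\<^sup>2)" for k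
    proof -
      have "(LINT x|lebesgue. (V ((x + real k *\<^sub>R ?h) + ?h) - V (x + real k *\<^sub>R ?h))\<^sup>2)
          = (LINT x|lebesgue. (V (x + ?h) - V x)\<^sup>2)"
        by (rule integral_lebesgue_translate) measurable
      moreover have "x + real (Suc k) *\<^sub>R ?h = (x + real k *\<^sub>R ?h) + ?h" for x
        by (simp add: scaleR_add_left algebra_simps)
      ultimately show ?thesis by presburger
    qed
    have "(LINT x|lebesgue. (V (x + y) - V x)\<^sup>2) \<le> (LINT x|lebesgue. (\<Sum>k<Suc n. (?d k x)\<^sup>2) * real (Suc n))"
      using integrable_translate_diff_square[OF V S, of y 0]
      by (intro integral_mono integrable_mult_left Bochner_Integration.integrable_sum int pt) simp
    also have "\<dots> = (\<Sum>k<Suc n. (LINT x|lebesgue. (?d k x)\<^sup>2)) * real (Suc n)"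
      by (simp only: integral_mult_left_zero Bochner_Integration.integral_sum[OF int])
    also have "\<dots> = (real (Suc n))\<^sup>2 * (LINT x|lebesgue. (V (x + ?h) - V x)\<^sup>2)"
      unfolding eq by (simp add: power2_eq_square)
    also have "\<dots> = (LINT x|lebesgue. (real (Suc n) * (V (x + ?h) - V x))\<^sup>2)"
      by (simp only: power_mult_distrib integral_mult_right_zero)
    finally show ?thesis .
  qed
  then have "(LINT x|lebesgue. (V (x + y) - V x)\<^sup>2)
      \<le> (LINT x|lebesgue. (classical_gradient V x \<bullet> y)\<^sup>2)"
    by (intro LIMSEQ_le_const[OF integral_difference_quotient_tendsto[OF V S, of "\<lambda>t. t\<^sup>2"]])
       (auto intro!: continuous_intros)
  also have "\<dots> \<le> (LINT x|lebesgue. (norm y)\<^sup>2 * (norm (classical_gradient V x))\<^sup>2)"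
  proof (rule integral_mono)
    have le: "(classical_gradient V x \<bullet> y)\<^sup>2 \<le> (norm y)\<^sup>2 * (norm (classical_gradient V x))\<^sup>2" for x
      using Cauchy_Schwarz_ineq[of "classical_gradient V x" y] by (simp add: dot_square_norm mult.commute)
    then show "\<And>x. (classical_gradient V x \<bullet> y)\<^sup>2 \<le> (norm y)\<^sup>2 * (norm (classical_gradient V x))\<^sup>2" .
    show i: "integrable lebesgue (\<lambda>x. (norm y)\<^sup>2 * (norm (classical_gradient V x))\<^sup>2)"
      by (intro integrable_mult_right integrable_gradient_square[OF V S])
    show "integrable lebesgue (\<lambda>x. (classical_gradient V x \<bullet> y)\<^sup>2)"
      by (rule Bochner_Integration.integrable_bound[OF i]) (use le in auto)
  qed
  finally show ?thesis by simp
qed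

text \<open>A shift longer than the diameter of the support makes the supports of \<open>V\<close> and of its translate
disjoint, so the left-hand side of the translation estimate is twice the squared \<open>L\<^sup>2\<close> norm of \<open>V\<close>.\<close>

lemma poincare_inequality:
  fixes V :: "real^'d \<Rightarrow> real"
  assumes V: "lip_ae_diff S V" and S: "S \<subseteq> cball 0 R" and R: "R \<ge> 0"
  shows "(LINT x|lebesgue. (V x)\<^sup>2)
    \<le> (2 * R + 1)\<^sup>2 * (LINT x|lebesgue. (norm (classical_gradient V x))\<^sup>2)"
proof -
  have bS: "bounded S" using S bounded_cball bounded_subset by blast
  obtain y :: "real^'d" where y: "norm y = 2 * R + 1"
    using vector_choose_size[of "2 * R + 1"] R by auto
  have disj: "(V (x + y) - V x)\<^sup>2 = (V (x + y))\<^sup>2 + (V x)\<^sup>2" for x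
  proof -
    have "V (x + y) = 0 \<or> V x = 0"
    proof (rule ccontr)
      assume "\<not> ?thesis"
      then have "x + y \<in> S" "x \<in> S" using V by (auto simp: lip_ae_diff_def)
      then have "norm (x + y) \<le> R" "norm x \<le> R" using S by auto
      moreover have "norm y \<le> norm (x + y) + norm x"
        using norm_triangle_ineq4[of "x + y" x] by simp
      ultimately show False using y by linarith
    qed
    then show ?thesis by (auto simp: power2_diff)
  qed
  have cont: "continuous_on UNIV (\<lambda>x. (V x)\<^sup>2)"
    by (intro continuous_intros lip_ae_diff_continuous[OF V])
  have i1: "integrable lebesgue (\<lambda>x. (V x)\<^sup>2)"
    using V by (intro integrable_continuous_supported[OF bS cont]) (auto simp: lip_ae_diff_def)
  have i2: "integrable lebesgue (\<lambda>x. (V (x + y))\<^sup>2)"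
  proof (rule Bochner_Integration.integrable_bound)
    show "integrable lebesgue (\<lambda>x. (V (x + y) - V (x + 0))\<^sup>2)"
      by (rule integrable_translate_diff_square[OF V bS])
    show "(\<lambda>x. (V (x + y))\<^sup>2) \<in> borel_measurable lebesgue"
      by (intro borel_measurable_lebesgueI borel_measurable_power measurable_compose[OF _ lip_ae_diff_borel[OF V]]) simp
  qed (simp add: disj)
  have "(LINT x|lebesgue. (V (x + y))\<^sup>2) = (LINT x|lebesgue. (V x)\<^sup>2)"
    using lip_ae_diff_borel[OF V] by (intro integral_lebesgue_translate[of "\<lambda>x. (V x)\<^sup>2"]) simp
  then have "(LINT x|lebesgue. (V (x + y) - V x)\<^sup>2) = 2 * (LINT x|lebesgue. (V x)\<^sup>2)"
    unfolding disj by (simp add: i1 i2)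
  with translation_estimate[OF V bS, of y, unfolded y]
  have "2 * (LINT x|lebesgue. (V x)\<^sup>2)
      \<le> (2 * R + 1)\<^sup>2 * (LINT x|lebesgue. (norm (classical_gradient V x))\<^sup>2)"
    by simp
  moreover have "(LINT x|lebesgue. (V x)\<^sup>2) \<ge> 0" by simp
  ultimately show ?thesis by linarith
qed

section \<open>The Sobolev inequality in dimension at most three\<close>

abbreviation unit_cube :: "(real^'d) set" where
  "unit_cube \<equiv> cbox 0 One"

text \<open>The mean value of \<open>V\<close> over the cube of side \<open>s\<close> with corner \<open>x\<close>; the unit cube has content 1.\<close>

definition cube_average :: "real \<Rightarrow> (real^'d \<Rightarrow> real) \<Rightarrow> real^'d \<Rightarrow> real" where
  "cube_average s V x = integral unit_cube (\<lambda>z. V (x + s *\<^sub>R z))"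

lemma norm_unit_cube_le:
  fixes z :: "real^'d"
  assumes "z \<in> unit_cube"
  shows "(norm z)\<^sup>2 \<le> real CARD('d)"
proof -
  have "(z $ i)\<^sup>2 \<le> 1" for i
  proof -
    have "(One :: real^'d) \<bullet> axis i 1 = 1"
      using inner_sum_left_Basis[of "axis i 1 :: real^'d" "\<lambda>_. 1"] by (auto simp: Basis_vec_def)
    then have one: "(One :: real^'d) $ i = 1" by (simp only: inner_axis inner_real_def mult_1_right)
    have "0 \<le> z $ i" "z $ i \<le> 1"
      using assms one unfolding mem_box_cart by (metis zero_index)+
    then show ?thesis by (simp add: power_le_one)
  qed
  then have "(\<Sum>i\<in>UNIV. (z $ i)\<^sup>2) \<le> (\<Sum>i\<in>(UNIV :: 'd set). 1)" by (intro sum_mono) auto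
  then show ?thesis by (simp only: power2_norm_eq_inner) (simp add: inner_vec_def power2_eq_square)
qed

lemma square_integral_unit_cube_le:
  fixes f :: "real^'d \<Rightarrow> real"
  assumes "continuous_on unit_cube f"
  shows "(integral unit_cube f)\<^sup>2 \<le> integral unit_cube (\<lambda>z. (f z)\<^sup>2)"
proof -
  define m where "m = integral unit_cube f"
  have f: "f integrable_on unit_cube" and f2: "(\<lambda>z. (f z)\<^sup>2) integrable_on unit_cube"
    using assms by (auto intro!: integrable_continuous continuous_intros)
  have "0 \<le> integral unit_cube (\<lambda>z. (f z - m)\<^sup>2)"
    using assms by (intro integral_nonneg integrable_continuous continuous_intros) auto
  also have "(\<lambda>z. (f z - m)\<^sup>2) = (\<lambda>z. (f z)\<^sup>2 - 2 * m * f z + m\<^sup>2)"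
    by (auto simp: power2_diff algebra_simps)
  also have "integral unit_cube \<dots> = integral unit_cube (\<lambda>z. (f z)\<^sup>2) - 2 * m * m + m\<^sup>2"
    using has_integral_add[OF has_integral_diff[OF integrable_integral[OF f2]
        has_integral_mult_right[OF integrable_integral[OF f], of "2 * m"]] has_integral_const[of "m\<^sup>2" 0 One]]
    by (intro integral_unique) (simp add: m_def)
  finally show ?thesis by (simp add: m_def power2_eq_square)
qed

lemma integral_lebesgue_eq_integral_cbox:
  fixes f :: "real^'d \<Rightarrow> real"
  assumes "continuous_on UNIV f" "\<And>x. x \<notin> cbox a b \<Longrightarrow> f x = 0"
  shows "(LINT x|lebesgue. f x) = integral (cbox a b) f"
proof -
  have "integrable (lebesgue_on (cbox a b)) f"
    using assms(1) by (intro continuous_imp_integrable continuous_on_subset[OF assms(1)]) auto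
  then have "(LINT x|lebesgue_on (cbox a b). f x) = integral (cbox a b) f"
    by (rule lebesgue_integral_eq_integral) auto
  then show ?thesis using integral_lebesgue_on_supported[of "cbox a b" f] assms(2) by simp
qed

text \<open>Averaging at scale \<open>s\<close> maps \<open>L\<^sup>2\<close> to \<open>L\<^sup>\<infinity>\<close>, at the price of the volume of the cube.\<close>

lemma square_cube_average_le:
  fixes f :: "real^'d \<Rightarrow> real"
  assumes cont: "continuous_on UNIV f" and S: "bounded S" "\<And>x. x \<notin> S \<Longrightarrow> f x = 0" and s: "s > 0"
  shows "(cube_average s f x)\<^sup>2 \<le> (LINT x|lebesgue. (f x)\<^sup>2) / s ^ CARD('d)"
proof -
  let ?g = "\<lambda>z. (f (x + s *\<^sub>R z))\<^sup>2"
  have cg: "continuous_on A (\<lambda>z. f (x + s *\<^sub>R z))" for A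
    by (rule continuous_on_compose2[OF cont]) (auto intro!: continuous_intros)
  have cg2: "continuous_on A ?g" for A
    by (intro continuous_on_power cg)
  have ig: "integrable lebesgue ?g"
  proof (rule integrable_continuous_supported)
    show "bounded ((\<lambda>y. (1 / s) *\<^sub>R (y - x)) ` S)"
      using bounded_scaling[OF bounded_translation_minus[OF S(1), of x], of "1/s"] by (simp add: image_image)
    fix z assume z: "z \<notin> (\<lambda>y. (1 / s) *\<^sub>R (y - x)) ` S"
    have "x + s *\<^sub>R z \<notin> S"
    proof
      assume "x + s *\<^sub>R z \<in> S"
      then have "(1 / s) *\<^sub>R (x + s *\<^sub>R z - x) \<in> (\<lambda>y. (1 / s) *\<^sub>R (y - x)) ` S" by (rule imageI)
      with z s show False by simp
    qed
    then show "?g z = 0" using S(2) by simp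
  qed (rule cg2)
  have "(cube_average s f x)\<^sup>2 \<le> integral unit_cube ?g"
    unfolding cube_average_def by (rule square_integral_unit_cube_le[OF cg])
  also have "\<dots> = (LINT z|lebesgue_on unit_cube. ?g z)"
    by (rule lebesgue_integral_eq_integral[symmetric]) (auto intro!: continuous_imp_integrable cg2)
  also have "\<dots> = (LINT z|lebesgue. indicator unit_cube z *\<^sub>R ?g z)"
    by (simp add: integral_restrict_space)
  also have "\<dots> \<le> (LINT z|lebesgue. ?g z)"
    by (intro integral_mono integrable_mult_indicator ig) (auto simp: indicator_def)
  also have "\<dots> = (LINT x|lebesgue. (f x)\<^sup>2) / s ^ DIM(real^'d)"
    by (rule integral_lebesgue_affine[of "\<lambda>y. (f y)\<^sup>2"])
       (use s cont in \<open>auto intro!: borel_measurable_continuous_onI continuous_intros\<close>)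
  finally show ?thesis by simp
qed

context
  fixes S :: "(real^'d) set" and V :: "real^'d \<Rightarrow> real" and \<Gamma> d :: real
  assumes V: "lip_ae_diff S V" and S: "bounded S"
  defines "\<Gamma> \<equiv> sqrt (LINT x|lebesgue. (norm (classical_gradient V x))\<^sup>2)"
    and "d \<equiv> real CARD('d)"
begin

lemma Gamma_nonneg: "\<Gamma> \<ge> 0" by (simp add: \<Gamma>_def)

lemma Gamma_square: "(LINT x|lebesgue. (norm (classical_gradient V x))\<^sup>2) = \<Gamma>\<^sup>2"
  by (simp add: \<Gamma>_def)

lemma shift_continuous:
  assumes "continuous_on A f"
  shows "continuous_on A (\<lambda>p. V (f p))"
  by (rule continuous_on_compose2[OF lip_ae_diff_continuous[OF V, of UNIV] assms]) auto

text \<open>Outside one compact box \<open>V\<close> and all its averages at scales up to 1 vanish. Integrals over the space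
thereby become integrals of continuous functions over boxes, whose order can be exchanged.\<close>

lemma supporting_box:
  obtains a b where "\<And>x (s::real) z. x \<notin> cbox a b \<Longrightarrow> 0 \<le> s \<Longrightarrow> s \<le> 1 \<Longrightarrow> z \<in> unit_cube \<Longrightarrow> V (x + s *\<^sub>R z) = 0"
proof -
  obtain R where R: "S \<subseteq> cball 0 R" using bounded_subset_cball_0[OF S] by blast
  obtain c :: "real^'d" where c: "cball 0 (R + sqrt d) \<subseteq> cbox (-c) c"
    using bounded_subset_cbox_symmetric[OF bounded_cball] by blast
  show ?thesis
  proof (rule that)
    fix x :: "real^'d" and s :: real and z assume x: "x \<notin> cbox (-c) c" and s: "0 \<le> s" "s \<le> 1" and z: "z \<in> (unit_cube :: (real^'d) set)"
    have "norm z \<le> sqrt d" using real_le_rsqrt[OF norm_unit_cube_le[OF z]] by (simp add: d_def)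
    moreover have "s * norm z \<le> 1 * norm z" using s by (intro mult_right_mono) auto
    ultimately have "norm (s *\<^sub>R z) \<le> sqrt d" using s by simp
    moreover have "norm x > R + sqrt d" using x c by (auto simp: subset_iff not_le)
    moreover have "norm x \<le> norm (x + s *\<^sub>R z) + norm (s *\<^sub>R z)"
      using norm_triangle_ineq4[of "x + s *\<^sub>R z" "s *\<^sub>R z"] by simp
    ultimately have "norm (x + s *\<^sub>R z) > R" by linarith
    then have "x + s *\<^sub>R z \<notin> S" using R by (auto simp: subset_iff)
    then show "V (x + s *\<^sub>R z) = 0" using V by (simp add: lip_ae_diff_def)
  qed
qed

lemma shift_L2_le:
  assumes "0 \<le> s" "z \<in> unit_cube"
  shows "(LINT x|lebesgue. (V (x + s *\<^sub>R z) - V x)\<^sup>2) \<le> s\<^sup>2 * d * \<Gamma>\<^sup>2"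
proof -
  have "(LINT x|lebesgue. (V (x + s *\<^sub>R z) - V x)\<^sup>2) \<le> (norm (s *\<^sub>R z))\<^sup>2 * \<Gamma>\<^sup>2"
    using translation_estimate[OF V S, of "s *\<^sub>R z"] by (simp add: Gamma_square)
  also have "(norm (s *\<^sub>R z))\<^sup>2 = s\<^sup>2 * (norm z)\<^sup>2" by (simp add: power_mult_distrib)
  also have "s\<^sup>2 * (norm z)\<^sup>2 * \<Gamma>\<^sup>2 \<le> s\<^sup>2 * d * \<Gamma>\<^sup>2"
    using norm_unit_cube_le[OF assms(2)] by (intro mult_right_mono mult_left_mono) (auto simp: d_def)
  finally show ?thesis .
qed

lemma cube_average_continuous: "continuous_on UNIV (cube_average s V)"
  unfolding cube_average_def
  by (rule integral_continuous_on_param) (auto simp: case_prod_beta intro!: shift_continuous continuous_intros)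

text \<open>Jensen's inequality and an exchange of integrals reduce this to shifts by a single vector of
length at most \<open>s \<surd>d\<close>.\<close>

lemma cube_average_L2_le:
  assumes s: "0 \<le> s" "s \<le> 1"
  shows "(LINT x|lebesgue. (cube_average s V x - V x)\<^sup>2) \<le> s\<^sup>2 * d * \<Gamma>\<^sup>2"
proof -
  obtain a b where J: "\<And>x (s::real) z. x \<notin> cbox a b \<Longrightarrow> 0 \<le> s \<Longrightarrow> s \<le> 1 \<Longrightarrow> z \<in> unit_cube \<Longrightarrow> V (x + s *\<^sub>R z) = 0"
    using supporting_box by blast
  have J0: "V x = 0" if "x \<notin> cbox a b" for x
    using J[OF that, of 0 0] by (simp add: mem_box)
  have contA: "continuous_on A (cube_average s V)" for A
    using cube_average_continuous continuous_on_subset by blast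
  let ?q = "\<lambda>x z. (V (x + s *\<^sub>R z) - V x)\<^sup>2"
  have cont: "continuous_on A (\<lambda>(x, z). ?q x z)" for A
    by (auto simp: case_prod_beta intro!: shift_continuous continuous_intros)
  have cz: "continuous_on A (\<lambda>z. ?q x z)" and cx: "continuous_on A (\<lambda>x. ?q x z)" for A x z
    by (auto intro!: shift_continuous continuous_intros)
  have "(LINT x|lebesgue. (cube_average s V x - V x)\<^sup>2) = integral (cbox a b) (\<lambda>x. (cube_average s V x - V x)\<^sup>2)"
  proof (rule integral_lebesgue_eq_integral_cbox)
    show "continuous_on UNIV (\<lambda>x. (cube_average s V x - V x)\<^sup>2)"
      by (intro continuous_intros contA lip_ae_diff_continuous[OF V])
    fix x assume x: "x \<notin> cbox a b"
    have "cube_average s V x = integral unit_cube (\<lambda>z::real^'d. 0::real)"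
      unfolding cube_average_def by (rule Henstock_Kurzweil_Integration.integral_cong) (use J[OF x] s in auto)
    then show "(cube_average s V x - V x)\<^sup>2 = 0" using J0[OF x] by simp
  qed
  also have "\<dots> \<le> integral (cbox a b) (\<lambda>x. integral unit_cube (?q x))"
  proof (rule integral_le)
    show "(\<lambda>x. (cube_average s V x - V x)\<^sup>2) integrable_on cbox a b"
      by (intro integrable_continuous continuous_intros contA lip_ae_diff_continuous[OF V])
    have "continuous_on (cbox a b) (\<lambda>x. integral unit_cube (?q x))"
      by (rule integral_continuous_on_param) (rule cont)
    then show "(\<lambda>x. integral unit_cube (?q x)) integrable_on cbox a b"
      by (rule integrable_continuous)
    fix x
    have "cube_average s V x - V x = integral unit_cube (\<lambda>z. V (x + s *\<^sub>R z) - V x)"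
      unfolding cube_average_def
      by (subst integral_diff) (auto intro!: integrable_continuous shift_continuous continuous_intros)
    moreover have "(integral unit_cube (\<lambda>z. V (x + s *\<^sub>R z) - V x))\<^sup>2 \<le> integral unit_cube (?q x)"
      by (intro square_integral_unit_cube_le shift_continuous continuous_intros)
    ultimately show "(cube_average s V x - V x)\<^sup>2 \<le> integral unit_cube (?q x)"
      by (simp only:)
  qed
  also have "\<dots> = integral unit_cube (\<lambda>z. integral (cbox a b) (\<lambda>x. ?q x z))"
    by (rule integral_swap_continuous) (rule cont)
  also have "\<dots> \<le> integral unit_cube (\<lambda>z::real^'d. s\<^sup>2 * d * \<Gamma>\<^sup>2)"
  proof (rule integral_le)
    have "continuous_on unit_cube (\<lambda>z. integral (cbox a b) (\<lambda>x. ?q x z))"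
      by (rule integral_continuous_on_param) (auto simp: case_prod_beta intro!: shift_continuous continuous_intros)
    then show "(\<lambda>z. integral (cbox a b) (\<lambda>x. ?q x z)) integrable_on unit_cube"
      by (rule integrable_continuous)
    fix z :: "real^'d" assume z: "z \<in> unit_cube"
    have "integral (cbox a b) (\<lambda>x. ?q x z) = (LINT x|lebesgue. ?q x z)"
      by (rule integral_lebesgue_eq_integral_cbox[OF cx, symmetric]) (use J[OF _ s z] J0 in auto)
    also have "\<dots> \<le> s\<^sup>2 * d * \<Gamma>\<^sup>2" by (rule shift_L2_le[OF s(1) z])
    finally show "integral (cbox a b) (\<lambda>x. ?q x z) \<le> s\<^sup>2 * d * \<Gamma>\<^sup>2" .
  qed auto
  finally show ?thesis by simp
qed

lemma abs_cube_average_shift_le: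
  assumes s: "0 < s" "0 \<le> t" "z \<in> unit_cube"
  shows "\<bar>cube_average s (\<lambda>y. V (y + t *\<^sub>R z) - V y) x\<bar> \<le> t * sqrt d * \<Gamma> / sqrt (s ^ CARD('d))"
proof -
  let ?f = "\<lambda>y. V (y + t *\<^sub>R z) - V y"
  have "(cube_average s ?f x)\<^sup>2 \<le> (LINT x|lebesgue. (?f x)\<^sup>2) / s ^ CARD('d)"
  proof (rule square_cube_average_le)
    show "continuous_on UNIV ?f" by (auto intro!: shift_continuous continuous_intros)
    show "bounded (S \<union> (\<lambda>y. y - t *\<^sub>R z) ` S)" using S by (simp add: bounded_translation_minus)
    fix y assume y: "y \<notin> S \<union> (\<lambda>y. y - t *\<^sub>R z) ` S"
    have "y + t *\<^sub>R z \<notin> S"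
    proof
      assume "y + t *\<^sub>R z \<in> S"
      then have "y + t *\<^sub>R z - t *\<^sub>R z \<in> (\<lambda>y. y - t *\<^sub>R z) ` S" by (rule imageI)
      with y show False by simp
    qed
    then show "?f y = 0" using y V by (simp add: lip_ae_diff_def)
  qed (rule s)
  also have "\<dots> \<le> t\<^sup>2 * d * \<Gamma>\<^sup>2 / s ^ CARD('d)"
    using s by (intro divide_right_mono shift_L2_le) auto
  also have "\<dots> = (t * sqrt d * \<Gamma> / sqrt (s ^ CARD('d)))\<^sup>2"
    using s by (simp add: power_mult_distrib power_divide d_def)
  finally show ?thesis
    using s Gamma_nonneg by (intro abs_le_square_iff[THEN iffD2, THEN order_trans[OF _ eq_refl]] ) (auto simp: d_def)
qed

text \<open>Averages at different scales commute, so both are compared with the twofold average. Either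
difference is a mean of averages, at one scale, of translates of \<open>V\<close> minus \<open>V\<close>; their sup norms are
controlled by the \<open>L\<^sup>2\<close> norms of the translation differences.\<close>

lemma abs_cube_average_diff_le:
  assumes s: "0 < s'" "s' \<le> s"
  shows "\<bar>cube_average s' V x - cube_average s V x\<bar> \<le> 2 * (s * sqrt d * \<Gamma> / sqrt (s' ^ CARD('d)))"
proof -
  let ?B = "s * sqrt d * \<Gamma> / sqrt (s' ^ CARD('d))"
  \<comment> \<open>The integrand of the twofold average, at scale \<open>s\<close> in \<open>z\<close> and at scale \<open>s'\<close> in \<open>z'\<close>.\<close>
  define F where "F z z' = V (x + s *\<^sub>R z + s' *\<^sub>R z')" for z z' :: "real^'d"
  define I1 where "I1 = integral unit_cube (\<lambda>z. integral unit_cube (F z))"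
  define I2 where "I2 = integral unit_cube (\<lambda>z'. integral unit_cube (\<lambda>z. F z z'))"
  have "I1 = I2"
    unfolding I1_def I2_def
    by (rule integral_swap_continuous)
       (auto simp: F_def case_prod_beta intro!: shift_continuous continuous_intros)
  have cont1: "continuous_on unit_cube (\<lambda>z. integral unit_cube (F z))"
    by (rule integral_continuous_on_param)
       (auto simp: F_def case_prod_beta intro!: shift_continuous continuous_intros)
  have cont2: "continuous_on unit_cube (\<lambda>z'. integral unit_cube (\<lambda>z. F z z'))"
    by (rule integral_continuous_on_param)
       (auto simp: F_def case_prod_beta intro!: shift_continuous continuous_intros)
  have int: "(\<lambda>z. V (x + t *\<^sub>R z)) integrable_on unit_cube" "(F z) integrable_on unit_cube"
     "(\<lambda>z. F z z') integrable_on unit_cube" for t z z'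
    by (auto simp: F_def intro!: integrable_continuous shift_continuous continuous_intros)
  have b1: "\<bar>integral unit_cube (F z) - cube_average s' V x\<bar> \<le> ?B" if z: "z \<in> unit_cube" for z
  proof -
    have "integral unit_cube (F z) - cube_average s' V x
       = cube_average s' (\<lambda>y. V (y + s *\<^sub>R z) - V y) x"
      unfolding cube_average_def integral_diff[OF int(2) int(1), symmetric] F_def
      by (simp add: algebra_simps)
    also have "\<bar>\<dots>\<bar> \<le> ?B" using s z by (intro abs_cube_average_shift_le) auto
    finally show ?thesis .
  qed
  have b2: "\<bar>integral unit_cube (\<lambda>z. F z z') - cube_average s V x\<bar> \<le> ?B" if z: "z' \<in> unit_cube" for z'
  proof -
    have "integral unit_cube (\<lambda>z. F z z') - cube_average s V x
       = integral unit_cube (\<lambda>z. F z z' - V (x + s *\<^sub>R z))"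
      unfolding cube_average_def by (rule integral_diff[OF int(3) int(1), symmetric])
    also have "\<dots> = cube_average s (\<lambda>y. V (y + s' *\<^sub>R z') - V y) x"
      by (simp only: F_def cube_average_def)
    also have "\<bar>\<dots>\<bar> \<le> s' * sqrt d * \<Gamma> / sqrt (s ^ CARD('d))" using s z by (intro abs_cube_average_shift_le) auto
    also have "\<dots> \<le> ?B"
      using s Gamma_nonneg by (intro frac_le mult_right_mono) (auto intro!: power_mono simp: d_def)
    finally show ?thesis .
  qed
  have B0: "?B \<ge> 0" using s Gamma_nonneg by (simp add: d_def)
  have "\<bar>I1 - cube_average s' V x\<bar> \<le> ?B"
  proof -
    have "I1 - cube_average s' V x = integral unit_cube (\<lambda>z. integral unit_cube (F z) - cube_average s' V x)"
      unfolding I1_def by (subst integral_diff) (auto intro!: integrable_continuous cont1)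
    also have "norm \<dots> \<le> integral unit_cube (\<lambda>z::real^'d. ?B)"
      by (rule Henstock_Kurzweil_Integration.integral_norm_bound_integral)
         (use b1 in \<open>auto intro!: integrable_continuous continuous_intros cont1\<close>)
    finally show ?thesis by simp
  qed
  moreover have "\<bar>I2 - cube_average s V x\<bar> \<le> ?B"
  proof -
    have "I2 - cube_average s V x = integral unit_cube (\<lambda>z'. integral unit_cube (\<lambda>z. F z z') - cube_average s V x)"
      unfolding I2_def by (subst integral_diff) (auto intro!: integrable_continuous cont2)
    also have "norm \<dots> \<le> integral unit_cube (\<lambda>z::real^'d. ?B)"
      by (rule Henstock_Kurzweil_Integration.integral_norm_bound_integral)
         (use b2 in \<open>auto intro!: integrable_continuous continuous_intros cont2\<close>)
    finally show ?thesis by simp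
  qed
  ultimately show ?thesis using \<open>I1 = I2\<close> by linarith
qed

lemma cube_average_integrable:
  assumes s: "0 \<le> s" "s \<le> 1" and t: "0 \<le> t" "t \<le> 1" and F: "continuous_on UNIV F" "F (0, 0, 0) = 0"
  shows "integrable lebesgue (\<lambda>x. F (V x, cube_average s V x, cube_average t V x) :: real)"
proof -
  obtain a b where J: "\<And>x (s::real) z. x \<notin> cbox a b \<Longrightarrow> 0 \<le> s \<Longrightarrow> s \<le> 1 \<Longrightarrow> z \<in> unit_cube \<Longrightarrow> V (x + s *\<^sub>R z) = 0"
    using supporting_box by blast
  have J0: "V x = 0" if "x \<notin> cbox a b" for x
    using J[OF that, of 0 0] by (simp add: mem_box)
  have JA: "cube_average s V x = 0" if x: "x \<notin> cbox a b" and s: "0 \<le> s" "s \<le> 1" for s x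
  proof -
    have "cube_average s V x = integral unit_cube (\<lambda>z::real^'d. 0::real)"
      unfolding cube_average_def by (rule Henstock_Kurzweil_Integration.integral_cong) (use J[OF x] s in auto)
    then show ?thesis by simp
  qed
  show ?thesis
  proof (rule integrable_continuous_supported[where S="cbox a b"])
    show "continuous_on UNIV (\<lambda>x. F (V x, cube_average s V x, cube_average t V x))"
      by (rule continuous_on_compose2[OF F(1)])
         (auto intro!: continuous_intros cube_average_continuous lip_ae_diff_continuous[OF V])
  qed (use F(2) J0 JA s t in auto)
qed

text \<open>The fourth power is split into the squared sup norm, of order \<open>s\<^sup>2\<^sup>-\<^sup>d\<close>, and the squared \<open>L\<^sup>2\<close>
norm, of order \<open>s\<^sup>2\<close>. The product \<open>s\<^sup>4\<^sup>-\<^sup>d\<close> is at most \<open>s\<close> because \<open>d \<le> 3\<close>.\<close>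

lemma cube_average_diff_L4_le:
  assumes d3: "CARD('d) \<le> 3" and s: "0 < s" "s \<le> 1"
  shows "(LINT x|lebesgue. (cube_average (s / 16) V x - cube_average s V x) ^ 4)
     \<le> 16 * 16 ^ CARD('d) * d\<^sup>2 * s * \<Gamma> ^ 4"
proof -
  let ?s = "s / 16"
  define D where "D x = cube_average ?s V x - cube_average s V x" for x
  define B where "B = 2 * (s * sqrt d * \<Gamma> / sqrt (?s ^ CARD('d)))"
  have s': "0 < ?s" "?s \<le> s" "?s \<le> 1" "0 \<le> ?s" "0 \<le> s" using s by auto
  have DB: "(D x)\<^sup>2 \<le> B\<^sup>2" for x
    using abs_cube_average_diff_le[OF s'(1,2), of x] unfolding D_def B_def
    by (intro abs_le_square_iff[THEN iffD1]) linarith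
  have intF: "integrable lebesgue (\<lambda>x. F (V x, cube_average ?s V x, cube_average s V x) :: real)"
    if "continuous_on UNIV F" "F (0, 0, 0) = 0" for F
    using cube_average_integrable[OF s'(4,3) s'(5) s(2) that] .
  have i2: "integrable lebesgue (\<lambda>x. (D x)\<^sup>2)"
    using intF[of "\<lambda>(v, a, b). (a - b)\<^sup>2"] by (simp add: D_def case_prod_beta continuous_intros)
  have i4: "integrable lebesgue (\<lambda>x. (D x) ^ 4)"
    using intF[of "\<lambda>(v, a, b). (a - b) ^ 4"] by (simp add: D_def case_prod_beta continuous_intros)
  have ia: "integrable lebesgue (\<lambda>x. (cube_average ?s V x - V x)\<^sup>2)"
    using intF[of "\<lambda>(v, a, b). (a - v)\<^sup>2"] by (simp add: case_prod_beta continuous_intros)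
  have ib: "integrable lebesgue (\<lambda>x. (cube_average s V x - V x)\<^sup>2)"
    using intF[of "\<lambda>(v, a, b). (b - v)\<^sup>2"] by (simp add: case_prod_beta continuous_intros)
  have "(LINT x|lebesgue. (D x)\<^sup>2)
      \<le> (LINT x|lebesgue. 2 * (cube_average ?s V x - V x)\<^sup>2 + 2 * (cube_average s V x - V x)\<^sup>2)"
  proof (intro integral_mono Bochner_Integration.integrable_add integrable_mult_right ia ib i2)
    fix x
    have "0 \<le> ((cube_average ?s V x - V x) + (cube_average s V x - V x))\<^sup>2" by simp
    then show "(D x)\<^sup>2 \<le> 2 * (cube_average ?s V x - V x)\<^sup>2 + 2 * (cube_average s V x - V x)\<^sup>2"
      unfolding D_def by (simp add: power2_eq_square algebra_simps)
  qed
  also have "\<dots> = 2 * (LINT x|lebesgue. (cube_average ?s V x - V x)\<^sup>2) + 2 * (LINT x|lebesgue. (cube_average s V x - V x)\<^sup>2)"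
    using ia ib by simp
  also have "\<dots> \<le> 2 * (?s\<^sup>2 * d * \<Gamma>\<^sup>2) + 2 * (s\<^sup>2 * d * \<Gamma>\<^sup>2)"
    using s' s by (intro add_mono mult_left_mono cube_average_L2_le) auto
  also have "\<dots> \<le> 4 * (s\<^sup>2 * d * \<Gamma>\<^sup>2)"
  proof -
    have "?s\<^sup>2 * d * \<Gamma>\<^sup>2 \<le> s\<^sup>2 * d * \<Gamma>\<^sup>2"
      using s' by (intro mult_right_mono power_mono) (auto simp: d_def)
    moreover have "2 * p + 2 * q \<le> 4 * q" if "p \<le> q" for p q :: real using that by simp
    ultimately show ?thesis by blast
  qed
  finally have L2: "(LINT x|lebesgue. (D x)\<^sup>2) \<le> 4 * (s\<^sup>2 * d * \<Gamma>\<^sup>2)" .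
  have "(LINT x|lebesgue. (D x) ^ 4) \<le> (LINT x|lebesgue. B\<^sup>2 * (D x)\<^sup>2)"
  proof (intro integral_mono integrable_mult_right i4 i2)
    fix x
    have "(D x) ^ 4 = (D x)\<^sup>2 * (D x)\<^sup>2" by (simp add: power2_eq_square power4_eq_xxxx)
    also have "\<dots> \<le> B\<^sup>2 * (D x)\<^sup>2" using DB by (intro mult_right_mono) auto
    finally show "(D x) ^ 4 \<le> B\<^sup>2 * (D x)\<^sup>2" .
  qed
  also have "\<dots> \<le> B\<^sup>2 * (4 * (s\<^sup>2 * d * \<Gamma>\<^sup>2))"
    using L2 by (simp add: mult_left_mono)
  also have "B\<^sup>2 = 4 * 16 ^ CARD('d) * (s\<^sup>2 * d * \<Gamma>\<^sup>2) / s ^ CARD('d)"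
    using s by (simp add: B_def power_mult_distrib power_divide d_def)
  also have "4 * 16 ^ CARD('d) * (s\<^sup>2 * d * \<Gamma>\<^sup>2) / s ^ CARD('d) * (4 * (s\<^sup>2 * d * \<Gamma>\<^sup>2))
     = 16 * 16 ^ CARD('d) * d\<^sup>2 * (s ^ 4 / s ^ CARD('d)) * \<Gamma> ^ 4"
    by (simp add: power2_eq_square power4_eq_xxxx)
  also have "\<dots> \<le> 16 * 16 ^ CARD('d) * d\<^sup>2 * s * \<Gamma> ^ 4"
  proof -
    have "s * s ^ 3 \<le> s * s ^ CARD('d)"
      using s d3 by (intro mult_left_mono power_decreasing) auto
    then have "s ^ 4 / s ^ CARD('d) \<le> s"
      using s by (simp add: divide_le_eq power_numeral_reduce eval_nat_numeral)
    then show ?thesis by (intro mult_right_mono mult_left_mono) auto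
  qed
  finally show ?thesis by (simp add: D_def)
qed

end

lemma cube_average_uniform_close:
  fixes V :: "real^'d \<Rightarrow> real"
  assumes V: "\<And>x y. \<bar>V x - V y\<bar> \<le> L * norm (x - y)" and cont: "continuous_on UNIV V" and s: "0 \<le> s" and L: "0 \<le> L"
  shows "\<bar>V x - cube_average s V x\<bar> \<le> L * sqrt CARD('d) * s"
proof -
  have c: "continuous_on A (\<lambda>z. V (x + s *\<^sub>R z))" for A
    by (rule continuous_on_compose2[OF cont]) (auto intro!: continuous_intros)
  have "V x - cube_average s V x = integral unit_cube (\<lambda>z. V x - V (x + s *\<^sub>R z))"
    unfolding cube_average_def by (subst integral_diff) (auto intro!: integrable_continuous c)
  also have "norm \<dots> \<le> integral unit_cube (\<lambda>z::real^'d. L * sqrt CARD('d) * s)"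
  proof (rule Henstock_Kurzweil_Integration.integral_norm_bound_integral)
    fix z :: "real^'d" assume z: "z \<in> unit_cube"
    have nz: "norm z \<le> sqrt CARD('d)" by (rule real_le_rsqrt[OF norm_unit_cube_le[OF z]])
    have "norm (V x - V (x + s *\<^sub>R z)) \<le> L * (s * norm z)"
      using V[of x "x + s *\<^sub>R z"] s by simp
    also have "\<dots> \<le> L * (s * sqrt CARD('d))" using nz s L by (intro mult_left_mono) auto
    finally show "norm (V x - V (x + s *\<^sub>R z)) \<le> L * sqrt CARD('d) * s" by (simp add: mult_ac)
  qed (auto intro!: integrable_continuous continuous_intros c)
  finally show ?thesis by simp
qed

text \<open>The telescoping sum \<open>V = (V - A\<^sub>n) + (\<Sum>k<n. A\<^sub>k\<^sub>+\<^sub>1 - A\<^sub>k) + A\<^sub>0\<close> over the averages at the scales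
\<open>16\<^sup>-\<^sup>k\<close> is multiplied by \<open>V\<^sup>3\<close> and integrated. With the ratio 16 the fourth roots of the bounds on the
increments form the geometric series of ratio \<open>1/2\<close>. The term \<open>A\<^sub>0\<close> is controlled by the Poincare
inequality, and the remainder \<open>V - A\<^sub>n\<close> tends to 0 uniformly because \<open>V\<close> is Lipschitz; the
Lipschitz constant does not survive the limit.\<close>

lemma sobolev_inequality_explicit:
  fixes V :: "real^'d \<Rightarrow> real"
  assumes V: "lip_ae_diff S V" and S: "S \<subseteq> cball 0 R" and R: "R \<ge> 0" and d3: "CARD('d) \<le> 3"
  defines "d \<equiv> real CARD('d)"
  defines "\<kappa> \<equiv> root 4 (16 * 16 ^ CARD('d) * d\<^sup>2)"
  defines "\<mu> \<equiv> root 4 (2 * (d + (2 * R + 1)\<^sup>2) * (2 * R + 1)\<^sup>2)"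
  shows "(LINT x|lebesgue. V x ^ 4)
    \<le> (2 * \<kappa> + \<mu>) ^ 4 * (LINT x|lebesgue. (norm (classical_gradient V x))\<^sup>2)\<^sup>2"
proof -
  have bS: "bounded S" using S bounded_cball bounded_subset by blast
  define \<Gamma> where "\<Gamma> = sqrt (LINT x|lebesgue. (norm (classical_gradient V x))\<^sup>2)"
  have \<Gamma>0: "\<Gamma> \<ge> 0" and \<Gamma>2: "(LINT x|lebesgue. (norm (classical_gradient V x))\<^sup>2) = \<Gamma>\<^sup>2"
    by (simp_all add: \<Gamma>_def)
  have \<kappa>: "\<kappa> \<ge> 0" "\<kappa> ^ 4 = 16 * 16 ^ CARD('d) * d\<^sup>2"
    unfolding \<kappa>_def by (auto simp: d_def)
  have \<mu>: "\<mu> \<ge> 0" "\<mu> ^ 4 = 2 * (d + (2 * R + 1)\<^sup>2) * (2 * R + 1)\<^sup>2"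
    unfolding \<mu>_def by (auto simp: d_def)
  define X where "X = root 4 (LINT x|lebesgue. V x ^ 4)"
  have X: "X \<ge> 0" "(LINT x|lebesgue. V x ^ 4) = X ^ 4"
    unfolding X_def by auto
  obtain L where L: "L \<ge> 0" "\<And>x y. \<bar>V x - V y\<bar> \<le> L * norm (x - y)" using lip_ae_diff_bound[OF V] by blast
  define A where "A n = cube_average ((1 / 16) ^ n) V" for n :: nat
  define D where "D n x = A (Suc n) x - A n x" for n x
  have s: "0 \<le> (1 / 16 :: real) ^ n" "(1 / 16 :: real) ^ n \<le> 1" "0 < (1 / 16 :: real) ^ n" for n
    by (auto simp: power_le_one)
  have intF: "integrable lebesgue (\<lambda>x. F (V x, A n x, A m x) :: real)"
    if "continuous_on UNIV F" "F (0, 0, 0) = 0" for F n m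
    unfolding A_def by (rule cube_average_integrable[OF V bS s(1,2) s(1,2) that])
  have meas: "V \<in> borel_measurable lebesgue" "A n \<in> borel_measurable lebesgue" for n
    unfolding A_def
    by (auto intro!: borel_measurable_lebesgueI borel_measurable_continuous_onI lip_ae_diff_continuous[OF V]
         cube_average_continuous[OF V bS])
  have measD: "D n \<in> borel_measurable lebesgue" for n
    unfolding D_def[abs_def] by (intro borel_measurable_diff meas)
  have V4: "integrable lebesgue (\<lambda>x. V x ^ 4)"
    using intF[of "\<lambda>(v, a, b). v ^ 4"] by (simp add: case_prod_beta continuous_intros)
  have A4: "integrable lebesgue (\<lambda>x. A n x ^ 4)" for n
    using intF[of "\<lambda>(v, a, b). a ^ 4"] by (simp add: case_prod_beta continuous_intros)
  have D4: "integrable lebesgue (\<lambda>x. D n x ^ 4)" for n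
    using intF[of "\<lambda>(v, a, b). (a - b) ^ 4"] by (simp add: D_def case_prod_beta continuous_intros)
  have D_le: "(LINT x|lebesgue. D n x ^ 4) \<le> (\<kappa> * \<Gamma> * (1 / 2) ^ n) ^ 4" for n
  proof -
    have "(LINT x|lebesgue. D n x ^ 4) \<le> 16 * 16 ^ CARD('d) * d\<^sup>2 * (1 / 16) ^ n * \<Gamma> ^ 4"
      using cube_average_diff_L4_le[OF V bS d3 s(3,2)[of n]]
      by (simp add: D_def A_def \<Gamma>_def d_def)
    also have "\<dots> = \<kappa> ^ 4 * ((1 / 2) ^ 4) ^ n * \<Gamma> ^ 4"
      unfolding \<kappa>(2)[symmetric] by (simp add: power_divide)
    also have "\<dots> = (\<kappa> * \<Gamma> * (1 / 2) ^ n) ^ 4"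
      by (simp only: power_mult_distrib power_mult[symmetric] mult_ac)
    finally show ?thesis .
  qed
  have VD: "integrable lebesgue (\<lambda>x. V x ^ 3 * D n x)"
      "(LINT x|lebesgue. V x ^ 3 * D n x) \<le> X ^ 3 * (\<kappa> * \<Gamma> * (1 / 2) ^ n)" for n
    using holder_cubic[OF meas(1) measD V4 D4 X _ D_le] \<kappa>(1) \<Gamma>0 by auto
  have A0: "(LINT x|lebesgue. A 0 x ^ 4) \<le> (\<mu> * \<Gamma>) ^ 4"
  proof -
    \<comment> \<open>At scale 1 averaging maps \<open>L\<^sup>2\<close> to \<open>L\<^sup>\<infinity>\<close> with constant 1; the Poincare inequality then bounds
      both the sup norm and the \<open>L\<^sup>2\<close> norm of \<open>A\<^sub>0\<close>.\<close>
    let ?P = "(2 * R + 1)\<^sup>2"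
    have P: "(LINT x|lebesgue. (V x)\<^sup>2) \<le> ?P * \<Gamma>\<^sup>2"
      using poincare_inequality[OF V S R] by (simp add: \<Gamma>2)
    have sup: "(A 0 x)\<^sup>2 \<le> ?P * \<Gamma>\<^sup>2" for x
    proof -
      have "(A 0 x)\<^sup>2 \<le> (LINT x|lebesgue. (V x)\<^sup>2) / 1 ^ CARD('d)"
        unfolding A_def power_0 using V
        by (intro square_cube_average_le[OF lip_ae_diff_continuous[OF V] bS]) (auto simp: lip_ae_diff_def)
      then show ?thesis using P by simp
    qed
    have i2: "integrable lebesgue (\<lambda>x. (A 0 x)\<^sup>2)" "integrable lebesgue (\<lambda>x. (A 0 x - V x)\<^sup>2)" "integrable lebesgue (\<lambda>x. (V x)\<^sup>2)"
      using intF[of "\<lambda>(v, a, b). a\<^sup>2" 0] intF[of "\<lambda>(v, a, b). (a - v)\<^sup>2" 0] intF[of "\<lambda>(v, a, b). v\<^sup>2"]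
      by (simp_all add: case_prod_beta continuous_intros)
    have "(LINT x|lebesgue. (A 0 x)\<^sup>2) \<le> (LINT x|lebesgue. 2 * (A 0 x - V x)\<^sup>2 + 2 * (V x)\<^sup>2)"
    proof (intro integral_mono Bochner_Integration.integrable_add integrable_mult_right i2)
      fix x
      have "0 \<le> (A 0 x - V x - V x)\<^sup>2" by simp
      then show "(A 0 x)\<^sup>2 \<le> 2 * (A 0 x - V x)\<^sup>2 + 2 * (V x)\<^sup>2"
        by (simp add: power2_eq_square algebra_simps)
    qed
    also have "\<dots> = 2 * (LINT x|lebesgue. (A 0 x - V x)\<^sup>2) + 2 * (LINT x|lebesgue. (V x)\<^sup>2)"
      using i2 by simp
    also have "\<dots> \<le> 2 * (d * \<Gamma>\<^sup>2) + 2 * (?P * \<Gamma>\<^sup>2)"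
      using cube_average_L2_le[OF V bS, of 1] P by (intro add_mono mult_left_mono) (auto simp: A_def \<Gamma>_def d_def)
    finally have L2: "(LINT x|lebesgue. (A 0 x)\<^sup>2) \<le> 2 * (d + ?P) * \<Gamma>\<^sup>2" by (simp add: algebra_simps)
    have "(LINT x|lebesgue. A 0 x ^ 4) \<le> (LINT x|lebesgue. (?P * \<Gamma>\<^sup>2) * (A 0 x)\<^sup>2)"
    proof (intro integral_mono integrable_mult_right A4 i2)
      fix x
      have "A 0 x ^ 4 = (A 0 x)\<^sup>2 * (A 0 x)\<^sup>2" by (simp add: power2_eq_square power4_eq_xxxx)
      also have "\<dots> \<le> (?P * \<Gamma>\<^sup>2) * (A 0 x)\<^sup>2" using sup by (intro mult_right_mono) auto
      finally show "A 0 x ^ 4 \<le> (?P * \<Gamma>\<^sup>2) * (A 0 x)\<^sup>2" .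
    qed
    also have "\<dots> \<le> (?P * \<Gamma>\<^sup>2) * (2 * (d + ?P) * \<Gamma>\<^sup>2)"
      using L2 by (simp only: integral_mult_right_zero) (intro mult_left_mono, auto)
    also have "\<dots> = \<mu> ^ 4 * \<Gamma> ^ 4"
      unfolding \<mu>(2) by (simp only: power4_eq_xxxx power2_eq_square mult_ac)
    finally show ?thesis by (simp add: power_mult_distrib)
  qed
  have VA0: "integrable lebesgue (\<lambda>x. V x ^ 3 * A 0 x)"
      "(LINT x|lebesgue. V x ^ 3 * A 0 x) \<le> X ^ 3 * (\<mu> * \<Gamma>)"
    using holder_cubic[OF meas(1) meas(2) V4 A4 X _ A0] \<mu>(1) \<Gamma>0 by auto
  define E where "E = L * sqrt CARD('d) * (LINT x|lebesgue. \<bar>V x\<bar> ^ 3)"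
  have bound: "X ^ 4 \<le> E * (1 / 16) ^ n + X ^ 3 * ((2 * \<kappa> + \<mu>) * \<Gamma>)" for n
  proof -
    have i3: "integrable lebesgue (\<lambda>x. \<bar>V x\<bar> ^ 3)"
      using intF[of "\<lambda>(v, a, b). \<bar>v\<bar> ^ 3"] by (simp add: case_prod_beta continuous_intros)
    have ir: "integrable lebesgue (\<lambda>x. V x ^ 3 * (V x - A n x))"
      using intF[of "\<lambda>(v, a, b). v ^ 3 * (v - a)"] by (simp add: case_prod_beta continuous_intros)
    have "(LINT x|lebesgue. V x ^ 3 * (V x - A n x))
        \<le> (LINT x|lebesgue. (L * sqrt CARD('d) * (1 / 16) ^ n) * \<bar>V x\<bar> ^ 3)"
    proof (intro integral_mono ir integrable_mult_right i3)
      fix x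
      have "\<bar>V x - A n x\<bar> \<le> L * sqrt CARD('d) * (1 / 16) ^ n"
        unfolding A_def by (rule cube_average_uniform_close[OF L(2) lip_ae_diff_continuous[OF V] s(1) L(1)])
      then have "\<bar>V x\<bar> ^ 3 * \<bar>V x - A n x\<bar> \<le> \<bar>V x\<bar> ^ 3 * (L * sqrt CARD('d) * (1 / 16) ^ n)"
        by (rule mult_left_mono) simp
      then show "V x ^ 3 * (V x - A n x) \<le> (L * sqrt CARD('d) * (1 / 16) ^ n) * \<bar>V x\<bar> ^ 3"
        using abs_ge_self[of "V x ^ 3 * (V x - A n x)"] unfolding abs_mult power_abs by (simp only: mult.commute)
    qed
    then have rest: "(LINT x|lebesgue. V x ^ 3 * (V x - A n x)) \<le> E * (1 / 16) ^ n"
      by (simp add: E_def mult_ac)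
    have tele: "V x ^ 4 = V x ^ 3 * (V x - A n x) + ((\<Sum>k<n. V x ^ 3 * D k x) + V x ^ 3 * A 0 x)" for x
    proof -
      have "(\<Sum>k<n. D k x) = A n x - A 0 x" unfolding D_def by (rule sum_lessThan_telescope)
      then have "(\<Sum>k<n. V x ^ 3 * D k x) = V x ^ 3 * (A n x - A 0 x)"
        by (simp add: sum_distrib_left[symmetric])
      then show ?thesis by (simp add: algebra_simps power4_eq_xxxx power3_eq_cube)
    qed
    have "X ^ 4 = (LINT x|lebesgue. V x ^ 3 * (V x - A n x) + ((\<Sum>k<n. V x ^ 3 * D k x) + V x ^ 3 * A 0 x))"
      unfolding X(2)[symmetric] using tele by (intro Bochner_Integration.integral_cong) auto
    also have "\<dots> = (LINT x|lebesgue. V x ^ 3 * (V x - A n x))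
        + ((\<Sum>k<n. LINT x|lebesgue. V x ^ 3 * D k x) + (LINT x|lebesgue. V x ^ 3 * A 0 x))"
      using ir VD(1) VA0(1) by simp
    also have "\<dots> \<le> E * (1 / 16) ^ n + ((\<Sum>k<n. X ^ 3 * (\<kappa> * \<Gamma> * (1 / 2) ^ k)) + X ^ 3 * (\<mu> * \<Gamma>))"
      by (intro add_mono sum_mono rest VD VA0)
    also have "(\<Sum>k<n. X ^ 3 * (\<kappa> * \<Gamma> * (1 / 2) ^ k)) = X ^ 3 * (\<kappa> * \<Gamma>) * (\<Sum>k<n. (1 / 2) ^ k)"
      by (simp add: sum_distrib_left mult_ac)
    also have "\<dots> \<le> X ^ 3 * (\<kappa> * \<Gamma>) * 2"
      using X(1) \<kappa>(1) \<Gamma>0 by (intro mult_left_mono) (auto simp: sum_gp_strict)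
    finally show ?thesis by (simp add: algebra_simps)
  qed
  have "(\<lambda>n. E * (1 / 16) ^ n + X ^ 3 * ((2 * \<kappa> + \<mu>) * \<Gamma>))
      \<longlonglongrightarrow> E * 0 + X ^ 3 * ((2 * \<kappa> + \<mu>) * \<Gamma>)"
    by (intro tendsto_add tendsto_mult tendsto_const LIMSEQ_realpow_zero) auto
  then have "X ^ 4 \<le> E * 0 + X ^ 3 * ((2 * \<kappa> + \<mu>) * \<Gamma>)"
    by (rule LIMSEQ_le_const) (use bound in auto)
  then have "X ^ 3 * X \<le> X ^ 3 * ((2 * \<kappa> + \<mu>) * \<Gamma>)" by (simp add: power4_eq_xxxx power3_eq_cube)
  then have "X \<le> (2 * \<kappa> + \<mu>) * \<Gamma>"
    using X(1) \<kappa>(1) \<mu>(1) \<Gamma>0 by (cases "X = 0") auto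
  then have "X ^ 4 \<le> ((2 * \<kappa> + \<mu>) * \<Gamma>) ^ 4" using X(1) by (rule power_mono)
  then show ?thesis by (simp add: X(2) \<Gamma>2 power_mult_distrib)
qed

section \<open>Integration by parts against test functions\<close>

lemma test_function_smoothD:
  assumes "\<psi> \<in> test_functions \<Omega>"
  shows "\<psi> differentiable (at x)" "(\<lambda>x. partial_deriv i \<psi> x) differentiable (at x)"
proof -
  have s: "\<And>is x. (foldr partial_deriv is \<psi>) differentiable (at x)"
    using assms by (auto simp: test_functions_def smooth_def)
  show "\<psi> differentiable (at x)" using s[of "[]"] by simp
  show "(\<lambda>x. partial_deriv i \<psi> x) differentiable (at x)" using s[of "[i]"] by simp
qed

lemma test_function_support:
  fixes \<psi> :: "real^'d \<Rightarrow> real"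
  assumes "\<psi> \<in> test_functions \<Omega>"
  obtains K where "compact K" "K \<subseteq> \<Omega>" "\<And>x. x \<notin> K \<Longrightarrow> \<psi> x = 0" "\<And>x i. x \<notin> K \<Longrightarrow> partial_deriv i \<psi> x = 0"
proof
  let ?K = "closure {x. \<psi> x \<noteq> 0}"
  show "compact ?K" "?K \<subseteq> \<Omega>" using assms unfolding test_functions_def by blast+
  show z: "\<psi> x = 0" if "x \<notin> ?K" for x using that closure_subset[of "{x. \<psi> x \<noteq> 0}"] by blast
  fix x i assume x: "x \<notin> ?K"
  have "(\<psi> has_derivative (\<lambda>h. 0)) (at x)"
  proof (rule has_derivative_transform_within_open[OF has_derivative_const[of 0]])
    show "open (- ?K)" by (rule open_Compl[OF closed_closure])
    show "x \<in> - ?K" using x unfolding Compl_iff .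
    show "0 = \<psi> y" if "y \<in> - ?K" for y using z[of y] that unfolding Compl_iff by metis
  qed
  then have "frechet_derivative \<psi> (at x) = (\<lambda>h. 0)" by (rule frechet_derivative_at[symmetric])
  then show "partial_deriv i \<psi> x = 0" by (simp add: partial_deriv_def)
qed

lemma test_function_lip_ae_diff:
  fixes \<psi> :: "real^'d \<Rightarrow> real"
  assumes "\<psi> \<in> test_functions \<Omega>"
  shows "lip_ae_diff \<Omega> \<psi>"
proof -
  obtain K where K: "compact K" "K \<subseteq> \<Omega>" "\<And>x. x \<notin> K \<Longrightarrow> \<psi> x = 0"
    "\<And>x i. x \<notin> K \<Longrightarrow> partial_deriv i \<psi> x = 0"
    using test_function_support[OF assms] by blast
  note diff = test_function_smoothD[OF assms]
  have "continuous_on K (partial_deriv i \<psi>)" for i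
    using diff(2)[of i] by (auto intro!: continuous_at_imp_continuous_on differentiable_imp_continuous_within)
  then have "continuous_on K (\<lambda>x. \<chi> i. partial_deriv i \<psi> x)"
    by (intro continuous_on_vec_lambda)
  then have "bounded ((\<lambda>x. \<chi> i. partial_deriv i \<psi> x) ` K)"
    using K(1) compact_continuous_image compact_imp_bounded by blast
  then obtain C where C: "\<And>x. x \<in> K \<Longrightarrow> norm (\<chi> i. partial_deriv i \<psi> x) \<le> C"
    unfolding bounded_iff by blast
  have C': "norm (classical_gradient \<psi> x) \<le> max C 0" for x
  proof (cases "x \<in> K")
    case False
    then have "classical_gradient \<psi> x = 0" using K(4) diff(1) by (simp add: classical_gradient_def vec_eq_iff)
    then show ?thesis by simp
  qed (use C diff(1) in \<open>auto simp: classical_gradient_def le_max_iff_disj\<close>)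
  have "(max C 0)-lipschitz_on UNIV \<psi>"
  proof (rule bounded_derivative_imp_lipschitz)
    show "(\<psi> has_derivative (\<lambda>h. classical_gradient \<psi> x \<bullet> h)) (at x within UNIV)" for x
      using has_derivative_classical_gradient[OF diff(1)] by simp
    show "onorm (\<lambda>h. classical_gradient \<psi> x \<bullet> h) \<le> max C 0" for x
    proof (rule onorm_le)
      fix h
      have "norm (classical_gradient \<psi> x \<bullet> h) \<le> norm (classical_gradient \<psi> x) * norm h"
        using Cauchy_Schwarz_ineq2 by simp
      also have "\<dots> \<le> max C 0 * norm h" using C'[of x] by (rule mult_right_mono) simp
      finally show "norm (classical_gradient \<psi> x \<bullet> h) \<le> max C 0 * norm h" .
    qed
  qed auto
  then show ?thesis using diff(1) K unfolding lip_ae_diff_def by auto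
qed

lemma lip_ae_diff_mult:
  fixes V W :: "real^'d \<Rightarrow> real"
  assumes V: "lip_ae_diff S V" and W: "lip_ae_diff S W" and S: "bounded S"
  shows "lip_ae_diff S (\<lambda>x. V x * W x)"
    and "V differentiable (at x) \<Longrightarrow> W differentiable (at x) \<Longrightarrow>
      classical_gradient (\<lambda>x. V x * W x) x = V x *\<^sub>R classical_gradient W x + W x *\<^sub>R classical_gradient V x"
proof -
  obtain L1 where L1: "L1 \<ge> 0" "\<And>x y. \<bar>V x - V y\<bar> \<le> L1 * norm (x - y)" using lip_ae_diff_bound[OF V] by blast
  obtain L2 where L2: "L2 \<ge> 0" "\<And>x y. \<bar>W x - W y\<bar> \<le> L2 * norm (x - y)" using lip_ae_diff_bound[OF W] by blast
  obtain B1 where B1: "B1 \<ge> 0" "\<And>x. \<bar>V x\<bar> \<le> B1" using lip_ae_diff_bounded[OF V S] by blast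
  obtain B2 where B2: "B2 \<ge> 0" "\<And>x. \<bar>W x\<bar> \<le> B2" using lip_ae_diff_bounded[OF W S] by blast
  have "(B1 * L2 + B2 * L1)-lipschitz_on UNIV (\<lambda>x. V x * W x)"
  proof (rule lipschitz_onI)
    fix x y
    have "\<bar>V x * W x - V y * W y\<bar> = \<bar>V x * (W x - W y) + W y * (V x - V y)\<bar>" by (simp add: algebra_simps)
    also have "\<dots> \<le> \<bar>V x\<bar> * \<bar>W x - W y\<bar> + \<bar>W y\<bar> * \<bar>V x - V y\<bar>"
      by (metis abs_mult abs_triangle_ineq)
    also have "\<dots> \<le> B1 * (L2 * norm (x - y)) + B2 * (L1 * norm (x - y))"
      using B1 B2 L1 L2 by (intro add_mono mult_mono) auto
    finally show "dist (V x * W x) (V y * W y) \<le> (B1 * L2 + B2 * L1) * dist x y"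
      by (simp add: dist_norm algebra_simps)
  qed (use B1 B2 L1 L2 in auto)
  moreover have "negligible {x. \<not> (\<lambda>x. V x * W x) differentiable (at x)}"
  proof (rule negligible_subset)
    show "negligible ({x. \<not> V differentiable (at x)} \<union> {x. \<not> W differentiable (at x)})"
      using V W by (auto simp: lip_ae_diff_def)
  qed auto
  ultimately show "lip_ae_diff S (\<lambda>x. V x * W x)" using V unfolding lip_ae_diff_def by auto
  assume "V differentiable (at x)" "W differentiable (at x)"
  note this[THEN has_derivative_classical_gradient]
  from has_derivative_mult[OF this]
  show "classical_gradient (\<lambda>x. V x * W x) x = V x *\<^sub>R classical_gradient W x + W x *\<^sub>R classical_gradient V x"
    by (intro classical_gradient_unique) (simp add: inner_add_left algebra_simps)
qed

lemma integrable_classical_gradient: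
  fixes V :: "real^'d \<Rightarrow> real"
  assumes V: "lip_ae_diff S V" and S: "bounded S"
  shows "integrable lebesgue (classical_gradient V)"
proof -
  obtain L where L: "\<And>x. norm (classical_gradient V x) \<le> L" using classical_gradient_bounded[OF V] by blast
  show ?thesis
    by (rule integrable_bounded_support[OF classical_gradient_measurable[OF V] L bounded_closure[OF S]])
       (rule classical_gradient_outside[OF V])
qed

text \<open>The integral of the gradient of \<open>V \<psi>\<close> vanishes, and the product rule holds almost everywhere.\<close>

lemma has_weak_gradient_classical_gradient:
  fixes V :: "real^'d \<Rightarrow> real"
  assumes \<Omega>: "open \<Omega>" "bounded \<Omega>" and V: "lip_ae_diff \<Omega> V"
  shows "has_weak_gradient \<Omega> V (classical_gradient V)"
  unfolding has_weak_gradient_def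
proof (intro conjI ballI allI)
  have V0: "integrable lebesgue V"
    using integrable_continuous_supported[OF \<Omega>(2) lip_ae_diff_continuous[OF V]] V by (auto simp: lip_ae_diff_def)
  show "locally_integrable \<Omega> V" "locally_integrable \<Omega> (classical_gradient V)"
    unfolding locally_integrable_def
    by (auto intro!: integrable_lebesgue_on_subset V0 integrable_classical_gradient[OF V \<Omega>(2)] lmeasurable_compact fmeasurableD)
  fix \<psi> :: "real^'d \<Rightarrow> real" and i
  assume \<psi>: "\<psi> \<in> test_functions \<Omega>"
  have P: "lip_ae_diff \<Omega> \<psi>" by (rule test_function_lip_ae_diff[OF \<psi>])
  have M: "\<Omega> \<in> sets lebesgue" using \<Omega> by (simp add: borel_open)
  have z: "\<psi> x = 0" "V x = 0" if "x \<notin> \<Omega>" for x using P V that by (auto simp: lip_ae_diff_def)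
  obtain B1 where B1: "\<And>x. \<bar>V x\<bar> \<le> B1" using lip_ae_diff_bounded[OF V \<Omega>(2)] by blast
  obtain B2 where B2: "\<And>x. \<bar>\<psi> x\<bar> \<le> B2" using lip_ae_diff_bounded[OF P \<Omega>(2)] by blast
  have pd: "partial_deriv i \<psi> x = classical_gradient \<psi> x \<bullet> axis i 1" for x
    using test_function_smoothD(1)[OF \<psi>] by (simp add: classical_gradient_def inner_axis)
  have [measurable]: "V \<in> borel_measurable lebesgue" "\<psi> \<in> borel_measurable lebesgue"
    "classical_gradient \<psi> \<in> borel_measurable lebesgue" "classical_gradient V \<in> borel_measurable lebesgue"
    using lip_ae_diff_borel[OF V] lip_ae_diff_borel[OF P] classical_gradient_measurable[OF V]
      classical_gradient_measurable[OF P] by (auto intro: borel_measurable_lebesgueI)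
  have i1: "integrable lebesgue (\<lambda>x. partial_deriv i \<psi> x * V x)"
  proof (rule Bochner_Integration.integrable_bound)
    show "integrable lebesgue (\<lambda>x. B1 * (norm (classical_gradient \<psi> x)))"
      using integrable_classical_gradient[OF P \<Omega>(2)] by simp
    show "AE x in lebesgue. norm (partial_deriv i \<psi> x * V x) \<le> norm (B1 * norm (classical_gradient \<psi> x))"
    proof (rule AE_I2)
      fix x
      have "\<bar>V x\<bar> * \<bar>classical_gradient \<psi> x \<bullet> axis i 1\<bar> \<le> \<bar>B1\<bar> * norm (classical_gradient \<psi> x)"
        using B1[of x] norm_bound_Basis_le[of "axis i 1"] Cauchy_Schwarz_ineq2[of "classical_gradient \<psi> x" "axis i 1"]
        by (intro mult_mono) auto
      then show "norm (partial_deriv i \<psi> x * V x) \<le> norm (B1 * norm (classical_gradient \<psi> x))"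
        by (simp add: pd abs_mult mult.commute)
    qed
    show "(\<lambda>x. partial_deriv i \<psi> x * V x) \<in> borel_measurable lebesgue" unfolding pd by measurable
  qed
  have i2: "integrable lebesgue (\<lambda>x. \<psi> x * (classical_gradient V x $ i))"
  proof (rule Bochner_Integration.integrable_bound)
    show "integrable lebesgue (\<lambda>x. B2 * (norm (classical_gradient V x)))"
      using integrable_classical_gradient[OF V \<Omega>(2)] by simp
    show "AE x in lebesgue. norm (\<psi> x * (classical_gradient V x $ i)) \<le> norm (B2 * norm (classical_gradient V x))"
    proof (rule AE_I2)
      fix x
      have "\<bar>\<psi> x\<bar> * \<bar>classical_gradient V x $ i\<bar> \<le> \<bar>B2\<bar> * norm (classical_gradient V x)"
        using B2[of x] component_le_norm_cart[of "classical_gradient V x" i]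
        by (intro mult_mono) auto
      then show "norm (\<psi> x * (classical_gradient V x $ i)) \<le> norm (B2 * norm (classical_gradient V x))"
        by (simp add: abs_mult)
    qed
    have "(\<lambda>x. classical_gradient V x \<bullet> axis i 1) \<in> borel_measurable lebesgue" by measurable
    then show "(\<lambda>x. \<psi> x * (classical_gradient V x $ i)) \<in> borel_measurable lebesgue"
      by (simp add: inner_axis)
  qed
  have "0 = (LINT x|lebesgue. classical_gradient (\<lambda>x. V x * \<psi> x) x \<bullet> axis i 1)"
    by (rule integral_classical_gradient_eq_0[OF lip_ae_diff_mult(1)[OF V P \<Omega>(2)] \<Omega>(2), symmetric])
  also have "\<dots> = (LINT x|lebesgue. partial_deriv i \<psi> x * V x + \<psi> x * (classical_gradient V x $ i))"
  proof (rule integral_cong_AE)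
    show "(\<lambda>x. classical_gradient (\<lambda>x. V x * \<psi> x) x \<bullet> axis i 1) \<in> borel_measurable lebesgue"
      using classical_gradient_measurable[OF lip_ae_diff_mult(1)[OF V P \<Omega>(2)]] by measurable
    show "(\<lambda>x. partial_deriv i \<psi> x * V x + \<psi> x * (classical_gradient V x $ i)) \<in> borel_measurable lebesgue"
      using i1 i2 by (intro borel_measurable_add borel_measurable_integrable)
    show "AE x in lebesgue. classical_gradient (\<lambda>x. V x * \<psi> x) x \<bullet> axis i 1
        = partial_deriv i \<psi> x * V x + \<psi> x * (classical_gradient V x $ i)"
      using AE_differentiable[OF V]
    proof eventually_elim
      case (elim x)
      then show ?case
        using lip_ae_diff_mult(2)[OF V P \<Omega>(2) elim test_function_smoothD(1)[OF \<psi>]]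
        by (simp add: pd inner_add_left inner_axis)
    qed
  qed
  also have "\<dots> = (LINT x|lebesgue. partial_deriv i \<psi> x * V x) + (LINT x|lebesgue. \<psi> x * (classical_gradient V x $ i))"
    using i1 i2 by simp
  finally show "(LINT x|lebesgue_on \<Omega>. partial_deriv i \<psi> x *\<^sub>R V x) =
        - (LINT x|lebesgue_on \<Omega>. \<psi> x *\<^sub>R (classical_gradient V x $ i))"
    using z by (simp add: integral_lebesgue_on_supported[OF M])
qed

section \<open>Smooth bump functions\<close>

text \<open>The functions \<open>p (1/t) exp (- 1/t)\<close>, extended by 0 to \<open>t \<le> 0\<close>. This form is preserved by
differentiation, and \<open>p = 1\<close> is the standard flat function.\<close>

definition flat :: "real poly \<Rightarrow> real \<Rightarrow> real" where
  "flat p t = (if t > 0 then poly p (inverse t) * exp (- inverse t) else 0)"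

lemma poly_times_exp_minus_tendsto_0: "((\<lambda>s. poly p s * exp (- s)) \<longlongrightarrow> (0::real)) at_top"
proof -
  have "((\<lambda>s. \<Sum>i\<le>degree p. coeff p i * (s ^ i / exp s)) \<longlongrightarrow> (\<Sum>i\<le>degree p. coeff p i * 0)) at_top"
    by (intro tendsto_intros tendsto_power_div_exp_0)
  then show ?thesis
    by (simp add: poly_altdef sum_distrib_right exp_minus divide_inverse mult.assoc)
qed

lemma has_derivative_flat:
  "(flat p has_real_derivative flat ([:0, 0, 1:] * (p - pderiv p)) t) (at t)"
proof (cases t "0 :: real" rule: linorder_cases)
  case greater
  have "((\<lambda>t. poly p (inverse t) * exp (- inverse t)) has_real_derivative
      flat ([:0, 0, 1:] * (p - pderiv p)) t) (at t)"
    using greater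
    by (auto intro!: derivative_eq_intros simp: flat_def field_simps power2_eq_square)
  then show ?thesis
    by (rule has_field_derivative_transform_within_open[where S="{0<..}"]) (use greater in \<open>auto simp: flat_def\<close>)
next
  case less
  have "((\<lambda>t. 0) has_real_derivative flat ([:0, 0, 1:] * (p - pderiv p)) t) (at t)"
    using less by (simp add: flat_def)
  then show ?thesis
    by (rule has_field_derivative_transform_within_open[where S="{..<0}"]) (use less in \<open>auto simp: flat_def\<close>)
next
  case equal
  have "((\<lambda>h. flat p h / h) \<longlongrightarrow> 0) (at_left 0)"
    by (rule tendsto_eventually) (auto simp: flat_def eventually_at_filter)
  moreover have "((\<lambda>h. flat p h / h) \<longlongrightarrow> 0) (at_right 0)"
  proof (rule Lim_transform_eventually)
    show "((\<lambda>h. poly ([:0, 1:] * p) (inverse h) * exp (- inverse h)) \<longlongrightarrow> 0) (at_right 0)"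
      by (rule filterlim_compose[OF poly_times_exp_minus_tendsto_0 filterlim_inverse_at_top_right])
    show "eventually (\<lambda>h. poly ([:0, 1:] * p) (inverse h) * exp (- inverse h) = flat p h / h) (at_right 0)"
      by (auto simp: eventually_at_filter flat_def divide_inverse mult_ac)
  qed
  ultimately have "((\<lambda>h. flat p h / h) \<longlongrightarrow> 0) (at 0)"
    by (simp add: filterlim_at_split)
  then show ?thesis
    using equal by (simp add: has_field_derivative_iff flat_def)
qed

text \<open>A family of functions on the line closed under differentiation. Smoothness in several variables
is then a property of tensor products: each partial derivative replaces one factor by its derivative.\<close>

inductive_set smooth_line :: "(real \<Rightarrow> real) set" where
  flat_affine: "(\<lambda>t. flat p (c * t + b)) \<in> smooth_line"
| const: "(\<lambda>t. c) \<in> smooth_line"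
| plus: "f \<in> smooth_line \<Longrightarrow> g \<in> smooth_line \<Longrightarrow> (\<lambda>t. f t + g t) \<in> smooth_line"
| times: "f \<in> smooth_line \<Longrightarrow> g \<in> smooth_line \<Longrightarrow> (\<lambda>t. f t * g t) \<in> smooth_line"

lemma smooth_line_derivative:
  "f \<in> smooth_line \<Longrightarrow> \<exists>f'\<in>smooth_line. \<forall>t. (f has_real_derivative f' t) (at t)"
proof (induction rule: smooth_line.induct)
  case (flat_affine p c b)
  let ?q = "[:0, 0, 1:] * (p - pderiv p)"
  have "((\<lambda>t. flat p (c * t + b)) has_real_derivative flat ?q (c * t + b) * c) (at t)" for t
    by (rule DERIV_chain2[OF has_derivative_flat]) (auto intro!: derivative_eq_intros)
  moreover have "(\<lambda>t. flat ?q (c * t + b) * c) \<in> smooth_line"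
    by (intro smooth_line.intros)
  ultimately show ?case by (intro bexI[of _ "\<lambda>t. flat ?q (c * t + b) * c"] allI)
next
  case (const c)
  then show ?case by (intro bexI[of _ "\<lambda>t. 0"]) (auto intro: smooth_line.intros)
next
  case (plus f g)
  then obtain f' g' where "f' \<in> smooth_line" "g' \<in> smooth_line"
    "\<And>t. (f has_real_derivative f' t) (at t)" "\<And>t. (g has_real_derivative g' t) (at t)" by blast
  then show ?case
    by (intro bexI[of _ "\<lambda>t. f' t + g' t"]) (auto intro: smooth_line.intros DERIV_add)
next
  case (times f g)
  then obtain f' g' where *: "f' \<in> smooth_line" "g' \<in> smooth_line"
    "\<And>t. (f has_real_derivative f' t) (at t)" "\<And>t. (g has_real_derivative g' t) (at t)" by blast
  then have "(\<lambda>t. f' t * g t + g' t * f t) \<in> smooth_line"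
    using times.hyps by (intro smooth_line.intros)
  with * show ?case
    by (intro bexI[of _ "\<lambda>t. f' t * g t + g' t * f t"]) (auto intro!: DERIV_mult)
qed

lemma partial_deriv_tensor:
  fixes f :: "'d::finite \<Rightarrow> real \<Rightarrow> real"
  assumes f: "\<And>i t. (f i has_real_derivative f' i t) (at t)"
  shows "(\<lambda>x::real^'d. \<Prod>i\<in>UNIV. f i (x $ i)) differentiable (at x)"
    and "partial_deriv j (\<lambda>x::real^'d. \<Prod>i\<in>UNIV. f i (x $ i))
      = (\<lambda>x. \<Prod>i\<in>UNIV. (if i = j then f' i else f i) (x $ i))"
proof -
  have "((\<lambda>x. f i (x $ i)) has_derivative (\<lambda>h. f' i (x $ i) * h $ i)) (at x)" for i and x :: "real^'d"
  proof -
    have "((\<lambda>x. x $ i) has_derivative (\<lambda>h. h $ i)) (at x)"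
      by (rule bounded_linear_imp_has_derivative) (rule bounded_linear_vec_nth)
    from has_derivative_compose[OF this, of "f i" "\<lambda>h. f' i (x $ i) * h"] f[of i "x $ i"]
    show ?thesis by (simp add: has_field_derivative_def)
  qed
  then have D: "((\<lambda>x. \<Prod>i\<in>UNIV. f i (x $ i)) has_derivative
      (\<lambda>h. \<Sum>i\<in>UNIV. f' i (x $ i) * h $ i * (\<Prod>k\<in>UNIV - {i}. f k (x $ k)))) (at x)" for x :: "real^'d"
    by (intro has_derivative_prod)
  then show "(\<lambda>x::real^'d. \<Prod>i\<in>UNIV. f i (x $ i)) differentiable (at x)"
    unfolding differentiable_def by blast
  show "partial_deriv j (\<lambda>x::real^'d. \<Prod>i\<in>UNIV. f i (x $ i))
      = (\<lambda>x. \<Prod>i\<in>UNIV. (if i = j then f' i else f i) (x $ i))"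
  proof
    fix x :: "real^'d"
    have "partial_deriv j (\<lambda>x::real^'d. \<Prod>i\<in>UNIV. f i (x $ i)) x
        = (\<Sum>i\<in>UNIV. f' i (x $ i) * axis j 1 $ i * (\<Prod>k\<in>UNIV - {i}. f k (x $ k)))"
      unfolding partial_deriv_def frechet_derivative_at[OF D, symmetric] by simp
    also have "\<dots> = (\<Sum>i\<in>UNIV. if i = j then f' i (x $ i) * (\<Prod>k\<in>UNIV - {i}. f k (x $ k)) else 0)"
      by (intro sum.cong) (auto simp: axis_def)
    also have "\<dots> = f' j (x $ j) * (\<Prod>k\<in>UNIV - {j}. f k (x $ k))" by simp
    also have "\<dots> = (\<Prod>i\<in>UNIV. (if i = j then f' i else f i) (x $ i))"
      by (subst (2) prod.remove[of _ j]) (auto intro!: prod.cong)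
    finally show "partial_deriv j (\<lambda>x::real^'d. \<Prod>i\<in>UNIV. f i (x $ i)) x
      = (\<Prod>i\<in>UNIV. (if i = j then f' i else f i) (x $ i))" .
  qed
qed

lemma smooth_tensor:
  fixes f :: "'d::finite \<Rightarrow> real \<Rightarrow> real"
  assumes f: "\<And>i. f i \<in> smooth_line"
  shows "smooth (\<lambda>x::real^'d. \<Prod>i\<in>UNIV. f i (x $ i))"
proof -
  have "\<exists>g. (\<forall>i. g i \<in> smooth_line) \<and>
      foldr partial_deriv is (\<lambda>x::real^'d. \<Prod>i\<in>UNIV. f i (x $ i)) = (\<lambda>x. \<Prod>i\<in>UNIV. g i (x $ i))" for "is"
  proof (induction "is")
    case Nil
    then show ?case using f by auto
  next
    case (Cons j js)
    then obtain g where g: "\<And>i. g i \<in> smooth_line" and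
      eq: "foldr partial_deriv js (\<lambda>x::real^'d. \<Prod>i\<in>UNIV. f i (x $ i)) = (\<lambda>x. \<Prod>i\<in>UNIV. g i (x $ i))"
      by blast
    have "\<forall>i. \<exists>g'. g' \<in> smooth_line \<and> (\<forall>t. (g i has_real_derivative g' t) (at t))"
      using smooth_line_derivative[OF g] by blast
    then obtain g' where g': "\<And>i. g' i \<in> smooth_line" "\<And>i t. (g i has_real_derivative g' i t) (at t)"
      by metis
    show ?case
      using g g'(1) partial_deriv_tensor(2)[OF g'(2), of j] eq
      by (intro exI[of _ "\<lambda>i. if i = j then g' i else g i"]) simp
  qed
  moreover have "(\<lambda>x::real^'d. \<Prod>i\<in>UNIV. g i (x $ i)) differentiable (at x)"
    if "\<forall>i. g i \<in> smooth_line" for g :: "'d \<Rightarrow> real \<Rightarrow> real" and x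
  proof -
    have "\<forall>i. \<exists>g'. \<forall>t. (g i has_real_derivative g' t) (at t)"
      using that smooth_line_derivative by blast
    then obtain g' where "\<And>i t. (g i has_real_derivative g' i t) (at t)" by metis
    then show ?thesis by (rule partial_deriv_tensor(1))
  qed
  ultimately show ?thesis unfolding smooth_def by metis
qed

text \<open>The parameter \<open>k\<close> compresses the transition layer at the faces: for \<open>k \<rightarrow> \<infinity>\<close> the bumps increase to
the indicator of the open box.\<close>

definition box_bump :: "real^'d \<Rightarrow> real^'d \<Rightarrow> real \<Rightarrow> real^'d \<Rightarrow> real" where
  "box_bump a b k x = (\<Prod>i\<in>UNIV. flat 1 (k * (x $ i - a $ i)) * flat 1 (k * (b $ i - x $ i)))"

lemma flat_1_bounds: "0 \<le> flat 1 t" "flat 1 t \<le> 1" "flat 1 t \<noteq> 0 \<longleftrightarrow> t > 0"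
  by (auto simp: flat_def)

lemma box_bump_bounds: "0 \<le> box_bump a b k x" "box_bump a b k x \<le> 1"
  unfolding box_bump_def
  by (auto intro!: prod_nonneg prod_le_1 mult_nonneg_nonneg mult_le_one flat_1_bounds)

lemma box_bump_nonzero_iff: "k > 0 \<Longrightarrow> box_bump a b k x \<noteq> 0 \<longleftrightarrow> x \<in> box a b"
  unfolding box_bump_def using flat_1_bounds(3)
  by (auto simp: mem_box_cart zero_less_mult_iff)

lemma box_bump_test_function:
  assumes "k > 0" "cbox a b \<subseteq> \<Omega>"
  shows "box_bump a b k \<in> test_functions \<Omega>"
proof -
  have "(\<lambda>t. flat 1 (k * t + - (k * a $ i)) * flat 1 (- k * t + k * b $ i)) \<in> smooth_line" for i
    by (intro smooth_line.intros)
  then have "smooth (\<lambda>x. \<Prod>i\<in>UNIV. flat 1 (k * x $ i + - (k * a $ i)) * flat 1 (- k * x $ i + k * b $ i))"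
    by (rule smooth_tensor)
  then have "smooth (box_bump a b k)"
    by (simp add: box_bump_def[abs_def] algebra_simps)
  moreover have "closure {x. box_bump a b k x \<noteq> 0} \<subseteq> cbox a b"
    by (intro closure_minimal)
       (auto simp: closed_cbox box_bump_nonzero_iff[OF assms(1)] intro: subsetD[OF box_subset_cbox])
  moreover from this have "compact (closure {x. box_bump a b k x \<noteq> 0})"
    by (meson bounded_cbox bounded_subset closed_closure compact_eq_bounded_closed)
  ultimately show ?thesis using assms(2) by (auto simp: test_functions_def)
qed

lemma box_bump_tendsto_indicator:
  "(\<lambda>n. box_bump a b (real (Suc n)) x) \<longlonglongrightarrow> indicator (box a b) x"
proof (cases "x \<in> box a b")
  case True
  have "(\<lambda>n. flat 1 (real (Suc n) * t)) \<longlonglongrightarrow> 1" if "t > 0" for t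
  proof -
    have "(\<lambda>n. exp (- (inverse (real (Suc n)) * inverse t))) \<longlonglongrightarrow> exp (- (0 * inverse t))"
      by (intro tendsto_exp tendsto_minus tendsto_mult LIMSEQ_inverse_real_of_nat tendsto_const)
    
    then show ?thesis
      using that by (simp add: flat_def zero_less_mult_iff)
  qed
  then have "(\<lambda>n. box_bump a b (real (Suc n)) x) \<longlonglongrightarrow> (\<Prod>i\<in>(UNIV :: 'a set). 1 * 1)"
    unfolding box_bump_def using True by (intro tendsto_prod tendsto_mult) (auto simp: mem_box_cart)
  then show ?thesis using True by simp
next
  case False
  then have "box_bump a b (real (Suc n)) x = 0" for n using box_bump_nonzero_iff[of "real (Suc n)"] by auto
  then show ?thesis using False by simp
qed

section \<open>Uniqueness and linearity of weak gradients\<close>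

lemma locally_integrableD: "locally_integrable \<Omega> f \<Longrightarrow> compact K \<Longrightarrow> K \<subseteq> \<Omega> \<Longrightarrow> integrable (lebesgue_on K) f"
  by (simp add: locally_integrable_def)

lemma integral_cbox_eq_0_if_test_integrals_eq_0:
  fixes h :: "real^'d \<Rightarrow> 'b::euclidean_space"
  assumes \<Omega>: "open \<Omega>" and h: "locally_integrable \<Omega> h"
    and 0: "\<And>\<psi>. \<psi> \<in> test_functions \<Omega> \<Longrightarrow> (LINT x|lebesgue_on \<Omega>. (\<psi> x :: real) *\<^sub>R h x) = 0"
    and ab: "cbox a b \<subseteq> \<Omega>"
  shows "integral (cbox a b) h = 0"
proof -
  let ?M = "lebesgue_on (cbox a b)"
  have int: "integrable ?M h" by (rule locally_integrableD[OF h compact_cbox ab])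
  have M: "\<Omega> \<in> sets lebesgue" using \<Omega> by (simp add: borel_open)
  have z: "(LINT x|?M. box_bump a b (real (Suc n)) x *\<^sub>R h x) = 0" for n
  proof -
    have "box_bump a b (real (Suc n)) x = 0" if "x \<notin> cbox a b" for x
      using that box_bump_nonzero_iff[of "real (Suc n)" a b x] box_subset_cbox by auto
    then have "(LINT x|?M. box_bump a b (real (Suc n)) x *\<^sub>R h x)
        = (LINT x|lebesgue_on \<Omega>. box_bump a b (real (Suc n)) x *\<^sub>R h x)"
      using ab M by (subst (1 2) integral_lebesgue_on_supported) auto
    then show ?thesis using 0[OF box_bump_test_function[OF _ ab]] by simp
  qed
  have "(\<lambda>n. LINT x|?M. box_bump a b (real (Suc n)) x *\<^sub>R h x) \<longlonglongrightarrow> (LINT x|?M. h x)"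
  proof (rule integral_dominated_convergence[where w="\<lambda>x. norm (h x)"])
    show mh: "h \<in> borel_measurable ?M" and "integrable ?M (\<lambda>x. norm (h x))" using int by auto
    show "(\<lambda>x. box_bump a b (real (Suc n)) x *\<^sub>R h x) \<in> borel_measurable ?M" for n
    proof (rule borel_measurable_scaleR[OF _ mh])
      have "box_bump a b (real (Suc n)) \<in> borel_measurable borel"
        using lip_ae_diff_borel[OF test_function_lip_ae_diff[OF box_bump_test_function[OF _ ab]]] by simp
      then show "box_bump a b (real (Suc n)) \<in> borel_measurable ?M"
        by (intro measurable_restrict_space1 borel_measurable_lebesgueI)
    qed
    have "negligible (cbox a b - box a b)" by (rule negligible_frontier_interval)
    then have "cbox a b - box a b \<in> null_sets ?M"
      by (subst null_sets_restrict_space) (auto simp: negligible_iff_null_sets)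
    then have "AE x in ?M. x \<notin> cbox a b - box a b" by (rule AE_not_in)
    then have "AE x in ?M. x \<in> box a b" by (rule AE_mp) (auto intro!: AE_I2)
    then show "AE x in ?M. (\<lambda>n. box_bump a b (real (Suc n)) x *\<^sub>R h x) \<longlonglongrightarrow> h x"
    proof eventually_elim
      case (elim x)
      from tendsto_scaleR[OF box_bump_tendsto_indicator[of a b x] tendsto_const[of "h x"]] elim
      show ?case by simp
    qed
    show "AE x in ?M. norm (box_bump a b (real (Suc n)) x *\<^sub>R h x) \<le> norm (h x)" for n
      using box_bump_bounds[of a b "real (Suc n)"]
      by (intro AE_I2) (simp add: mult_left_le_one_le del: of_nat_Suc)
  qed
  then have "(LINT x|?M. h x) = 0" unfolding z by (simp add: LIMSEQ_const_iff)
  then show ?thesis using lebesgue_integral_eq_integral[OF int] by simp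
qed

text \<open>Bump functions approximate the indicators of boxes, so the integral of \<open>h\<close> over every small box
vanishes; the Lebesgue differentiation theorem for cubes then gives \<open>h = 0\<close> almost everywhere.\<close>

lemma fundamental_lemma:
  fixes h :: "real^'d \<Rightarrow> 'b::euclidean_space"
  assumes \<Omega>: "open \<Omega>" and h: "locally_integrable \<Omega> h"
    and 0: "\<And>\<psi>. \<psi> \<in> test_functions \<Omega> \<Longrightarrow> (LINT x|lebesgue_on \<Omega>. (\<psi> x :: real) *\<^sub>R h x) = 0"
  shows "negligible {x \<in> \<Omega>. h x \<noteq> 0}"
proof -
  have loc: "negligible {x \<in> cbox A B. h x \<noteq> 0}" if AB: "cbox A B \<subseteq> \<Omega>" for A B
  proof -
    let ?f = "\<lambda>x. if x \<in> cbox A B then h x else 0"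
    have "h integrable_on cbox A B"
      using locally_integrableD[OF h compact_cbox AB] by (intro integrable_on_lebesgue_on) auto
    then have "?f integrable_on UNIV" by (simp add: integrable_restrict_UNIV)
    then have "?f integrable_on cbox a b" for a b by (rule integrable_on_subcbox) simp
    from integrable_ccontinuous_explicit[OF this]
    obtain N where N: "negligible N"
      "\<And>x e. \<lbrakk>x \<notin> N; 0 < e\<rbrakk> \<Longrightarrow> \<exists>d>0. \<forall>k. 0 < k \<and> k < d \<longrightarrow>
         norm (integral (cbox x (x + k *\<^sub>R One)) ?f /\<^sub>R k ^ DIM(real^'d) - ?f x) < e"
      by blast
    have "h x = 0" if x: "x \<in> box A B" "x \<notin> N" for x
    proof (rule ccontr)
      assume "h x \<noteq> 0"
      with N(2)[OF x(2), of "norm (h x)"] obtain d where d: "d > 0"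
        "\<And>k. 0 < k \<Longrightarrow> k < d \<Longrightarrow> norm (integral (cbox x (x + k *\<^sub>R One)) ?f /\<^sub>R k ^ DIM(real^'d) - ?f x) < norm (h x)"
        unfolding zero_less_norm_iff by blast
      have lim: "((\<lambda>k. x + k *\<^sub>R One) \<longlongrightarrow> x + 0 *\<^sub>R One) (at_right 0)" by (intro tendsto_intros)
      have "eventually (\<lambda>k. x + k *\<^sub>R One \<in> box A B) (at_right 0)"
        using topological_tendstoD[OF lim open_box, of A B] x(1) by simp
      moreover have "eventually (\<lambda>k. 0 < k \<and> k < d) (at_right 0)"
        using eventually_at_right_real[OF d(1)] by eventually_elim simp
      ultimately have "eventually (\<lambda>k. x + k *\<^sub>R One \<in> box A B \<and> 0 < k \<and> k < d) (at_right 0)"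
        by eventually_elim simp
      then obtain k where k: "x + k *\<^sub>R One \<in> box A B" "0 < k" "k < d"
        using eventually_happens'[OF trivial_limit_at_right_real] by blast
      \<comment> \<open>For small \<open>k\<close> the cube lies inside the box, where the mean values of \<open>h\<close> vanish.\<close>
    have sub: "cbox x (x + k *\<^sub>R One) \<subseteq> cbox A B"
        unfolding subset_box using x(1) k(1) unfolding mem_box by (meson less_imp_le)
      have "integral (cbox x (x + k *\<^sub>R One)) ?f = integral (cbox x (x + k *\<^sub>R One)) h"
        using sub by (intro Henstock_Kurzweil_Integration.integral_cong) auto
      also have "\<dots> = 0"
        using sub AB by (intro integral_cbox_eq_0_if_test_integrals_eq_0[OF \<Omega> h 0]) auto
      finally have "norm (?f x) < norm (h x)" using d(2)[OF k(2,3)] by simp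
      moreover have "x \<in> cbox A B" using x(1) box_subset_cbox[of A B] by blast
      ultimately show False by simp
    qed
    then have "{x \<in> cbox A B. h x \<noteq> 0} \<subseteq> N \<union> (cbox A B - box A B)" by blast
    moreover have "negligible (N \<union> (cbox A B - box A B))"
      by (intro negligible_Un N(1) negligible_frontier_interval)
    ultimately show ?thesis by (rule negligible_subset[rotated])
  qed
  obtain D where D: "countable D" "D \<subseteq> Pow \<Omega>" "\<And>X. X \<in> D \<Longrightarrow> \<exists>a b. X = cbox a b" "\<Union>D = \<Omega>"
    using open_countable_Union_open_cbox[OF \<Omega>] by metis
  have "negligible (\<Union>((\<lambda>X. {x \<in> X. h x \<noteq> 0}) ` D))"
  proof (rule negligible_countable_Union)
    fix Y assume "Y \<in> (\<lambda>X. {x \<in> X. h x \<noteq> 0}) ` D"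
    then obtain X where X: "X \<in> D" "Y = {x \<in> X. h x \<noteq> 0}" by blast
    then obtain a b where "X = cbox a b" using D(3) by blast
    then show "negligible Y" using loc[of a b] X D(2) by blast
  qed (use D(1) in auto)
  moreover have "{x \<in> \<Omega>. h x \<noteq> 0} = \<Union>((\<lambda>X. {x \<in> X. h x \<noteq> 0}) ` D)" using D(4) by blast
  ultimately show ?thesis by simp
qed

lemma integrable_cutoff:
  fixes f :: "real^'d \<Rightarrow> 'b::euclidean_space"
  assumes \<Omega>: "open \<Omega>" and f: "locally_integrable \<Omega> f" and K: "compact K" "K \<subseteq> \<Omega>"
    and \<phi>: "continuous_on UNIV \<phi>" "\<And>x. x \<notin> K \<Longrightarrow> \<phi> x = 0"
  shows "integrable (lebesgue_on \<Omega>) (\<lambda>x. (\<phi> x :: real) *\<^sub>R f x)"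
proof -
  have KM: "K \<in> sets lebesgue" using K(1) by (auto intro: lmeasurable_compact fmeasurableD)
  have i: "integrable lebesgue (\<lambda>x. indicator K x *\<^sub>R f x)"
    using locally_integrableD[OF f K] KM by (simp add: integrable_restrict_space)
  have "bounded (\<phi> ` K)"
    by (intro compact_imp_bounded compact_continuous_image continuous_on_subset[OF \<phi>(1)] K(1)) simp
  then obtain C where C: "\<And>x. x \<in> K \<Longrightarrow> \<bar>\<phi> x\<bar> \<le> C" unfolding bounded_iff real_norm_def by blast
  have "integrable lebesgue (\<lambda>x. \<phi> x *\<^sub>R (indicator K x *\<^sub>R f x))"
  proof (rule Bochner_Integration.integrable_bound)
    show "integrable lebesgue (\<lambda>x. C * norm (indicator K x *\<^sub>R f x))"
      by (intro integrable_mult_right integrable_norm i)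
    show "(\<lambda>x. \<phi> x *\<^sub>R indicat_real K x *\<^sub>R f x) \<in> borel_measurable lebesgue"
      by (rule borel_measurable_scaleR[OF borel_measurable_lebesgueI[OF borel_measurable_continuous_onI[OF \<phi>(1)]]
            borel_measurable_integrable[OF i]])
    show "AE x in lebesgue. norm (\<phi> x *\<^sub>R indicat_real K x *\<^sub>R f x) \<le> norm (C * norm (indicat_real K x *\<^sub>R f x))"
    proof (rule AE_I2)
      fix x show "norm (\<phi> x *\<^sub>R indicat_real K x *\<^sub>R f x) \<le> norm (C * norm (indicat_real K x *\<^sub>R f x))"
        using C[of x] by (cases "x \<in> K") (auto simp: abs_mult intro!: mult_right_mono)
    qed
  qed
  also have "(\<lambda>x. \<phi> x *\<^sub>R (indicator K x *\<^sub>R f x)) = (\<lambda>x. \<phi> x *\<^sub>R f x)"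
    using \<phi>(2) by (auto simp: fun_eq_iff indicator_def)
  finally show ?thesis using \<Omega> by (intro integrable_lebesgue_on_subset) (auto simp: borel_open)
qed

lemma integrable_test_function_times:
  fixes f :: "real^'d \<Rightarrow> 'b::euclidean_space" and \<psi> :: "real^'d \<Rightarrow> real"
  assumes \<Omega>: "open \<Omega>" and f: "locally_integrable \<Omega> f" and \<psi>: "\<psi> \<in> test_functions \<Omega>"
  shows "integrable (lebesgue_on \<Omega>) (\<lambda>x. \<psi> x *\<^sub>R f x)"
    and "integrable (lebesgue_on \<Omega>) (\<lambda>x. partial_deriv i \<psi> x *\<^sub>R f x)"
proof -
  obtain K where K: "compact K" "K \<subseteq> \<Omega>" "\<And>x. x \<notin> K \<Longrightarrow> \<psi> x = 0"
    "\<And>x i. x \<notin> K \<Longrightarrow> partial_deriv i \<psi> x = 0"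
    using test_function_support[OF \<psi>] by blast
  have c: "continuous_on UNIV \<psi>" "continuous_on UNIV (partial_deriv i \<psi>)"
    using test_function_smoothD[OF \<psi>]
    by (auto intro!: continuous_at_imp_continuous_on differentiable_imp_continuous_within)
  show "integrable (lebesgue_on \<Omega>) (\<lambda>x. \<psi> x *\<^sub>R f x)"
    by (rule integrable_cutoff[OF \<Omega> f K(1,2) c(1) K(3)])
  show "integrable (lebesgue_on \<Omega>) (\<lambda>x. partial_deriv i \<psi> x *\<^sub>R f x)"
    by (rule integrable_cutoff[OF \<Omega> f K(1,2) c(2) K(4)])
qed

lemma locally_integrable_vec_nth:
  fixes g :: "real^'d \<Rightarrow> 'b::euclidean_space^'d"
  shows "locally_integrable \<Omega> g \<Longrightarrow> locally_integrable \<Omega> (\<lambda>x. g x $ i)"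
  unfolding locally_integrable_def
  using integrable_bounded_linear[OF bounded_linear_vec_nth] by blast

lemma locally_integrable_diff:
  "locally_integrable \<Omega> f \<Longrightarrow> locally_integrable \<Omega> g \<Longrightarrow> locally_integrable \<Omega> (\<lambda>x. f x - g x)"
  and locally_integrable_add:
  "locally_integrable \<Omega> f \<Longrightarrow> locally_integrable \<Omega> g \<Longrightarrow> locally_integrable \<Omega> (\<lambda>x. f x + g x)"
  by (simp_all add: locally_integrable_def)

lemma weak_gradient_locally_integrable:
  assumes "has_weak_gradient \<Omega> v g"
  shows "locally_integrable \<Omega> v" "locally_integrable \<Omega> g"
  using assms unfolding has_weak_gradient_def by (auto simp only:)

lemma weak_gradientD:
  assumes "has_weak_gradient \<Omega> v g" "\<psi> \<in> test_functions \<Omega>"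
  shows "(LINT x|lebesgue_on \<Omega>. partial_deriv i \<psi> x *\<^sub>R v x) = - (LINT x|lebesgue_on \<Omega>. \<psi> x *\<^sub>R (g x $ i))"
  using assms by (simp add: has_weak_gradient_def)

lemma weak_gradient_unique:
  fixes v :: "real^'d \<Rightarrow> 'b::euclidean_space"
  assumes \<Omega>: "open \<Omega>" and g: "has_weak_gradient \<Omega> v g" and g': "has_weak_gradient \<Omega> v g'"
  shows "negligible {x \<in> \<Omega>. g x \<noteq> g' x}"
proof -
  have "negligible {x \<in> \<Omega>. g x $ i - g' x $ i \<noteq> 0}" for i
  proof (rule fundamental_lemma[OF \<Omega>])
    have l: "locally_integrable \<Omega> (\<lambda>x. g x $ i)" "locally_integrable \<Omega> (\<lambda>x. g' x $ i)"
      using g g' by (auto simp: has_weak_gradient_def intro: locally_integrable_vec_nth)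
    then show "locally_integrable \<Omega> (\<lambda>x. g x $ i - g' x $ i)" by (rule locally_integrable_diff)
    fix \<psi> :: "real^'d \<Rightarrow> real" assume \<psi>: "\<psi> \<in> test_functions \<Omega>"
    have "(LINT x|lebesgue_on \<Omega>. \<psi> x *\<^sub>R (g x $ i)) = (LINT x|lebesgue_on \<Omega>. \<psi> x *\<^sub>R (g' x $ i))"
      using weak_gradientD[OF g \<psi>, of i] weak_gradientD[OF g' \<psi>, of i] by simp
    then show "(LINT x|lebesgue_on \<Omega>. \<psi> x *\<^sub>R (g x $ i - g' x $ i)) = 0"
      using integrable_test_function_times(1)[OF \<Omega> l(1) \<psi>] integrable_test_function_times(1)[OF \<Omega> l(2) \<psi>]
      by (simp add: scaleR_diff_right)
  qed
  then have "negligible (\<Union>i\<in>UNIV. {x \<in> \<Omega>. g x $ i - g' x $ i \<noteq> 0})"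
    by (intro negligible_Union) auto
  moreover have "{x \<in> \<Omega>. g x \<noteq> g' x} \<subseteq> (\<Union>i\<in>UNIV. {x \<in> \<Omega>. g x $ i - g' x $ i \<noteq> 0})"
    by (auto simp: vec_eq_iff)
  ultimately show ?thesis by (rule negligible_subset)
qed

lemma grad_weak_gradient:
  assumes "has_weak_gradient \<Omega> v g"
  shows "has_weak_gradient \<Omega> v (grad \<Omega> v)"
  unfolding grad_def using assms by (rule someI[of "\<lambda>g. has_weak_gradient \<Omega> v g"])

text \<open>This makes \<open>grad\<close> computable: any weak gradient may be substituted for it under the integral.\<close>

lemma grad_eq_AE:
  fixes v :: "real^'d \<Rightarrow> 'b::euclidean_space"
  assumes \<Omega>: "open \<Omega>" and g: "has_weak_gradient \<Omega> v g"
  shows "AE x in lebesgue_on \<Omega>. grad \<Omega> v x = g x"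
proof -
  have "negligible {x \<in> \<Omega>. grad \<Omega> v x \<noteq> g x}"
    by (rule weak_gradient_unique[OF \<Omega> grad_weak_gradient[OF g] g])
  then have "{x \<in> \<Omega>. grad \<Omega> v x \<noteq> g x} \<in> null_sets (lebesgue_on \<Omega>)"
    using \<Omega> by (subst null_sets_restrict_space) (auto simp: negligible_iff_null_sets borel_open)
  from AE_not_in[OF this] show ?thesis by (rule AE_mp) (auto intro!: AE_I2)
qed

lemma weak_gradient_add:
  fixes v w :: "real^'d \<Rightarrow> 'b::euclidean_space"
  assumes \<Omega>: "open \<Omega>" and v: "has_weak_gradient \<Omega> v g" and w: "has_weak_gradient \<Omega> w k"
  shows "has_weak_gradient \<Omega> (\<lambda>x. v x + w x) (\<lambda>x. g x + k x)"
proof -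
  have l: "locally_integrable \<Omega> v" "locally_integrable \<Omega> w"
    "locally_integrable \<Omega> (\<lambda>x. g x $ i)" "locally_integrable \<Omega> (\<lambda>x. k x $ i)" for i
    using v w by (auto simp: has_weak_gradient_def intro: locally_integrable_vec_nth)
  note i = integrable_test_function_times[OF \<Omega>]
  show ?thesis
    using v w l unfolding has_weak_gradient_def
    by (auto simp: scaleR_add_right i intro!: locally_integrable_add)
qed

lemma bounded_linear_vec_map:
  fixes T :: "'b::euclidean_space \<Rightarrow> 'c::euclidean_space"
  assumes "bounded_linear T"
  shows "bounded_linear (\<lambda>y::'b^'d. \<chi> i. T (y $ i))"
proof -
  interpret T: bounded_linear T by (rule assms)
  have "linear (\<lambda>y::'b^'d. \<chi> i. T (y $ i))"
    by (rule linearI) (auto simp: vec_eq_iff T.add T.scaleR)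
  then show ?thesis by (simp add: linear_conv_bounded_linear)
qed

text \<open>Real and imaginary parts, the embedding of the reals into the complex numbers and multiplication by
constants are the linear maps of interest.\<close>

lemma weak_gradient_linear_image:
  fixes v :: "real^'d \<Rightarrow> 'b::euclidean_space" and T :: "'b \<Rightarrow> 'c::euclidean_space"
  assumes \<Omega>: "open \<Omega>" and v: "has_weak_gradient \<Omega> v g" and T: "bounded_linear T"
  shows "has_weak_gradient \<Omega> (\<lambda>x. T (v x)) (\<lambda>x. \<chi> i. T (g x $ i))"
proof -
  have l: "locally_integrable \<Omega> v" "locally_integrable \<Omega> (\<lambda>x. g x $ i)" for i
    using v by (auto simp: has_weak_gradient_def intro: locally_integrable_vec_nth)
  note i = integrable_test_function_times[OF \<Omega>]
  interpret T: bounded_linear T by (rule T)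
  have "locally_integrable \<Omega> (\<lambda>x. T (v x))"
    using l(1) T unfolding locally_integrable_def by (auto intro: integrable_bounded_linear)
  moreover have "locally_integrable \<Omega> (\<lambda>x. \<chi> i. T (g x $ i))"
    using v bounded_linear_vec_map[OF T] unfolding locally_integrable_def has_weak_gradient_def
    by (auto intro: integrable_bounded_linear)
  moreover have "(LINT x|lebesgue_on \<Omega>. partial_deriv i \<psi> x *\<^sub>R T (v x)) =
        - (LINT x|lebesgue_on \<Omega>. \<psi> x *\<^sub>R T (g x $ i))"
    if \<psi>: "\<psi> \<in> test_functions \<Omega>" for \<psi> :: "real^'d \<Rightarrow> real" and i
  proof -
    have "(LINT x|lebesgue_on \<Omega>. partial_deriv i \<psi> x *\<^sub>R T (v x)) = T (LINT x|lebesgue_on \<Omega>. partial_deriv i \<psi> x *\<^sub>R v x)"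
      using integral_bounded_linear[OF T i(2)[OF l(1) \<psi>, of i]] by (simp add: T.scaleR)
    also have "\<dots> = T (- (LINT x|lebesgue_on \<Omega>. \<psi> x *\<^sub>R (g x $ i)))"
      using v \<psi> by (simp add: has_weak_gradient_def)
    also have "\<dots> = - (LINT x|lebesgue_on \<Omega>. \<psi> x *\<^sub>R T (g x $ i))"
      using integral_bounded_linear[OF T i(1)[OF l(2) \<psi>, of i]] by (simp add: T.scaleR T.neg)
    finally show ?thesis .
  qed
  ultimately show ?thesis by (simp add: has_weak_gradient_def)
qed

lemma weak_gradient_cong:
  fixes v w :: "real^'d \<Rightarrow> 'b::euclidean_space"
  assumes v: "has_weak_gradient \<Omega> v g" and eq: "\<And>x. x \<in> \<Omega> \<Longrightarrow> v x = w x"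
  shows "has_weak_gradient \<Omega> w g"
  unfolding has_weak_gradient_def
proof (intro conjI ballI allI)
  show "locally_integrable \<Omega> w"
    unfolding locally_integrable_def
  proof (intro allI impI)
    fix K :: "(real^'d) set" assume K: "compact K \<and> K \<subseteq> \<Omega>"
    then have "integrable (lebesgue_on K) v"
      by (intro locally_integrableD[OF weak_gradient_locally_integrable(1)[OF v]]) simp_all
    moreover have "integrable (lebesgue_on K) v = integrable (lebesgue_on K) w"
    proof (rule Bochner_Integration.integrable_cong[OF refl])
      fix x assume "x \<in> space (lebesgue_on K)"
      then show "v x = w x" using K by (intro eq) auto
    qed
    ultimately show "integrable (lebesgue_on K) w" by simp
  qed
  show "locally_integrable \<Omega> g" by (rule weak_gradient_locally_integrable(2)[OF v])
  fix \<psi> :: "real^'d \<Rightarrow> real" and i assume \<psi>: "\<psi> \<in> test_functions \<Omega>"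
  have "(LINT x|lebesgue_on \<Omega>. partial_deriv i \<psi> x *\<^sub>R w x) = (LINT x|lebesgue_on \<Omega>. partial_deriv i \<psi> x *\<^sub>R v x)"
  proof (rule Bochner_Integration.integral_cong[OF refl])
    fix x assume "x \<in> space (lebesgue_on \<Omega>)"
    then have "w x = v x" using eq[of x] by simp
    then show "partial_deriv i \<psi> x *\<^sub>R w x = partial_deriv i \<psi> x *\<^sub>R v x" by (rule arg_cong)
  qed
  also have "\<dots> = - (LINT x|lebesgue_on \<Omega>. \<psi> x *\<^sub>R (g x $ i))"
    by (rule weak_gradientD[OF v \<psi>])
  finally show "(LINT x|lebesgue_on \<Omega>. partial_deriv i \<psi> x *\<^sub>R w x) = - (LINT x|lebesgue_on \<Omega>. \<psi> x *\<^sub>R (g x $ i))" .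
qed

section \<open>The Crank-Nicolson scheme in an abstract Galerkin space\<close>

lemma integrable_continuous_closure:
  fixes f :: "real^'d \<Rightarrow> real"
  assumes \<Omega>: "open \<Omega>" "bounded \<Omega>" and f: "continuous_on (closure \<Omega>) f"
  shows "integrable (lebesgue_on \<Omega>) f"
proof -
  have M: "\<Omega> \<in> sets lebesgue" using \<Omega>(1) by (simp add: borel_open)
  have fin: "finite_measure (lebesgue_on \<Omega>)"
    using \<Omega> by (intro finite_measure_lebesgue_on lmeasurable_open)
  have "bounded (f ` closure \<Omega>)"
    using \<Omega>(2) f by (intro compact_imp_bounded compact_continuous_image) (auto simp: compact_closure)
  then obtain C where C: "\<And>x. x \<in> closure \<Omega> \<Longrightarrow> norm (f x) \<le> C" unfolding bounded_iff by blast
  have "f \<in> borel_measurable (lebesgue_on \<Omega>)"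
    by (intro continuous_imp_measurable_on_sets_lebesgue continuous_on_subset[OF f] closure_subset M)
  then show ?thesis
    by (intro finite_measure.integrable_const_bound[OF fin, of f C] AE_I2)
       (use C closure_subset in auto)
qed

text \<open>A property that holds almost everywhere in an open set and defines a closed set holds on the whole
closure; thus equality of finite element functions up to null sets is pointwise equality.\<close>

lemma continuous_integral_square_eq_0:
  fixes f :: "real^'d \<Rightarrow> real"
  assumes \<Omega>: "open \<Omega>" "bounded \<Omega>" and f: "continuous_on (closure \<Omega>) f"
    and 0: "(LINT x|lebesgue_on \<Omega>. (f x)\<^sup>2) \<le> 0" and x: "x \<in> closure \<Omega>"
  shows "f x = 0"
proof -
  have M: "\<Omega> \<in> sets lebesgue" using \<Omega>(1) by (simp add: borel_open)
  have "integrable (lebesgue_on \<Omega>) (\<lambda>x. (f x)\<^sup>2)"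
    by (intro integrable_continuous_closure[OF \<Omega>] continuous_intros f)
  moreover have "(LINT x|lebesgue_on \<Omega>. (f x)\<^sup>2) = 0" using 0 by (intro antisym) simp_all
  ultimately have "AE x in lebesgue_on \<Omega>. (f x)\<^sup>2 = 0"
    by (subst (asm) integral_nonneg_eq_0_iff_AE) auto
  then have ae: "AE x\<in>\<Omega> in lebesgue. x \<in> {x \<in> closure \<Omega>. f x = 0}"
    using M closure_subset[of \<Omega>]
    by (subst (asm) AE_restrict_space_iff) (auto simp del: power_eq_0_iff elim!: eventually_mono)
  have cl: "closed {x \<in> closure \<Omega>. f x = 0}"
    using continuous_closed_preimage_constant[OF f closed_closure] by simp
  have "y \<in> {x \<in> closure \<Omega>. f x = 0}" if "y \<in> \<Omega>" for y
    using mem_closed_if_AE_lebesgue_open[OF \<Omega>(1) cl ae that] .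
  then have "closure \<Omega> \<subseteq> {x \<in> closure \<Omega>. f x = 0}" by (intro closure_minimal cl) blast
  with x show ?thesis by blast
qed

text \<open>The properties of a finite element space that the uniqueness argument consumes. The constants \<open>S\<close>
and \<open>P\<close> are parameters, so that they can be chosen before the mesh.\<close>

locale galerkin_space =
  fixes \<Omega> :: "(real^'d) set" and X :: "(real^'d \<Rightarrow> real) set"
    and a :: "(real^'d \<Rightarrow> real) \<Rightarrow> (real^'d \<Rightarrow> real) \<Rightarrow> real" and S P :: real
  assumes open_\<Omega>: "open \<Omega>" and bounded_\<Omega>: "bounded \<Omega>"
    and X_cont: "v \<in> X \<Longrightarrow> continuous_on (closure \<Omega>) v"
    and X_add: "v \<in> X \<Longrightarrow> w \<in> X \<Longrightarrow> (\<lambda>x. v x + w x) \<in> X"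
    and X_diff: "v \<in> X \<Longrightarrow> w \<in> X \<Longrightarrow> (\<lambda>x. v x - w x) \<in> X"
    and a_add: "u \<in> X \<Longrightarrow> v \<in> X \<Longrightarrow> w \<in> X \<Longrightarrow> a (\<lambda>x. u x + v x) w = a u w + a v w"
    and a_diff: "u \<in> X \<Longrightarrow> v \<in> X \<Longrightarrow> w \<in> X \<Longrightarrow> a (\<lambda>x. u x - v x) w = a u w - a v w"
    and a_sym: "a v w = a w v"
    and a_nonneg: "0 \<le> a v v"
    and a_cong: "v \<in> X \<Longrightarrow> v' \<in> X \<Longrightarrow> (\<And>x. x \<in> \<Omega> \<Longrightarrow> v x = v' x) \<Longrightarrow> a v w = a v' w"
    and S_nonneg: "0 \<le> S" and P_nonneg: "0 \<le> P"
    and sobolev: "v \<in> X \<Longrightarrow> (LINT x|lebesgue_on \<Omega>. v x ^ 4) \<le> S ^ 4 * (a v v)\<^sup>2"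
    and poincare: "v \<in> X \<Longrightarrow> (LINT x|lebesgue_on \<Omega>. (v x)\<^sup>2) \<le> P * a v v"
begin

abbreviation I :: "(real^'d \<Rightarrow> real) \<Rightarrow> real" where
  "I f \<equiv> LINT x|lebesgue_on \<Omega>. f x"

abbreviation cont :: "(real^'d \<Rightarrow> real) \<Rightarrow> bool" where
  "cont f \<equiv> continuous_on (closure \<Omega>) f"

definition L2 :: "(real^'d \<Rightarrow> real) \<Rightarrow> real" where "L2 f = sqrt (I (\<lambda>x. (f x)\<^sup>2))"

definition anorm :: "(real^'d \<Rightarrow> real) \<Rightarrow> real" where "anorm v = sqrt (a v v)"

lemma L2_nonneg: "0 \<le> L2 f" and L2_square: "(L2 f)\<^sup>2 = I (\<lambda>x. (f x)\<^sup>2)"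
  by (simp_all add: L2_def)

lemma anorm_nonneg: "0 \<le> anorm f" and anorm_square: "(anorm f)\<^sup>2 = a f f"
  using a_nonneg by (simp_all add: anorm_def)

lemma cont_integrable: "cont f \<Longrightarrow> integrable (lebesgue_on \<Omega>) f"
  by (rule integrable_continuous_closure[OF open_\<Omega> bounded_\<Omega>])

lemma I_add: "cont f \<Longrightarrow> cont g \<Longrightarrow> I (\<lambda>x. f x + g x) = I f + I g"
  and I_diff: "cont f \<Longrightarrow> cont g \<Longrightarrow> I (\<lambda>x. f x - g x) = I f - I g"
  by (simp_all add: cont_integrable)

lemmas conts = continuous_on_add continuous_on_diff continuous_on_mult continuous_on_power

text \<open>The estimate of all nonlinear terms: two factors are measured in \<open>L\<^sup>4\<close>, hence by their gradients,
and the third in \<open>L\<^sup>2\<close>.\<close>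

lemma trilinear_bound:
  assumes f: "f \<in> X" and g: "g \<in> X" and h: "cont h"
  shows "\<bar>I (\<lambda>x. f x * g x * h x)\<bar> \<le> S\<^sup>2 * anorm f * anorm g * L2 h"
proof -
  have m: "f \<in> borel_measurable (lebesgue_on \<Omega>)" "g \<in> borel_measurable (lebesgue_on \<Omega>)"
    "h \<in> borel_measurable (lebesgue_on \<Omega>)"
    using cont_integrable[OF X_cont[OF f]] cont_integrable[OF X_cont[OF g]] cont_integrable[OF h] by auto
  have 4: "integrable (lebesgue_on \<Omega>) (\<lambda>x. f x ^ 4)" "integrable (lebesgue_on \<Omega>) (\<lambda>x. g x ^ 4)"
    and 2: "integrable (lebesgue_on \<Omega>) (\<lambda>x. (h x)\<^sup>2)"
    by (auto intro!: cont_integrable conts X_cont[OF f] X_cont[OF g] h)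
  note fg = integral_product_square_le[OF m(1,2) 4]
  have "(I (\<lambda>x. (f x * g x)\<^sup>2))\<^sup>2 \<le> (S ^ 4 * (a f f)\<^sup>2) * (S ^ 4 * (a g g)\<^sup>2)"
    by (rule order_trans[OF fg(2)]) (intro mult_mono sobolev f g, auto simp: S_nonneg)
  also have "\<dots> = ((S\<^sup>2 * anorm f * anorm g)\<^sup>2)\<^sup>2"
    by (simp only: anorm_square[symmetric] power_mult_distrib power_mult[symmetric]) simp
  finally have "I (\<lambda>x. (f x * g x)\<^sup>2) \<le> (S\<^sup>2 * anorm f * anorm g)\<^sup>2" by (rule power2_le_imp_le) simp
  then have "(I (\<lambda>x. f x * g x * h x))\<^sup>2 \<le> (S\<^sup>2 * anorm f * anorm g)\<^sup>2 * (L2 h)\<^sup>2"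
    using m by (intro order_trans[OF cauchy_schwarz_integral(2)[OF _ m(3) fg(1) 2]]) (auto simp: L2_square intro: mult_right_mono)
  also have "\<dots> = (S\<^sup>2 * anorm f * anorm g * L2 h)\<^sup>2" by (simp add: power_mult_distrib)
  finally show ?thesis
    using anorm_nonneg L2_nonneg by (simp add: abs_le_square_iff[symmetric] abs_mult)
qed

definition density_eq :: "real \<Rightarrow> real \<Rightarrow> (real^'d \<Rightarrow> real) \<Rightarrow> (real^'d \<Rightarrow> real) \<Rightarrow> (real^'d \<Rightarrow> real) \<Rightarrow> bool" where
  "density_eq \<alpha> B p q \<phi> \<longleftrightarrow>
     (\<forall>w\<in>X. \<alpha> * I (\<lambda>x. \<phi> x * w x) + B * a \<phi> w = I (\<lambda>x. ((p x)\<^sup>2 + (q x)\<^sup>2) * w x))"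

text \<open>One step of the scheme for \<open>u = p + \<i> q\<close>, tested with real functions: the imaginary part gives the
first equation and the real part the second. The denominators 2 and 4 come from the midpoint averages.\<close>

definition cn_step where
  "cn_step \<tau> p q \<phi> p' q' \<phi>' \<longleftrightarrow>
     (\<forall>v\<in>X. I (\<lambda>x. (p' x - p x) * v x) / \<tau> =
        a (\<lambda>x. q' x + q x) v / 2 + I (\<lambda>x. (\<phi>' x + \<phi> x) * (q' x + q x) * v x) / 4) \<and>
     (\<forall>v\<in>X. I (\<lambda>x. (q' x - q x) * v x) / \<tau> =
        - a (\<lambda>x. p' x + p x) v / 2 - I (\<lambda>x. (\<phi>' x + \<phi> x) * (p' x + p x) * v x) / 4)"

lemma cn_stepD:
  assumes "cn_step \<tau> p q \<phi> p' q' \<phi>'" "v \<in> X"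
  shows "I (\<lambda>x. (p' x - p x) * v x) / \<tau> =
        a (\<lambda>x. q' x + q x) v / 2 + I (\<lambda>x. (\<phi>' x + \<phi> x) * (q' x + q x) * v x) / 4"
    and "I (\<lambda>x. (q' x - q x) * v x) / \<tau> =
        - a (\<lambda>x. p' x + p x) v / 2 - I (\<lambda>x. (\<phi>' x + \<phi> x) * (p' x + p x) * v x) / 4"
  using assms unfolding cn_step_def by blast+

definition kinetic where "kinetic p q = a p p + a q q"

definition energy where
  "energy \<alpha> B p q \<phi> = kinetic p q + (\<alpha> * I (\<lambda>x. (\<phi> x)\<^sup>2) + B * a \<phi> \<phi>) / 2"

lemma kinetic_nonneg: "0 \<le> kinetic p q" using a_nonneg[of p] a_nonneg[of q] by (simp add: kinetic_def)

lemma anorm_le_sqrt_kinetic: "anorm p \<le> sqrt (kinetic p q)" "anorm q \<le> sqrt (kinetic p q)"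
  using a_nonneg[of p] a_nonneg[of q] by (simp_all add: anorm_def kinetic_def)

lemma a_diff_square:
  assumes "v \<in> X" "w \<in> X"
  shows "a (\<lambda>x. v x + w x) (\<lambda>x. v x - w x) = a v v - a w w"
proof -
  have "a (\<lambda>x. v x + w x) (\<lambda>x. v x - w x) = a v (\<lambda>x. v x - w x) + a w (\<lambda>x. v x - w x)"
    by (intro a_add assms X_diff)
  also have "a v (\<lambda>x. v x - w x) = a v v - a w v" using a_diff[OF assms assms(1)] a_sym by metis
  also have "a w (\<lambda>x. v x - w x) = a v w - a w w" using a_diff[OF assms assms(2)] a_sym by metis
  finally show ?thesis using a_sym[of v w] by simp
qed

text \<open>The equations are tested with the sums of old and new values; in their sum the terms with \<open>a\<close>
cancel by symmetry and the coupling terms because they coincide.\<close>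

lemma mass_conservation:
  assumes X: "p \<in> X" "q \<in> X" "\<phi> \<in> X" "p' \<in> X" "q' \<in> X" "\<phi>' \<in> X"
    and step: "cn_step \<tau> p q \<phi> p' q' \<phi>'" and \<tau>: "\<tau> > 0"
  shows "I (\<lambda>x. (p' x)\<^sup>2) + I (\<lambda>x. (q' x)\<^sup>2) = I (\<lambda>x. (p x)\<^sup>2) + I (\<lambda>x. (q x)\<^sup>2)"
proof -
  have 1: "I (\<lambda>x. (p' x - p x) * (p' x + p x)) / \<tau> =
        a (\<lambda>x. q' x + q x) (\<lambda>x. p' x + p x) / 2 + I (\<lambda>x. (\<phi>' x + \<phi> x) * (q' x + q x) * (p' x + p x)) / 4"
    by (rule cn_stepD(1)[OF step X_add[OF X(4,1)]])
  have 2: "I (\<lambda>x. (q' x - q x) * (q' x + q x)) / \<tau> =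
        - a (\<lambda>x. p' x + p x) (\<lambda>x. q' x + q x) / 2 - I (\<lambda>x. (\<phi>' x + \<phi> x) * (p' x + p x) * (q' x + q x)) / 4"
    by (rule cn_stepD(2)[OF step X_add[OF X(5,2)]])
  have sq: "I (\<lambda>x. (f x - g x) * (f x + g x)) = I (\<lambda>x. (f x)\<^sup>2) - I (\<lambda>x. (g x)\<^sup>2)" if "f \<in> X" "g \<in> X" for f g
    by (subst I_diff[symmetric]) (auto intro!: conts that[THEN X_cont] Bochner_Integration.integral_cong simp: power2_eq_square algebra_simps)
  have "I (\<lambda>x. (\<phi>' x + \<phi> x) * (q' x + q x) * (p' x + p x)) = I (\<lambda>x. (\<phi>' x + \<phi> x) * (p' x + p x) * (q' x + q x))"
    by (simp add: mult_ac)
  with 1 2 have "I (\<lambda>x. (p' x - p x) * (p' x + p x)) / \<tau> + I (\<lambda>x. (q' x - q x) * (q' x + q x)) / \<tau> = 0"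
    using a_sym[of "\<lambda>x. q' x + q x"] by simp
  then show ?thesis using \<tau> by (simp add: sq X add_divide_distrib[symmetric])
qed

text \<open>Testing the two equations crosswise, with the increments of \<open>q\<close> and of \<open>p\<close>, makes the left-hand sides
equal; they cancel in the difference.\<close>

lemma energy_identity:
  assumes X: "p \<in> X" "q \<in> X" "\<phi> \<in> X" "p' \<in> X" "q' \<in> X" "\<phi>' \<in> X"
    and step: "cn_step \<tau> p q \<phi> p' q' \<phi>'"
  defines "\<rho> \<equiv> \<lambda>x. (p x)\<^sup>2 + (q x)\<^sup>2" and "\<rho>' \<equiv> \<lambda>x. (p' x)\<^sup>2 + (q' x)\<^sup>2"
  shows "kinetic p' q' - kinetic p q
    + (I (\<lambda>x. \<rho>' x * \<phi>' x) - I (\<lambda>x. \<rho> x * \<phi>' x) + I (\<lambda>x. \<rho>' x * \<phi> x) - I (\<lambda>x. \<rho> x * \<phi> x)) / 2 = 0"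
proof -
  have 1: "I (\<lambda>x. (p' x - p x) * (q' x - q x)) / \<tau> =
        a (\<lambda>x. q' x + q x) (\<lambda>x. q' x - q x) / 2 + I (\<lambda>x. (\<phi>' x + \<phi> x) * (q' x + q x) * (q' x - q x)) / 4"
    by (rule cn_stepD(1)[OF step X_diff[OF X(5,2)]])
  have 2: "I (\<lambda>x. (q' x - q x) * (p' x - p x)) / \<tau> =
        - a (\<lambda>x. p' x + p x) (\<lambda>x. p' x - p x) / 2 - I (\<lambda>x. (\<phi>' x + \<phi> x) * (p' x + p x) * (p' x - p x)) / 4"
    by (rule cn_stepD(2)[OF step X_diff[OF X(4,1)]])
  have "I (\<lambda>x. (\<phi>' x + \<phi> x) * (q' x + q x) * (q' x - q x)) + I (\<lambda>x. (\<phi>' x + \<phi> x) * (p' x + p x) * (p' x - p x))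
     = I (\<lambda>x. \<rho>' x * \<phi>' x - \<rho> x * \<phi>' x + \<rho>' x * \<phi> x - \<rho> x * \<phi> x)"
    unfolding \<rho>_def \<rho>'_def
    by (subst I_add[symmetric]) (auto intro!: conts X[THEN X_cont] Bochner_Integration.integral_cong simp: power2_eq_square algebra_simps)
  also have "\<dots> = I (\<lambda>x. \<rho>' x * \<phi>' x) - I (\<lambda>x. \<rho> x * \<phi>' x) + I (\<lambda>x. \<rho>' x * \<phi> x) - I (\<lambda>x. \<rho> x * \<phi> x)"
    unfolding \<rho>_def \<rho>'_def by (simp add: I_add I_diff conts X[THEN X_cont])
  finally have "I (\<lambda>x. (\<phi>' x + \<phi> x) * (q' x + q x) * (q' x - q x)) + I (\<lambda>x. (\<phi>' x + \<phi> x) * (p' x + p x) * (p' x - p x))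
    = I (\<lambda>x. \<rho>' x * \<phi>' x) - I (\<lambda>x. \<rho> x * \<phi>' x) + I (\<lambda>x. \<rho>' x * \<phi> x) - I (\<lambda>x. \<rho> x * \<phi> x)" .
  moreover have "I (\<lambda>x. (p' x - p x) * (q' x - q x)) / \<tau> = I (\<lambda>x. (q' x - q x) * (p' x - p x)) / \<tau>"
    by (simp add: mult.commute)
  ultimately show ?thesis
    using 1 2 a_diff_square[OF X(5,2)] a_diff_square[OF X(4,1)] unfolding kinetic_def by argo
qed

text \<open>The density equation at both time levels, tested with both potentials, turns the coupling terms of
the energy identity into differences of potential energies.\<close>

lemma energy_conservation:
  assumes X: "p \<in> X" "q \<in> X" "\<phi> \<in> X" "p' \<in> X" "q' \<in> X" "\<phi>' \<in> X"
    and step: "cn_step \<tau> p q \<phi> p' q' \<phi>'"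
    and d: "density_eq \<alpha> B p q \<phi>" and d': "density_eq \<alpha> B p' q' \<phi>'"
  shows "energy \<alpha> B p' q' \<phi>' = energy \<alpha> B p q \<phi>"
proof -
  have "\<alpha> * I (\<lambda>x. \<phi>' x * \<phi>' x) + B * a \<phi>' \<phi>' = I (\<lambda>x. ((p' x)\<^sup>2 + (q' x)\<^sup>2) * \<phi>' x)"
    "\<alpha> * I (\<lambda>x. \<phi>' x * \<phi> x) + B * a \<phi>' \<phi> = I (\<lambda>x. ((p' x)\<^sup>2 + (q' x)\<^sup>2) * \<phi> x)"
    "\<alpha> * I (\<lambda>x. \<phi> x * \<phi>' x) + B * a \<phi> \<phi>' = I (\<lambda>x. ((p x)\<^sup>2 + (q x)\<^sup>2) * \<phi>' x)"
    "\<alpha> * I (\<lambda>x. \<phi> x * \<phi> x) + B * a \<phi> \<phi> = I (\<lambda>x. ((p x)\<^sup>2 + (q x)\<^sup>2) * \<phi> x)"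
    using d d' X unfolding density_eq_def by blast+
  moreover have "\<alpha> * I (\<lambda>x. \<phi>' x * \<phi> x) = \<alpha> * I (\<lambda>x. \<phi> x * \<phi>' x)" by (simp add: mult.commute)
  moreover have "B * a \<phi> \<phi>' = B * a \<phi>' \<phi>" using a_sym[of \<phi> \<phi>'] by simp
  ultimately show ?thesis
    using energy_identity[OF X step] unfolding energy_def power2_eq_square by argo
qed

text \<open>Twice the terms left over in \<open>first_step_energy_bound\<close>, where \<open>G\<close> and \<open>F\<close> bound the gradients of the
initial wave function and potential and \<open>sqrt P * G\<close> bounds the \<open>L\<^sup>2\<close> norms of its parts.\<close>

definition energy_bound where
  "energy_bound B G F = 2 * (G\<^sup>2 + S\<^sup>2 * (sqrt P * G) * F * G
     + (S\<^sup>2 * (sqrt P * G))\<^sup>2 * G\<^sup>2 / B + (S\<^sup>2 * (sqrt P * G))\<^sup>2 * F\<^sup>2 / 2)"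

lemma energy_bound_ge: "B > 0 \<Longrightarrow> G \<ge> 0 \<Longrightarrow> F \<ge> 0 \<Longrightarrow> G\<^sup>2 \<le> energy_bound B G F"
  unfolding energy_bound_def using P_nonneg
  by (smt (verit) divide_nonneg_pos mult_nonneg_nonneg real_sqrt_ge_0_iff zero_le_power2)

lemma density_bound:
  assumes X: "p \<in> X" "q \<in> X" "\<phi> \<in> X" and k: "anorm p \<le> k" "anorm q \<le> k" and m: "L2 p \<le> m" "L2 q \<le> m"
  shows "\<bar>I (\<lambda>x. ((p x)\<^sup>2 + (q x)\<^sup>2) * \<phi> x)\<bar> \<le> 2 * (S\<^sup>2 * anorm \<phi> * k * m)"
proof -
  have k0: "k \<ge> 0" using k anorm_nonneg[of p] by simp
  have le: "\<bar>I (\<lambda>x. \<phi> x * f x * f x)\<bar> \<le> S\<^sup>2 * anorm \<phi> * k * m" if "f \<in> X" "anorm f \<le> k" "L2 f \<le> m" for f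
    by (rule order_trans[OF trilinear_bound[OF X(3) that(1) X_cont[OF that(1)]]])
       (use that k0 anorm_nonneg L2_nonneg S_nonneg in \<open>auto intro!: mult_mono mult_nonneg_nonneg\<close>)
  have "I (\<lambda>x. ((p x)\<^sup>2 + (q x)\<^sup>2) * \<phi> x) = I (\<lambda>x. \<phi> x * p x * p x) + I (\<lambda>x. \<phi> x * q x * q x)"
    by (subst I_add[symmetric]) (auto intro!: conts X[THEN X_cont] Bochner_Integration.integral_cong simp: power2_eq_square algebra_simps)
  then show ?thesis using le[OF X(1) k(1) m(1)] le[OF X(2) k(2) m(2)] by linarith
qed

lemma mass_bound:
  assumes X: "p \<in> X" "q \<in> X" and G: "I (\<lambda>x. (p x)\<^sup>2) + I (\<lambda>x. (q x)\<^sup>2) \<le> P * G\<^sup>2" "G \<ge> 0"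
  shows "L2 p \<le> sqrt P * G" "L2 q \<le> sqrt P * G"
proof -
  have "I (\<lambda>x. (p x)\<^sup>2) \<ge> 0" "I (\<lambda>x. (q x)\<^sup>2) \<ge> 0" by simp_all
  then have "I (\<lambda>x. (p x)\<^sup>2) \<le> P * G\<^sup>2" "I (\<lambda>x. (q x)\<^sup>2) \<le> P * G\<^sup>2" using G(1) by linarith+
  then have "(L2 p)\<^sup>2 \<le> (sqrt P * G)\<^sup>2" "(L2 q)\<^sup>2 \<le> (sqrt P * G)\<^sup>2"
    using P_nonneg by (simp_all add: L2_square power_mult_distrib)
  then show "L2 p \<le> sqrt P * G" "L2 q \<le> sqrt P * G"
    using G(2) P_nonneg by (auto intro: power2_le_imp_le)
qed

text \<open>No density equation is available for the old potential, so three coupling terms remain. Each is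
bounded by a product of the gradient norms and the conserved mass that is at most linear in the new
gradient norms; Young's inequality absorbs these into half of the new energy.\<close>

lemma first_step_energy_bound:
  assumes X: "p \<in> X" "q \<in> X" "\<phi> \<in> X" "p' \<in> X" "q' \<in> X" "\<phi>' \<in> X"
    and step: "cn_step \<tau> p q \<phi> p' q' \<phi>'" and \<tau>: "\<tau> > 0"
    and d': "density_eq \<alpha> B p' q' \<phi>'" and \<alpha>: "\<alpha> \<ge> 0" and B: "B > 0"
    and G: "kinetic p q \<le> G\<^sup>2" "G \<ge> 0" and F: "a \<phi> \<phi> \<le> F\<^sup>2" "F \<ge> 0"
  shows "energy \<alpha> B p' q' \<phi>' \<le> energy_bound B G F"
proof -
  define m where "m = sqrt P * G"
  define c where "c = S\<^sup>2 * m"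
  define k where "k = sqrt (kinetic p' q')"
  have c0: "c \<ge> 0" and m0: "m \<ge> 0" using P_nonneg G(2) by (simp_all add: c_def m_def)
  have k0: "k \<ge> 0" and k2: "k\<^sup>2 = kinetic p' q'" using kinetic_nonneg by (simp_all add: k_def)
  have "I (\<lambda>x. (p x)\<^sup>2) + I (\<lambda>x. (q x)\<^sup>2) \<le> P * kinetic p q"
    using poincare[OF X(1)] poincare[OF X(2)] by (simp add: kinetic_def algebra_simps)
  also have "\<dots> \<le> P * G\<^sup>2" using G P_nonneg by (intro mult_left_mono)
  finally have mass: "I (\<lambda>x. (p x)\<^sup>2) + I (\<lambda>x. (q x)\<^sup>2) \<le> P * G\<^sup>2" .
  then have mass': "I (\<lambda>x. (p' x)\<^sup>2) + I (\<lambda>x. (q' x)\<^sup>2) \<le> P * G\<^sup>2"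
    using mass_conservation[OF X step \<tau>] by simp
  note mb = mass_bound[OF X(1,2) mass G(2), folded m_def] mass_bound[OF X(4,5) mass' G(2), folded m_def]
  have "sqrt (kinetic p q) \<le> G" using G by (simp add: real_le_lsqrt)
  then have G': "anorm p \<le> G" "anorm q \<le> G" using anorm_le_sqrt_kinetic[of p q] anorm_le_sqrt_kinetic(2)[of q p] by linarith+
  have F': "anorm \<phi> \<le> F" using F by (simp add: anorm_def real_le_lsqrt)
  have "\<bar>I (\<lambda>x. ((p x)\<^sup>2 + (q x)\<^sup>2) * \<phi>' x)\<bar> \<le> 2 * (S\<^sup>2 * anorm \<phi>' * G * m)"
    by (rule density_bound[OF X(1,2,6) G' mb(1,2)])
  then have e1: "\<bar>I (\<lambda>x. ((p x)\<^sup>2 + (q x)\<^sup>2) * \<phi>' x)\<bar> \<le> 2 * (c * G * anorm \<phi>')"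
    by (simp add: c_def mult_ac)
  have "\<bar>I (\<lambda>x. ((p' x)\<^sup>2 + (q' x)\<^sup>2) * \<phi> x)\<bar> \<le> 2 * (S\<^sup>2 * anorm \<phi> * k * m)"
    by (rule density_bound[OF X(4,5,3) _ _ mb(3,4)]) (simp_all add: k_def anorm_le_sqrt_kinetic)
  also have "\<dots> = 2 * (c * k * anorm \<phi>)" by (simp add: c_def mult_ac)
  also have "\<dots> \<le> 2 * (c * k * F)" using F' c0 k0 by (intro mult_left_mono) auto
  also have "\<dots> = 2 * (c * F * k)" by simp
  finally have e2: "\<bar>I (\<lambda>x. ((p' x)\<^sup>2 + (q' x)\<^sup>2) * \<phi> x)\<bar> \<le> 2 * (c * F * k)" .
  have "\<bar>I (\<lambda>x. ((p x)\<^sup>2 + (q x)\<^sup>2) * \<phi> x)\<bar> \<le> 2 * (S\<^sup>2 * anorm \<phi> * G * m)"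
    by (rule density_bound[OF X(1,2,3) G' mb(1,2)])
  also have "\<dots> = 2 * (c * G * anorm \<phi>)" by (simp add: c_def mult_ac)
  also have "\<dots> \<le> 2 * (c * G * F)" using F' c0 G by (intro mult_left_mono) auto
  also have "\<dots> = 2 * (c * F * G)" by simp
  finally have e3: "\<bar>I (\<lambda>x. ((p x)\<^sup>2 + (q x)\<^sup>2) * \<phi> x)\<bar> \<le> 2 * (c * F * G)" .
  have "\<alpha> * I (\<lambda>x. \<phi>' x * \<phi>' x) + B * a \<phi>' \<phi>' = I (\<lambda>x. ((p' x)\<^sup>2 + (q' x)\<^sup>2) * \<phi>' x)"
    using d' X(6) unfolding density_eq_def by blast
  then have "energy \<alpha> B p' q' \<phi>' = kinetic p q + (I (\<lambda>x. ((p x)\<^sup>2 + (q x)\<^sup>2) * \<phi>' x)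
      - I (\<lambda>x. ((p' x)\<^sup>2 + (q' x)\<^sup>2) * \<phi> x) + I (\<lambda>x. ((p x)\<^sup>2 + (q x)\<^sup>2) * \<phi> x)) / 2"
    using energy_identity[OF X step] unfolding energy_def power2_eq_square by argo
  also have "\<dots> \<le> G\<^sup>2 + c * G * anorm \<phi>' + c * F * k + c * F * G"
    using e1 e2 e3 G(1) unfolding abs_le_iff by argo
  finally have E1: "energy \<alpha> B p' q' \<phi>' \<le> G\<^sup>2 + c * G * anorm \<phi>' + c * F * k + c * F * G" .
  \<comment> \<open>Young's inequality, with weights such that half of the new energy absorbs both squares.\<close>
  have y1: "c * G * anorm \<phi>' \<le> B * (anorm \<phi>')\<^sup>2 / 4 + c\<^sup>2 * G\<^sup>2 / B"
  proof -
    have "0 \<le> (B * anorm \<phi>' - 2 * (c * G))\<^sup>2" by simp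
    also have "\<dots> = 4 * B * (B * (anorm \<phi>')\<^sup>2 / 4 + c\<^sup>2 * G\<^sup>2 / B - c * G * anorm \<phi>')"
      using B by (simp add: power2_eq_square field_simps)
    finally show ?thesis using B by (simp add: zero_le_mult_iff)
  qed
  have y2: "c * F * k \<le> k\<^sup>2 / 2 + c\<^sup>2 * F\<^sup>2 / 2"
    using sum_squares_bound[of "c * F" k] by (simp add: power_mult_distrib)
  have "k\<^sup>2 + B * (anorm \<phi>')\<^sup>2 / 2 \<le> energy \<alpha> B p' q' \<phi>'"
    using \<alpha> by (simp add: energy_def k2 anorm_square add_divide_distrib)
  then have "energy \<alpha> B p' q' \<phi>' \<le> 2 * (G\<^sup>2 + c * F * G + c\<^sup>2 * G\<^sup>2 / B + c\<^sup>2 * F\<^sup>2 / 2)"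
    using E1 y1 y2 by argo
  then show ?thesis by (simp add: energy_bound_def c_def m_def)
qed

lemma kinetic_le_energy: "\<alpha> \<ge> 0 \<Longrightarrow> B > 0 \<Longrightarrow> kinetic p q \<le> energy \<alpha> B p q \<phi>"
  using a_nonneg[of \<phi>] by (simp add: energy_def)

lemma kinetic_bound:
  assumes X: "\<And>n. n \<le> N \<Longrightarrow> p n \<in> X" "\<And>n. n \<le> N \<Longrightarrow> q n \<in> X" "\<And>n. n \<le> N \<Longrightarrow> \<phi> n \<in> X"
    and step: "\<And>n. n < N \<Longrightarrow> cn_step \<tau> (p n) (q n) (\<phi> n) (p (Suc n)) (q (Suc n)) (\<phi> (Suc n))"
    and d: "\<And>n. n < N \<Longrightarrow> density_eq \<alpha> B (p (Suc n)) (q (Suc n)) (\<phi> (Suc n))"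
    and \<tau>: "\<tau> > 0" and \<alpha>: "\<alpha> \<ge> 0" and B: "B > 0"
    and G: "kinetic (p 0) (q 0) \<le> G\<^sup>2" "G \<ge> 0" and F: "a (\<phi> 0) (\<phi> 0) \<le> F\<^sup>2" "F \<ge> 0"
    and n: "n \<le> N"
  shows "kinetic (p n) (q n) \<le> energy_bound B G F"
proof -
  have E: "Suc n \<le> N \<Longrightarrow> energy \<alpha> B (p (Suc n)) (q (Suc n)) (\<phi> (Suc n)) \<le> energy_bound B G F" for n
  proof (induction n)
    case 0
    then show ?case
      using first_step_energy_bound[OF X(1,2,3)[of 0] X(1,2,3)[of "Suc 0"] step[of 0] \<tau> d[of 0] \<alpha> B G F] by simp
  next
    case (Suc n)
    then show ?case
      using energy_conservation[OF X(1,2,3)[of "Suc n"] X(1,2,3)[of "Suc (Suc n)"] step[of "Suc n"] d[of n] d[of "Suc n"]]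
      by simp
  qed
  show ?thesis
  proof (cases n)
    case 0
    then show ?thesis using G(1) energy_bound_ge[OF B G(2) F(2)] by simp
  next
    case (Suc m)
    then show ?thesis using E[of m] n kinetic_le_energy[OF \<alpha> B, of "p n" "q n" "\<phi> n"] by simp
  qed
qed

text \<open>The difference \<open>e = (e1, e2)\<close> of the new wave functions and the difference \<open>\<psi>\<close> of the new potentials
satisfy \<open>\<parallel>e\<parallel>\<^sup>2 / \<tau> \<le> C \<parallel>\<nabla>\<psi>\<parallel> \<parallel>e\<parallel>\<close> by the first two equations, tested with \<open>e\<close>, and
\<open>\<parallel>\<nabla>\<psi>\<parallel> \<le> C' \<parallel>e\<parallel>\<close> by the density equations, tested with \<open>\<psi>\<close>. The term with the average potential
drops out when \<open>e\<close> is the test function.\<close>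

lemma step_unique:
  assumes X: "p \<in> X" "q \<in> X" "\<phi> \<in> X" "p' \<in> X" "q' \<in> X" "\<phi>' \<in> X" "p'' \<in> X" "q'' \<in> X" "\<phi>'' \<in> X"
    and s': "cn_step \<tau> p q \<phi> p' q' \<phi>'" and d': "density_eq \<alpha> B p' q' \<phi>'"
    and s'': "cn_step \<tau> p q \<phi> p'' q'' \<phi>''" and d'': "density_eq \<alpha> B p'' q'' \<phi>''"
    and \<tau>: "\<tau> > 0" and \<alpha>: "\<alpha> \<ge> 0" and B: "B > 0"
    and K: "kinetic p q \<le> K" "kinetic p' q' \<le> K" "kinetic p'' q'' \<le> K"
    and small: "2 * S ^ 4 * K * \<tau> < B" and x: "x \<in> closure \<Omega>"
  shows "p' x = p'' x" "q' x = q'' x" "\<phi>' x = \<phi>'' x"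
proof -
  define e1 where "e1 = (\<lambda>x. p' x - p'' x)"
  define e2 where "e2 = (\<lambda>x. q' x - q'' x)"
  define \<psi> where "\<psi> = (\<lambda>x. \<phi>' x - \<phi>'' x)"
  have eX: "e1 \<in> X" "e2 \<in> X" "\<psi> \<in> X" unfolding e1_def e2_def \<psi>_def by (intro X_diff X)+
  define k where "k = sqrt K"
  have K0: "K \<ge> 0" using K(1) kinetic_nonneg[of p q] by linarith
  have k0: "k \<ge> 0" and k2: "k\<^sup>2 = K" using K0 by (simp_all add: k_def)
  have kk: "anorm p \<le> k" "anorm q \<le> k" "anorm p' \<le> k" "anorm q' \<le> k" "anorm p'' \<le> k" "anorm q'' \<le> k"
    unfolding k_def using anorm_le_sqrt_kinetic K real_sqrt_le_mono order_trans by meson+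
  define s where "s = L2 e1 + L2 e2"
  have s0: "s \<ge> 0" using L2_nonneg by (simp add: s_def)
  have tri: "\<bar>I (\<lambda>x. \<psi> x * f x * e x)\<bar> \<le> S\<^sup>2 * anorm \<psi> * k * L2 e" if "f \<in> X" "anorm f \<le> k" "e \<in> X" for f e
    by (rule order_trans[OF trilinear_bound[OF eX(3) that(1) X_cont[OF that(3)]]])
       (use that k0 anorm_nonneg L2_nonneg in \<open>auto intro!: mult_mono mult_nonneg_nonneg\<close>)
  have 1: "I (\<lambda>x. e1 x * v x) / \<tau> = a e2 v / 2 + I (\<lambda>x. ((\<phi>' x + \<phi> x) * e2 x + \<psi> x * (q'' x + q x)) * v x) / 4"
    if v: "v \<in> X" for v
  proof -
    have "a (\<lambda>x. q' x + q x) v - a (\<lambda>x. q'' x + q x) v = a e2 v"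
      using v X by (simp add: e2_def a_add a_diff)
    moreover have "I (\<lambda>x. (p' x - p x) * v x) - I (\<lambda>x. (p'' x - p x) * v x) = I (\<lambda>x. e1 x * v x)"
      by (subst I_diff[symmetric])
         (auto intro!: conts X[THEN X_cont] v[THEN X_cont] Bochner_Integration.integral_cong simp: e1_def algebra_simps)
    moreover have "I (\<lambda>x. (\<phi>' x + \<phi> x) * (q' x + q x) * v x) - I (\<lambda>x. (\<phi>'' x + \<phi> x) * (q'' x + q x) * v x)
        = I (\<lambda>x. ((\<phi>' x + \<phi> x) * e2 x + \<psi> x * (q'' x + q x)) * v x)"
      by (subst I_diff[symmetric])
         (auto intro!: conts X[THEN X_cont] v[THEN X_cont] Bochner_Integration.integral_cong simp: e2_def \<psi>_def algebra_simps)
    moreover have "I (\<lambda>x. (p' x - p x) * v x) / \<tau> =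
        a (\<lambda>x. q' x + q x) v / 2 + I (\<lambda>x. (\<phi>' x + \<phi> x) * (q' x + q x) * v x) / 4"
      using s' v unfolding cn_step_def by blast
    moreover have "I (\<lambda>x. (p'' x - p x) * v x) / \<tau> =
        a (\<lambda>x. q'' x + q x) v / 2 + I (\<lambda>x. (\<phi>'' x + \<phi> x) * (q'' x + q x) * v x) / 4"
      using s'' v unfolding cn_step_def by blast
    ultimately show ?thesis by (simp add: diff_divide_distrib[symmetric] flip: \<open>_ = I (\<lambda>x. e1 x * v x)\<close>) argo
  qed
  have 2: "I (\<lambda>x. e2 x * v x) / \<tau> = - a e1 v / 2 - I (\<lambda>x. ((\<phi>' x + \<phi> x) * e1 x + \<psi> x * (p'' x + p x)) * v x) / 4"
    if v: "v \<in> X" for v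
  proof -
    have "a (\<lambda>x. p' x + p x) v - a (\<lambda>x. p'' x + p x) v = a e1 v"
      using v X by (simp add: e1_def a_add a_diff)
    moreover have "I (\<lambda>x. (q' x - q x) * v x) - I (\<lambda>x. (q'' x - q x) * v x) = I (\<lambda>x. e2 x * v x)"
      by (subst I_diff[symmetric])
         (auto intro!: conts X[THEN X_cont] v[THEN X_cont] Bochner_Integration.integral_cong simp: e2_def algebra_simps)
    moreover have "I (\<lambda>x. (\<phi>' x + \<phi> x) * (p' x + p x) * v x) - I (\<lambda>x. (\<phi>'' x + \<phi> x) * (p'' x + p x) * v x)
        = I (\<lambda>x. ((\<phi>' x + \<phi> x) * e1 x + \<psi> x * (p'' x + p x)) * v x)"
      by (subst I_diff[symmetric])
         (auto intro!: conts X[THEN X_cont] v[THEN X_cont] Bochner_Integration.integral_cong simp: e1_def \<psi>_def algebra_simps)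
    moreover have "I (\<lambda>x. (q' x - q x) * v x) / \<tau> =
        - a (\<lambda>x. p' x + p x) v / 2 - I (\<lambda>x. (\<phi>' x + \<phi> x) * (p' x + p x) * v x) / 4"
      using s' v unfolding cn_step_def by blast
    moreover have "I (\<lambda>x. (q'' x - q x) * v x) / \<tau> =
        - a (\<lambda>x. p'' x + p x) v / 2 - I (\<lambda>x. (\<phi>'' x + \<phi> x) * (p'' x + p x) * v x) / 4"
      using s'' v unfolding cn_step_def by blast
    ultimately show ?thesis by (simp add: diff_divide_distrib[symmetric] flip: \<open>_ = I (\<lambda>x. e2 x * v x)\<close>) argo
  qed
  define m where "m = (L2 e1)\<^sup>2 + (L2 e2)\<^sup>2"
  have m_eq: "m / \<tau> = (I (\<lambda>x. \<psi> x * q'' x * e1 x) + I (\<lambda>x. \<psi> x * q x * e1 x)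
      - I (\<lambda>x. \<psi> x * p'' x * e2 x) - I (\<lambda>x. \<psi> x * p x * e2 x)) / 4"
  proof -
    have "I (\<lambda>x. ((\<phi>' x + \<phi> x) * e2 x + \<psi> x * (q'' x + q x)) * e1 x)
       = I (\<lambda>x. (\<phi>' x + \<phi> x) * e1 x * e2 x) + (I (\<lambda>x. \<psi> x * q'' x * e1 x) + I (\<lambda>x. \<psi> x * q x * e1 x))"
      by (simp add: I_add[symmetric] conts X[THEN X_cont] eX[THEN X_cont] del: Bochner_Integration.integral_add)
         (auto intro!: Bochner_Integration.integral_cong simp: algebra_simps)
    moreover have "I (\<lambda>x. ((\<phi>' x + \<phi> x) * e1 x + \<psi> x * (p'' x + p x)) * e2 x)
       = I (\<lambda>x. (\<phi>' x + \<phi> x) * e1 x * e2 x) + (I (\<lambda>x. \<psi> x * p'' x * e2 x) + I (\<lambda>x. \<psi> x * p x * e2 x))"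
      by (simp add: I_add[symmetric] conts X[THEN X_cont] eX[THEN X_cont] del: Bochner_Integration.integral_add)
         (auto intro!: Bochner_Integration.integral_cong simp: algebra_simps)
    moreover have "m / \<tau> = I (\<lambda>x. e1 x * e1 x) / \<tau> + I (\<lambda>x. e2 x * e2 x) / \<tau>"
      unfolding m_def L2_square by (simp add: power2_eq_square add_divide_distrib)
    ultimately show ?thesis
      using 1[OF eX(1)] 2[OF eX(2)] a_sym[of e1 e2] by argo
  qed
  have m_le: "m / \<tau> \<le> S\<^sup>2 * anorm \<psi> * k * s / 2"
    unfolding m_eq s_def
    using tri[OF X(8) kk(6) eX(1)] tri[OF X(2) kk(2) eX(1)] tri[OF X(7) kk(5) eX(2)] tri[OF X(1) kk(1) eX(2)]
    by (simp add: algebra_simps)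
  have h1: "\<alpha> * I (\<lambda>x. \<phi>' x * \<psi> x) + B * a \<phi>' \<psi> = I (\<lambda>x. ((p' x)\<^sup>2 + (q' x)\<^sup>2) * \<psi> x)"
    "\<alpha> * I (\<lambda>x. \<phi>'' x * \<psi> x) + B * a \<phi>'' \<psi> = I (\<lambda>x. ((p'' x)\<^sup>2 + (q'' x)\<^sup>2) * \<psi> x)"
    using d' d'' eX(3) unfolding density_eq_def by blast+
  have h2: "a \<psi> \<psi> = a \<phi>' \<psi> - a \<phi>'' \<psi>" unfolding \<psi>_def by (intro a_diff X X_diff)
  have h3: "I (\<lambda>x. \<psi> x * \<psi> x) = I (\<lambda>x. \<phi>' x * \<psi> x) - I (\<lambda>x. \<phi>'' x * \<psi> x)"
    by (subst I_diff[symmetric]) (auto intro!: conts X[THEN X_cont] eX[THEN X_cont] Bochner_Integration.integral_cong simp: \<psi>_def algebra_simps)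
  have h4: "I (\<lambda>x. ((p' x)\<^sup>2 + (q' x)\<^sup>2) * \<psi> x) - I (\<lambda>x. ((p'' x)\<^sup>2 + (q'' x)\<^sup>2) * \<psi> x)
      = I (\<lambda>x. \<psi> x * p' x * e1 x) + I (\<lambda>x. \<psi> x * p'' x * e1 x) + (I (\<lambda>x. \<psi> x * q' x * e2 x) + I (\<lambda>x. \<psi> x * q'' x * e2 x))"
    by (simp add: I_add[symmetric] I_diff[symmetric] conts X[THEN X_cont] eX[THEN X_cont] del: Bochner_Integration.integral_add Bochner_Integration.integral_diff)
       (auto intro!: Bochner_Integration.integral_cong simp: e1_def e2_def power2_eq_square algebra_simps)
  have "\<alpha> * I (\<lambda>x. \<psi> x * \<psi> x) + B * a \<psi> \<psi>
      = I (\<lambda>x. \<psi> x * p' x * e1 x) + I (\<lambda>x. \<psi> x * p'' x * e1 x) + (I (\<lambda>x. \<psi> x * q' x * e2 x) + I (\<lambda>x. \<psi> x * q'' x * e2 x))"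
    using h1 h4 unfolding h2 h3 right_diff_distrib by argo
  moreover have "\<alpha> * I (\<lambda>x. \<psi> x * \<psi> x) \<ge> 0" using \<alpha> by (simp add: mult_nonneg_nonneg)
  ultimately have "B * (anorm \<psi>)\<^sup>2 \<le> 2 * (S\<^sup>2 * anorm \<psi> * k * s)"
    unfolding anorm_square s_def
    using tri[OF X(4) kk(3) eX(1)] tri[OF X(7) kk(5) eX(1)] tri[OF X(5) kk(4) eX(2)] tri[OF X(8) kk(6) eX(2)]
    by (simp add: algebra_simps)
  then have "anorm \<psi> * (B * anorm \<psi>) \<le> anorm \<psi> * (2 * S\<^sup>2 * k * s)" by (simp add: power2_eq_square mult_ac)
  then have psi_le: "B * anorm \<psi> \<le> 2 * S\<^sup>2 * k * s"
    using anorm_nonneg[of \<psi>] k0 s0 by (cases "anorm \<psi> = 0") auto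
  have s2: "s\<^sup>2 \<le> 2 * m"
    using sum_squares_bound[of "L2 e1" "L2 e2"] by (simp add: s_def m_def power2_sum)
  have m0: "m \<ge> 0" by (simp add: m_def)
  have "B * m = \<tau> * (B * (m / \<tau>))" using \<tau> by simp
  also have "\<dots> \<le> \<tau> * (B * (S\<^sup>2 * anorm \<psi> * k * s / 2))" using m_le \<tau> B by (intro mult_left_mono) auto
  also have "\<dots> = \<tau> * (S\<^sup>2 * k * s / 2) * (B * anorm \<psi>)" by (simp add: mult_ac)
  also have "\<dots> \<le> \<tau> * (S\<^sup>2 * k * s / 2) * (2 * S\<^sup>2 * k * s)" using psi_le \<tau> k0 s0 by (intro mult_left_mono) auto
  also have "\<dots> = \<tau> * S ^ 4 * K * s\<^sup>2" by (simp add: k2[symmetric] power2_eq_square power4_eq_xxxx mult_ac)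
  also have "\<dots> \<le> \<tau> * S ^ 4 * K * (2 * m)" using s2 \<tau> K0 by (intro mult_left_mono) auto
  finally have "B * m \<le> (2 * S ^ 4 * K * \<tau>) * m" by (simp add: mult_ac)
  then have "m \<le> 0" using small m0 by (smt (verit) mult_less_cancel_right)
  then have m00: "(L2 e1)\<^sup>2 \<le> 0" "(L2 e2)\<^sup>2 \<le> 0" "s = 0"
    using m0 s2 s0 unfolding m_def by (smt (verit) zero_le_power2 power_eq_0_iff zero_less_power)+
  then have "anorm \<psi> = 0" using psi_le B anorm_nonneg[of \<psi>] by (simp add: mult_le_0_iff)
  then have p0: "I (\<lambda>x. (\<psi> x)\<^sup>2) \<le> 0" using poincare[OF eX(3)] anorm_square[of \<psi>] by simp
  note z = continuous_integral_square_eq_0[OF open_\<Omega> bounded_\<Omega> X_cont _ x]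
  show "p' x = p'' x" "q' x = q'' x" "\<phi>' x = \<phi>'' x"
    using z[OF eX(1)] z[OF eX(2)] z[OF eX(3) p0] m00(1,2) unfolding L2_square
    by (simp_all add: e1_def e2_def \<psi>_def)
qed

text \<open>The values of finite element functions outside the closed domain are arbitrary, so the induction over
the time levels only provides old data that agree on the closure.\<close>

lemma cn_step_cong_old:
  assumes X: "p \<in> X" "q \<in> X" "p' \<in> X" "q' \<in> X" "p0 \<in> X" "q0 \<in> X"
    and eq: "\<And>x. x \<in> closure \<Omega> \<Longrightarrow> p x = p0 x" "\<And>x. x \<in> closure \<Omega> \<Longrightarrow> q x = q0 x" "\<And>x. x \<in> closure \<Omega> \<Longrightarrow> \<phi> x = \<phi>0 x"
    and step: "cn_step \<tau> p q \<phi> p' q' \<phi>'"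
  shows "cn_step \<tau> p0 q0 \<phi>0 p' q' \<phi>'"
proof -
  have eq': "p x = p0 x" "q x = q0 x" "\<phi> x = \<phi>0 x" if "x \<in> \<Omega>" for x
    using eq that closure_subset by blast+
  have a1: "a (\<lambda>x. q' x + q0 x) v = a (\<lambda>x. q' x + q x) v" "a (\<lambda>x. p' x + p0 x) v = a (\<lambda>x. p' x + p x) v" for v
    by (rule a_cong; simp add: X X_add eq')+
  have "I (\<lambda>x. (p' x - p0 x) * v x) = I (\<lambda>x. (p' x - p x) * v x)"
    "I (\<lambda>x. (q' x - q0 x) * v x) = I (\<lambda>x. (q' x - q x) * v x)"
    "I (\<lambda>x. (\<phi>' x + \<phi>0 x) * (q' x + q0 x) * v x) = I (\<lambda>x. (\<phi>' x + \<phi> x) * (q' x + q x) * v x)"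
    "I (\<lambda>x. (\<phi>' x + \<phi>0 x) * (p' x + p0 x) * v x) = I (\<lambda>x. (\<phi>' x + \<phi> x) * (p' x + p x) * v x)" for v
    by (rule Bochner_Integration.integral_cong; simp add: eq')+
  with step a1 show ?thesis unfolding cn_step_def by simp
qed

theorem scheme_unique:
  assumes X: "\<And>n. n \<le> N \<Longrightarrow> p n \<in> X" "\<And>n. n \<le> N \<Longrightarrow> q n \<in> X" "\<And>n. n \<le> N \<Longrightarrow> \<phi> n \<in> X"
    and step: "\<And>n. n < N \<Longrightarrow> cn_step \<tau> (p n) (q n) (\<phi> n) (p (Suc n)) (q (Suc n)) (\<phi> (Suc n))"
    and d: "\<And>n. n < N \<Longrightarrow> density_eq \<alpha> B (p (Suc n)) (q (Suc n)) (\<phi> (Suc n))"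
    and X': "\<And>n. n \<le> N \<Longrightarrow> p' n \<in> X" "\<And>n. n \<le> N \<Longrightarrow> q' n \<in> X" "\<And>n. n \<le> N \<Longrightarrow> \<phi>' n \<in> X"
    and step': "\<And>n. n < N \<Longrightarrow> cn_step \<tau> (p' n) (q' n) (\<phi>' n) (p' (Suc n)) (q' (Suc n)) (\<phi>' (Suc n))"
    and d': "\<And>n. n < N \<Longrightarrow> density_eq \<alpha> B (p' (Suc n)) (q' (Suc n)) (\<phi>' (Suc n))"
    and init: "\<And>x. x \<in> closure \<Omega> \<Longrightarrow> p 0 x = p' 0 x" "\<And>x. x \<in> closure \<Omega> \<Longrightarrow> q 0 x = q' 0 x"
      "\<And>x. x \<in> closure \<Omega> \<Longrightarrow> \<phi> 0 x = \<phi>' 0 x"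
    and \<tau>: "\<tau> > 0" and \<alpha>: "\<alpha> \<ge> 0" and B: "B > 0"
    and G: "kinetic (p 0) (q 0) \<le> G\<^sup>2" "kinetic (p' 0) (q' 0) \<le> G\<^sup>2" "G \<ge> 0"
    and F: "a (\<phi> 0) (\<phi> 0) \<le> F\<^sup>2" "a (\<phi>' 0) (\<phi>' 0) \<le> F\<^sup>2" "F \<ge> 0"
    and small: "2 * S ^ 4 * energy_bound B G F * \<tau> < B"
    and n: "n \<le> N"
  shows "\<forall>x\<in>closure \<Omega>. p n x = p' n x \<and> q n x = q' n x \<and> \<phi> n x = \<phi>' n x"
  using n
proof (induction n)
  case 0
  then show ?case using init by simp
next
  case (Suc n)
  have K: "kinetic (p n) (q n) \<le> energy_bound B G F" if "n \<le> N" for n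
    using that by (intro kinetic_bound[of N p q \<phi> \<tau> \<alpha> B G F n] X step d \<tau> \<alpha> B G(1,3) F(1,3))
  have K': "kinetic (p' n) (q' n) \<le> energy_bound B G F" if "n \<le> N" for n
    using that by (intro kinetic_bound[of N p' q' \<phi>' \<tau> \<alpha> B G F n] X' step' d' \<tau> \<alpha> B G(2,3) F(2,3))
  have IH: "\<And>x. x \<in> closure \<Omega> \<Longrightarrow> p n x = p' n x" "\<And>x. x \<in> closure \<Omega> \<Longrightarrow> q n x = q' n x"
      "\<And>x. x \<in> closure \<Omega> \<Longrightarrow> \<phi> n x = \<phi>' n x"
    using Suc by auto
  have n: "n \<le> N" "Suc n \<le> N" "n < N" using Suc.prems by auto
  have s: "cn_step \<tau> (p' n) (q' n) (\<phi>' n) (p (Suc n)) (q (Suc n)) (\<phi> (Suc n))"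
    by (rule cn_step_cong_old[OF X(1,2)[OF n(1)] X(1,2)[OF n(2)] X'(1,2)[OF n(1)] IH step[OF n(3)]])
  show ?case
    using step_unique[OF X'[OF n(1)] X[OF n(2)] X'[OF n(2)] s d[OF n(3)] step'[OF n(3)] d'[OF n(3)] \<tau> \<alpha> B
        K'[OF n(1)] K[OF n(2)] K'[OF n(2)] small] by blast
qed

end

section \<open>The Dirichlet form\<close>

text \<open>The functions on which the Dirichlet form is finite and bilinear; both \<open>H\<^sup>1\<close> functions and finite
element functions belong here.\<close>

definition weakly_diff :: "(real^'d) set \<Rightarrow> (real^'d \<Rightarrow> 'b::euclidean_space) \<Rightarrow> bool" where
  "weakly_diff \<Omega> v \<longleftrightarrow> (\<exists>g. has_weak_gradient \<Omega> v g \<and> square_integrable \<Omega> g)"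

lemma borel_measurable_lebesgue_on_AE:
  fixes f g :: "'a::euclidean_space \<Rightarrow> 'b::euclidean_space"
  assumes S: "S \<in> sets lebesgue" and f: "f \<in> borel_measurable (lebesgue_on S)"
    and ae: "AE x in lebesgue_on S. f x = g x"
  shows "g \<in> borel_measurable (lebesgue_on S)"
proof -
  have "(\<lambda>x. if x \<in> S then f x else 0) \<in> borel_measurable lebesgue"
    by (rule borel_measurable_if_I[OF f S])
  moreover have "AE x in lebesgue. (if x \<in> S then f x else 0) = (if x \<in> S then g x else 0)"
    using ae S by (subst (asm) AE_restrict_space_iff) (auto elim: eventually_mono)
  ultimately have "(\<lambda>x. if x \<in> S then g x else 0) \<in> borel_measurable lebesgue"
    by (rule borel_measurable_AE)
  then show ?thesis by (rule borel_measurable_if_D)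
qed

lemma square_integrable_AE:
  fixes f g :: "real^'d \<Rightarrow> 'b::euclidean_space"
  assumes \<Omega>: "open \<Omega>" and f: "square_integrable \<Omega> f" and ae: "AE x in lebesgue_on \<Omega>. f x = g x"
  shows "square_integrable \<Omega> g"
proof -
  have "g \<in> borel_measurable (lebesgue_on \<Omega>)"
    using \<Omega> f by (intro borel_measurable_lebesgue_on_AE[OF _ _ ae]) (auto simp: square_integrable_def borel_open)
  moreover have "integrable (lebesgue_on \<Omega>) (\<lambda>x. (norm (g x))\<^sup>2)"
  proof (rule integrable_cong_AE_imp)
    show "integrable (lebesgue_on \<Omega>) (\<lambda>x. (norm (f x))\<^sup>2)" using f by (simp add: square_integrable_def)
    show "(\<lambda>x. (norm (g x))\<^sup>2) \<in> borel_measurable (lebesgue_on \<Omega>)" using \<open>g \<in> _\<close> by measurable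
    show "AE x in lebesgue_on \<Omega>. (norm (f x))\<^sup>2 = (norm (g x))\<^sup>2" using ae by eventually_elim simp
  qed
  ultimately show ?thesis by (simp add: square_integrable_def)
qed

lemma square_integrable_grad:
  assumes \<Omega>: "open \<Omega>" and v: "weakly_diff \<Omega> v"
  shows "square_integrable \<Omega> (grad \<Omega> v)"
proof -
  obtain g where g: "has_weak_gradient \<Omega> v g" "square_integrable \<Omega> g" using v by (auto simp: weakly_diff_def)
  have "AE x in lebesgue_on \<Omega>. g x = grad \<Omega> v x"
    using grad_eq_AE[OF \<Omega> g(1)] by eventually_elim simp
  from square_integrable_AE[OF \<Omega> g(2) this] show ?thesis .
qed

lemma grad_has_weak_gradient: "weakly_diff \<Omega> v \<Longrightarrow> has_weak_gradient \<Omega> v (grad \<Omega> v)"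
  using grad_weak_gradient by (auto simp: weakly_diff_def)

lemma integrable_inner_square_integrable:
  fixes f g :: "real^'d \<Rightarrow> real^'d"
  assumes "square_integrable \<Omega> f" "square_integrable \<Omega> g"
  shows "integrable (lebesgue_on \<Omega>) (\<lambda>x. f x \<bullet> g x)"
proof (rule Bochner_Integration.integrable_bound)
  have m[measurable]: "f \<in> borel_measurable (lebesgue_on \<Omega>)" "g \<in> borel_measurable (lebesgue_on \<Omega>)"
    using assms by (auto simp: square_integrable_def)
  show "integrable (lebesgue_on \<Omega>) (\<lambda>x. norm (f x) * norm (g x))"
    using assms by (intro cauchy_schwarz_integral(1)) (auto simp: square_integrable_def)
  show "(\<lambda>x. f x \<bullet> g x) \<in> borel_measurable (lebesgue_on \<Omega>)" by measurable
  show "AE x in lebesgue_on \<Omega>. norm (f x \<bullet> g x) \<le> norm (norm (f x) * norm (g x))"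
    by (rule AE_I2) (simp add: Cauchy_Schwarz_ineq2 abs_mult)
qed

lemma square_integrable_add:
  fixes f g :: "real^'d \<Rightarrow> 'b::euclidean_space"
  assumes "square_integrable \<Omega> f" "square_integrable \<Omega> g"
  shows "square_integrable \<Omega> (\<lambda>x. f x + g x)"
proof -
  have m[measurable]: "f \<in> borel_measurable (lebesgue_on \<Omega>)" "g \<in> borel_measurable (lebesgue_on \<Omega>)"
    using assms by (auto simp: square_integrable_def)
  have "integrable (lebesgue_on \<Omega>) (\<lambda>x. (norm (f x + g x))\<^sup>2)"
  proof (rule Bochner_Integration.integrable_bound)
    show "integrable (lebesgue_on \<Omega>) (\<lambda>x. 2 * (norm (f x))\<^sup>2 + 2 * (norm (g x))\<^sup>2)"
      using assms by (auto simp: square_integrable_def)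
    show "AE x in lebesgue_on \<Omega>. norm ((norm (f x + g x))\<^sup>2) \<le> norm (2 * (norm (f x))\<^sup>2 + 2 * (norm (g x))\<^sup>2)"
    proof (rule AE_I2)
      fix x
      have "(norm (f x + g x))\<^sup>2 \<le> (norm (f x) + norm (g x))\<^sup>2"
        by (intro power_mono norm_triangle_ineq) simp
      also have "\<dots> \<le> 2 * (norm (f x))\<^sup>2 + 2 * (norm (g x))\<^sup>2"
        using sum_squares_bound[of "norm (f x)" "norm (g x)"] by (simp add: power2_sum)
      finally show "norm ((norm (f x + g x))\<^sup>2) \<le> norm (2 * (norm (f x))\<^sup>2 + 2 * (norm (g x))\<^sup>2)" by simp
    qed
  qed simp
  then show ?thesis by (simp add: square_integrable_def)
qed

lemma square_integrable_linear_image: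
  fixes g :: "real^'d \<Rightarrow> 'b::euclidean_space" and T :: "'b \<Rightarrow> 'c::euclidean_space"
  assumes g: "square_integrable \<Omega> g" and T: "bounded_linear T"
  shows "square_integrable \<Omega> (\<lambda>x. T (g x))"
proof -
  obtain K where K: "K > 0" "\<And>y. norm (T y) \<le> norm y * K" using bounded_linear.pos_bounded[OF T] by blast
  have "T \<in> borel_measurable borel"
    by (intro borel_measurable_continuous_onI linear_continuous_on T)
  then have m: "(\<lambda>x. T (g x)) \<in> borel_measurable (lebesgue_on \<Omega>)"
    using g measurable_compose by (auto simp: square_integrable_def)
  moreover have "integrable (lebesgue_on \<Omega>) (\<lambda>x. (norm (T (g x)))\<^sup>2)"
  proof (rule Bochner_Integration.integrable_bound)
    show "integrable (lebesgue_on \<Omega>) (\<lambda>x. K\<^sup>2 * (norm (g x))\<^sup>2)"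
      using g by (auto simp: square_integrable_def)
    show "(\<lambda>x. (norm (T (g x)))\<^sup>2) \<in> borel_measurable (lebesgue_on \<Omega>)" using m by measurable
    show "AE x in lebesgue_on \<Omega>. norm ((norm (T (g x)))\<^sup>2) \<le> norm (K\<^sup>2 * (norm (g x))\<^sup>2)"
    proof (rule AE_I2)
      fix x
      have "(norm (T (g x)))\<^sup>2 \<le> (norm (g x) * K)\<^sup>2" using K(2) by (intro power_mono) auto
      then show "norm ((norm (T (g x)))\<^sup>2) \<le> norm (K\<^sup>2 * (norm (g x))\<^sup>2)" by (simp add: power_mult_distrib mult.commute)
    qed
  qed
  ultimately show ?thesis by (simp add: square_integrable_def)
qed

context
  fixes \<Omega> :: "(real^'d) set"
  assumes \<Omega>: "open \<Omega>"
begin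

lemma weakly_diff_add:
  fixes v w :: "real^'d \<Rightarrow> 'b::euclidean_space"
  assumes "weakly_diff \<Omega> v" "weakly_diff \<Omega> w"
  shows "weakly_diff \<Omega> (\<lambda>x. v x + w x)"
    and "AE x in lebesgue_on \<Omega>. grad \<Omega> (\<lambda>x. v x + w x) x = grad \<Omega> v x + grad \<Omega> w x"
proof -
  have w: "has_weak_gradient \<Omega> (\<lambda>x. v x + w x) (\<lambda>x. grad \<Omega> v x + grad \<Omega> w x)"
    using assms by (intro weak_gradient_add \<Omega> grad_has_weak_gradient)
  then show "weakly_diff \<Omega> (\<lambda>x. v x + w x)"
    using square_integrable_add assms square_integrable_grad[OF \<Omega>] unfolding weakly_diff_def by metis
  show "AE x in lebesgue_on \<Omega>. grad \<Omega> (\<lambda>x. v x + w x) x = grad \<Omega> v x + grad \<Omega> w x"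
    by (rule grad_eq_AE[OF \<Omega> w])
qed

lemma weakly_diff_linear_image:
  fixes v :: "real^'d \<Rightarrow> 'b::euclidean_space" and T :: "'b \<Rightarrow> 'c::euclidean_space"
  assumes v: "weakly_diff \<Omega> v" and T: "bounded_linear T"
  shows "weakly_diff \<Omega> (\<lambda>x. T (v x))"
    and "AE x in lebesgue_on \<Omega>. grad \<Omega> (\<lambda>x. T (v x)) x = (\<chi> i. T (grad \<Omega> v x $ i))"
proof -
  have w: "has_weak_gradient \<Omega> (\<lambda>x. T (v x)) (\<lambda>x. \<chi> i. T (grad \<Omega> v x $ i))"
    using v by (intro weak_gradient_linear_image \<Omega> grad_has_weak_gradient T)
  moreover have "square_integrable \<Omega> (\<lambda>x. \<chi> i. T (grad \<Omega> v x $ i))"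
    by (rule square_integrable_linear_image[OF square_integrable_grad[OF \<Omega> v] bounded_linear_vec_map[OF T]])
  ultimately show "weakly_diff \<Omega> (\<lambda>x. T (v x))" unfolding weakly_diff_def by blast
  show "AE x in lebesgue_on \<Omega>. grad \<Omega> (\<lambda>x. T (v x)) x = (\<chi> i. T (grad \<Omega> v x $ i))"
    by (rule grad_eq_AE[OF \<Omega> w])
qed

lemma weakly_diff_scale:
  fixes v :: "real^'d \<Rightarrow> real"
  assumes v: "weakly_diff \<Omega> v"
  shows "weakly_diff \<Omega> (\<lambda>x. c * v x)"
    and "AE x in lebesgue_on \<Omega>. grad \<Omega> (\<lambda>x. c * v x) x = c *\<^sub>R grad \<Omega> v x"
proof -
  note l = weakly_diff_linear_image[OF v bounded_linear_mult_right[of c]]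
  show "weakly_diff \<Omega> (\<lambda>x. c * v x)" by (rule l(1))
  show "AE x in lebesgue_on \<Omega>. grad \<Omega> (\<lambda>x. c * v x) x = c *\<^sub>R grad \<Omega> v x"
    using l(2) by eventually_elim (simp add: vec_eq_iff)
qed

lemma real_grad_inner_cong_AE:
  assumes u: "weakly_diff \<Omega> u" and w: "weakly_diff \<Omega> w" and ae: "AE x in lebesgue_on \<Omega>. grad \<Omega> u x = g x"
  shows "real_grad_inner \<Omega> u w = (LINT x|lebesgue_on \<Omega>. g x \<bullet> grad \<Omega> w x)"
  unfolding real_grad_inner_def
proof (rule integral_cong_AE)
  note si = square_integrable_grad[OF \<Omega> u] square_integrable_grad[OF \<Omega> w] square_integrable_AE[OF \<Omega> square_integrable_grad[OF \<Omega> u] ae]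
  show "(\<lambda>x. grad \<Omega> u x \<bullet> grad \<Omega> w x) \<in> borel_measurable (lebesgue_on \<Omega>)"
    "(\<lambda>x. g x \<bullet> grad \<Omega> w x) \<in> borel_measurable (lebesgue_on \<Omega>)"
    using integrable_inner_square_integrable[OF si(1,2)] integrable_inner_square_integrable[OF si(3,2)] by auto
  show "AE x in lebesgue_on \<Omega>. grad \<Omega> u x \<bullet> grad \<Omega> w x = g x \<bullet> grad \<Omega> w x"
    using ae by eventually_elim simp
qed

lemma real_grad_inner_add:
  assumes "weakly_diff \<Omega> u" "weakly_diff \<Omega> v" "weakly_diff \<Omega> w"
  shows "real_grad_inner \<Omega> (\<lambda>x. u x + v x) w = real_grad_inner \<Omega> u w + real_grad_inner \<Omega> v w"
  using real_grad_inner_cong_AE[OF weakly_diff_add(1)[OF assms(1,2)] assms(3) weakly_diff_add(2)[OF assms(1,2)]]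
    integrable_inner_square_integrable[OF assms(1)[THEN square_integrable_grad[OF \<Omega>]] assms(3)[THEN square_integrable_grad[OF \<Omega>]]]
    integrable_inner_square_integrable[OF assms(2)[THEN square_integrable_grad[OF \<Omega>]] assms(3)[THEN square_integrable_grad[OF \<Omega>]]]
  by (simp add: inner_add_left real_grad_inner_def)

lemma real_grad_inner_scale:
  assumes "weakly_diff \<Omega> v" "weakly_diff \<Omega> w"
  shows "real_grad_inner \<Omega> (\<lambda>x. c * v x) w = c * real_grad_inner \<Omega> v w"
  using real_grad_inner_cong_AE[OF weakly_diff_scale(1)[OF assms(1)] assms(2) weakly_diff_scale(2)[OF assms(1)]]
  by (simp add: real_grad_inner_def)

lemma real_grad_inner_diff:
  assumes "weakly_diff \<Omega> u" "weakly_diff \<Omega> v" "weakly_diff \<Omega> w"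
  shows "real_grad_inner \<Omega> (\<lambda>x. u x - v x) w = real_grad_inner \<Omega> u w - real_grad_inner \<Omega> v w"
  using real_grad_inner_add[OF assms(1) weakly_diff_scale(1)[OF assms(2), of "-1"] assms(3)]
    real_grad_inner_scale[OF assms(2,3), of "-1"] by simp

lemma real_grad_inner_sym: "real_grad_inner \<Omega> v w = real_grad_inner \<Omega> w v"
  by (simp add: real_grad_inner_def inner_commute)

lemma real_grad_inner_nonneg: "0 \<le> real_grad_inner \<Omega> v v"
  by (simp add: real_grad_inner_def)

lemma grad_cong:
  fixes v v' :: "real^'d \<Rightarrow> 'b::euclidean_space"
  assumes "\<And>x. x \<in> \<Omega> \<Longrightarrow> v x = v' x"
  shows "grad \<Omega> v = grad \<Omega> v'"
proof -
  have "has_weak_gradient \<Omega> v = has_weak_gradient \<Omega> v'"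
    by (intro ext iffI; erule weak_gradient_cong) (simp_all add: assms)
  then show ?thesis by (simp add: grad_def)
qed

lemma real_grad_inner_Cauchy_Schwarz:
  assumes "weakly_diff \<Omega> u" "weakly_diff \<Omega> v"
  shows "(real_grad_inner \<Omega> u v)\<^sup>2 \<le> real_grad_inner \<Omega> u u * real_grad_inner \<Omega> v v"
proof -
  note si = assms[THEN square_integrable_grad[OF \<Omega>]]
  have m[measurable]: "grad \<Omega> u \<in> borel_measurable (lebesgue_on \<Omega>)" "grad \<Omega> v \<in> borel_measurable (lebesgue_on \<Omega>)"
    using si by (auto simp: square_integrable_def)
  have sq: "integrable (lebesgue_on \<Omega>) (\<lambda>x. (norm (grad \<Omega> u x))\<^sup>2)" "integrable (lebesgue_on \<Omega>) (\<lambda>x. (norm (grad \<Omega> v x))\<^sup>2)"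
    using si by (auto simp: square_integrable_def)
  note cs = cauchy_schwarz_integral[OF _ _ sq]
  have "\<bar>real_grad_inner \<Omega> u v\<bar> \<le> (LINT x|lebesgue_on \<Omega>. norm (grad \<Omega> u x) * norm (grad \<Omega> v x))"
    unfolding real_grad_inner_def real_norm_def[symmetric]
    by (rule Bochner_Integration.integral_norm_bound_integral)
       (auto simp: Cauchy_Schwarz_ineq2 integrable_inner_square_integrable[OF si] intro: cs(1))
  then have "(real_grad_inner \<Omega> u v)\<^sup>2 \<le> (LINT x|lebesgue_on \<Omega>. norm (grad \<Omega> u x) * norm (grad \<Omega> v x))\<^sup>2"
    by (simp add: abs_le_square_iff[symmetric])
  also have "\<dots> \<le> (LINT x|lebesgue_on \<Omega>. (norm (grad \<Omega> u x))\<^sup>2) * (LINT x|lebesgue_on \<Omega>. (norm (grad \<Omega> v x))\<^sup>2)"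
    by (rule cs(2)) measurable
  finally show ?thesis by (simp add: real_grad_inner_def dot_square_norm)
qed

end

section \<open>Finite element functions\<close>

lemma polynomial_of_degree_le_imp_real_polynomial_function:
  assumes "polynomial_of_degree_le r (p :: real^'d \<Rightarrow> real)"
  shows "real_polynomial_function p"
proof -
  obtain c where c: "\<And>x. p x = (\<Sum>k | sum k UNIV \<le> r. c k * (\<Prod>i\<in>UNIV. (x $ i) ^ k i))"
    using assms by (auto simp: polynomial_of_degree_le_def)
  have comp: "real_polynomial_function (\<lambda>x::real^'d. x $ i)" for i
    by (rule real_polynomial_function.intros(1)) (rule bounded_linear_vec_nth)
  have "real_polynomial_function (\<lambda>x::real^'d. \<Sum>k | sum k UNIV \<le> r. c k * (\<Prod>i\<in>UNIV. (x $ i) ^ k i))"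
  proof (cases "finite {k :: 'd \<Rightarrow> nat. sum k UNIV \<le> r}")
    case True
    then show ?thesis
      by (intro real_polynomial_function_sum real_polynomial_function.intros(4) real_polynomial_function.intros(2)
          real_polynomial_function_prod real_polynomial_function_power comp) auto
  next
    case False
    then show ?thesis by (simp add: real_polynomial_function.intros(2))
  qed
  moreover have "p = (\<lambda>x. \<Sum>k | sum k UNIV \<le> r. c k * (\<Prod>i\<in>UNIV. (x $ i) ^ k i))" using c by blast
  ultimately show ?thesis by simp
qed

lemma polynomial_of_degree_le_add:
  assumes "polynomial_of_degree_le r p" "polynomial_of_degree_le r q"
  shows "polynomial_of_degree_le r (\<lambda>x. p x + q x)"
proof -
  obtain c d where "\<And>x. p x = (\<Sum>k | sum k UNIV \<le> r. c k * (\<Prod>i\<in>UNIV. (x $ i) ^ k i))"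
    "\<And>x. q x = (\<Sum>k | sum k UNIV \<le> r. d k * (\<Prod>i\<in>UNIV. (x $ i) ^ k i))"
    using assms unfolding polynomial_of_degree_le_def by blast
  then show ?thesis
    unfolding polynomial_of_degree_le_def
    by (intro exI[of _ "\<lambda>k. c k + d k"]) (simp add: sum.distrib distrib_right)
qed

lemma polynomial_of_degree_le_scale:
  assumes "polynomial_of_degree_le r p"
  shows "polynomial_of_degree_le r (\<lambda>x. t * p x)"
proof -
  obtain c where "\<And>x. p x = (\<Sum>k | sum k UNIV \<le> r. c k * (\<Prod>i\<in>UNIV. (x $ i) ^ k i))"
    using assms unfolding polynomial_of_degree_le_def by blast
  then show ?thesis
    unfolding polynomial_of_degree_le_def
    by (intro exI[of _ "\<lambda>k. t * c k"]) (simp add: sum_distrib_left mult.assoc)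
qed

lemma fe_space_add:
  assumes "v \<in> fe_space \<Omega> \<T> r" "w \<in> fe_space \<Omega> \<T> r"
  shows "(\<lambda>x. v x + w x) \<in> fe_space \<Omega> \<T> r"
proof -
  have "\<exists>p. polynomial_of_degree_le r p \<and> (\<forall>x\<in>K. v x + w x = p x)" if K: "K \<in> \<T>" for K
  proof -
    obtain p q where "polynomial_of_degree_le r p" "\<forall>x\<in>K. v x = p x" "polynomial_of_degree_le r q" "\<forall>x\<in>K. w x = q x"
      using assms K unfolding fe_space_def by blast
    then show ?thesis by (intro exI[of _ "\<lambda>x. p x + q x"]) (simp add: polynomial_of_degree_le_add)
  qed
  then show ?thesis using assms by (simp add: fe_space_def continuous_on_add)
qed

lemma fe_space_scale:
  assumes "v \<in> fe_space \<Omega> \<T> r"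
  shows "(\<lambda>x. t * v x) \<in> fe_space \<Omega> \<T> r"
proof -
  have "\<exists>p. polynomial_of_degree_le r p \<and> (\<forall>x\<in>K. t * v x = p x)" if K: "K \<in> \<T>" for K
  proof -
    obtain p where "polynomial_of_degree_le r p" "\<forall>x\<in>K. v x = p x"
      using assms K unfolding fe_space_def by blast
    then show ?thesis by (intro exI[of _ "\<lambda>x. t * p x"]) (simp add: polynomial_of_degree_le_scale)
  qed
  then show ?thesis using assms by (simp add: fe_space_def continuous_on_mult_left)
qed

lemma fe_space_diff:
  assumes "v \<in> fe_space \<Omega> \<T> r" "w \<in> fe_space \<Omega> \<T> r"
  shows "(\<lambda>x. v x - w x) \<in> fe_space \<Omega> \<T> r"
  using fe_space_add[OF assms(1) fe_space_scale[OF assms(2), of "-1"]] by simp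

lemma fe_space_continuous: "v \<in> fe_space \<Omega> \<T> r \<Longrightarrow> continuous_on (closure \<Omega>) v"
  by (simp add: fe_space_def)

lemma fe_space_zero: "(\<lambda>x. 0) \<in> fe_space \<Omega> \<T> r"
  by (auto simp: fe_space_def polynomial_of_degree_le_def intro!: exI[of _ "\<lambda>x. 0"])

lemma real_polynomial_function_lipschitz:
  fixes p :: "'a::euclidean_space \<Rightarrow> real"
  assumes "real_polynomial_function p" and S: "bounded S"
  shows "\<exists>L. L-lipschitz_on S p"
proof -
  have "\<exists>L B. 0 \<le> L \<and> (\<forall>x\<in>S. \<bar>p x\<bar> \<le> B) \<and> (\<forall>x\<in>S. \<forall>y\<in>S. \<bar>p x - p y\<bar> \<le> L * norm (x - y))"
    using assms(1)
  proof induction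
    case (linear f)
    obtain R where R: "\<And>x. x \<in> S \<Longrightarrow> norm x \<le> R" using S bounded_iff by blast
    obtain K where K: "K > 0" "\<And>x. norm (f x) \<le> norm x * K" using bounded_linear.pos_bounded[OF linear] by blast
    have "\<bar>f x - f y\<bar> \<le> K * norm (x - y)" for x y
      using K(2)[of "x - y"] linear by (simp add: bounded_linear.linear linear_diff mult.commute)
    moreover have "\<bar>f x\<bar> \<le> R * K" if "x \<in> S" for x
      using K(2)[of x] mult_right_mono[OF R[OF that] less_imp_le[OF K(1)]] unfolding real_norm_def by linarith
    ultimately show ?case using K(1) less_imp_le by blast
  next
    case (const c)
    show ?case by (intro exI[of _ 0] exI[of _ "\<bar>c\<bar>"]) auto
  next
    case (add f g)
    then obtain L B L' B' where *: "0 \<le> L" "\<forall>x\<in>S. \<bar>f x\<bar> \<le> B" "\<forall>x\<in>S. \<forall>y\<in>S. \<bar>f x - f y\<bar> \<le> L * norm (x - y)"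
      "0 \<le> L'" "\<forall>x\<in>S. \<bar>g x\<bar> \<le> B'" "\<forall>x\<in>S. \<forall>y\<in>S. \<bar>g x - g y\<bar> \<le> L' * norm (x - y)"
      by blast
    have "\<bar>f x + g x\<bar> \<le> B + B'" if "x \<in> S" for x
      using *(2,5) that by (metis abs_triangle_ineq add_mono order_trans)
    moreover have "\<bar>f x + g x - (f y + g y)\<bar> \<le> (L + L') * norm (x - y)" if "x \<in> S" "y \<in> S" for x y
    proof -
      have "\<bar>f x - f y\<bar> \<le> L * norm (x - y)" "\<bar>g x - g y\<bar> \<le> L' * norm (x - y)" using *(3,6) that by blast+
      then show ?thesis unfolding distrib_right by linarith
    qed
    ultimately show ?case using *(1,4) by (intro exI[of _ "L + L'"] exI[of _ "B + B'"]) auto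
  next
    case (mult f g)
    then obtain L B L' B' where *: "0 \<le> L" "\<forall>x\<in>S. \<bar>f x\<bar> \<le> B" "\<forall>x\<in>S. \<forall>y\<in>S. \<bar>f x - f y\<bar> \<le> L * norm (x - y)"
      "0 \<le> L'" "\<forall>x\<in>S. \<bar>g x\<bar> \<le> B'" "\<forall>x\<in>S. \<forall>y\<in>S. \<bar>g x - g y\<bar> \<le> L' * norm (x - y)"
      by blast
    have B: "\<bar>f x\<bar> \<le> \<bar>B\<bar>" "\<bar>g x\<bar> \<le> \<bar>B'\<bar>" if "x \<in> S" for x
      using *(2,5) that by (meson abs_ge_self order_trans)+
    have "\<bar>f x * g x\<bar> \<le> \<bar>B\<bar> * \<bar>B'\<bar>" if "x \<in> S" for x
      unfolding abs_mult using B[OF that] by (intro mult_mono) auto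
    moreover have "\<bar>f x * g x - f y * g y\<bar> \<le> (\<bar>B\<bar> * L' + \<bar>B'\<bar> * L) * norm (x - y)" if "x \<in> S" "y \<in> S" for x y
    proof -
      have "\<bar>f x * g x - f y * g y\<bar> = \<bar>f x * (g x - g y) + g y * (f x - f y)\<bar>" by (simp add: algebra_simps)
      also have "\<dots> \<le> \<bar>f x\<bar> * \<bar>g x - g y\<bar> + \<bar>g y\<bar> * \<bar>f x - f y\<bar>" by (metis abs_mult abs_triangle_ineq)
      also have "\<dots> \<le> \<bar>B\<bar> * (L' * norm (x - y)) + \<bar>B'\<bar> * (L * norm (x - y))"
        using B that *(3,6) by (intro add_mono mult_mono) auto
      finally show ?thesis by (simp add: algebra_simps)
    qed
    ultimately show ?case using *(1,4)
      by (intro exI[of _ "\<bar>B\<bar> * L' + \<bar>B'\<bar> * L"] exI[of _ "\<bar>B\<bar> * \<bar>B'\<bar>"]) auto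
  qed
  then show ?thesis unfolding lipschitz_on_def by (auto simp: dist_norm)
qed

definition zero_extension :: "(real^'d) set \<Rightarrow> (real^'d \<Rightarrow> real) \<Rightarrow> real^'d \<Rightarrow> real" where
  "zero_extension \<Omega> v x = (if x \<in> \<Omega> then v x else 0)"

text \<open>On every segment the pieces induce a finite closed cover of an interval, along which the Lipschitz
bounds of the pieces can be chained.\<close>

lemma lipschitz_if_piecewise_lipschitz:
  fixes V :: "'a::real_normed_vector \<Rightarrow> real"
  assumes fin: "finite \<C>" and cl: "\<And>C. C \<in> \<C> \<Longrightarrow> closed C" and cover: "\<Union>\<C> = UNIV"
    and lip: "\<And>C. C \<in> \<C> \<Longrightarrow> \<exists>L. L-lipschitz_on C V"
  shows "\<exists>L. L-lipschitz_on UNIV V"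
proof -
  obtain L where L: "\<And>C. C \<in> \<C> \<Longrightarrow> (L C)-lipschitz_on C V" using lip by metis
  \<comment> \<open>The sum is a convenient common Lipschitz constant for the finitely many pieces.\<close>
  define M where "M = (\<Sum>C\<in>\<C>. L C)"
  have L0: "C \<in> \<C> \<Longrightarrow> 0 \<le> L C" for C using lipschitz_on_nonneg[OF L] .
  have LM: "L C \<le> M" if "C \<in> \<C>" for C unfolding M_def using that L0 fin by (intro member_le_sum) auto
  have M0: "M \<ge> 0" unfolding M_def using L0 by (intro sum_nonneg) auto
  have "M-lipschitz_on UNIV V"
  proof (rule lipschitz_onI[OF _ M0])
    fix x y :: 'a
    let ?l = "\<lambda>t. x + t *\<^sub>R (y - x)"
    have "(M * dist x y)-lipschitz_on {0..1} (\<lambda>t. V (?l t))"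
    proof (rule lipschitz_on_closed_Union[where I=\<C> and U="\<lambda>C. ?l -` C"])
      fix C assume C: "C \<in> \<C>"
      show "(M * dist x y)-lipschitz_on (?l -` C) (\<lambda>t. V (?l t))"
      proof (rule lipschitz_onI)
        fix s t assume "s \<in> ?l -` C" "t \<in> ?l -` C"
        then have "?l s \<in> C" "?l t \<in> C" by simp_all
        then have "dist (V (?l s)) (V (?l t)) \<le> L C * dist (?l s) (?l t)"
          by (rule lipschitz_onD[OF L[OF C]])
        also have "\<dots> \<le> M * dist (?l s) (?l t)" using LM[OF C] by (intro mult_right_mono) auto
        also have "dist (?l s) (?l t) = dist x y * dist s t"
          by (simp add: dist_norm scaleR_diff_left[symmetric] norm_minus_commute mult.commute)
        finally show "dist (V (?l s)) (V (?l t)) \<le> M * dist x y * dist s t" by simp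
      qed (use M0 in simp)
      show "closed (?l -` C)"
        by (rule continuous_closed_vimage[OF cl[OF C]]) (auto intro!: continuous_intros)
    next
      show "{0..1} \<subseteq> (\<Union>C\<in>\<C>. ?l -` C)" using cover by auto
    qed (use fin M0 in auto)
    from lipschitz_onD[OF this, of 0 1] show "dist (V x) (V y) \<le> M * dist x y" by simp
  qed
  then show ?thesis by blast
qed

text \<open>The complement of the domain, where the extension is 0, is one more closed piece next to the cells.
Points of non-differentiability lie on the boundaries of convex sets, which are null sets.\<close>

lemma fe_zero_extension_lip_ae_diff:
  assumes \<Omega>: "convex_polytopal_domain \<Omega>" and \<T>: "simplicial_partition \<Omega> \<T>"
    and v: "v \<in> fe_space \<Omega> \<T> r"
  shows "lip_ae_diff \<Omega> (zero_extension \<Omega> v)"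
proof -
  have o: "open \<Omega>" "bounded \<Omega>" "convex \<Omega>" using \<Omega> by (auto simp: convex_polytopal_domain_def)
  have fin: "finite \<T>" and simp: "\<And>K. K \<in> \<T> \<Longrightarrow> int CARD('a) simplex K" and un: "\<Union>\<T> = closure \<Omega>"
    using \<T> by (auto simp: simplicial_partition_def)
  let ?V = "zero_extension \<Omega> v"
  have on_cell: "\<exists>p. real_polynomial_function p \<and> (\<forall>x\<in>K. ?V x = p x)" if K: "K \<in> \<T>" for K
  proof -
    obtain p where p: "polynomial_of_degree_le r p" "\<forall>x\<in>K. v x = p x" using v K by (auto simp: fe_space_def)
    have "?V x = p x" if x: "x \<in> K" for x
    proof (cases "x \<in> \<Omega>")
      case False
      then have "x \<in> frontier \<Omega>" using x K un o(1) by (auto simp: frontier_def interior_open)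
      then have "v x = 0" using v by (auto simp: fe_space_def)
      then show ?thesis using False p(2) x by (auto simp: zero_extension_def)
    qed (use p x in \<open>auto simp: zero_extension_def\<close>)
    with p(1) show ?thesis using polynomial_of_degree_le_imp_real_polynomial_function by blast
  qed
  have "\<exists>L. L-lipschitz_on UNIV ?V"
  proof (rule lipschitz_if_piecewise_lipschitz)
    show "finite (insert (- \<Omega>) \<T>)" using fin by simp
    show "closed C" if "C \<in> insert (- \<Omega>) \<T>" for C
      using that o(1) simp closed_simplex by (auto simp: closed_Compl)
    show "\<Union>(insert (- \<Omega>) \<T>) = UNIV" using un closure_subset[of \<Omega>] by auto
    show "\<exists>L. L-lipschitz_on C ?V" if "C \<in> insert (- \<Omega>) \<T>" for C
    proof (cases "C = - \<Omega>")
      case True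
      have "0-lipschitz_on C ?V" by (rule lipschitz_onI) (auto simp: True zero_extension_def)
      then show ?thesis ..
    next
      case False
      then have C: "C \<in> \<T>" using that by simp
      obtain p where p: "real_polynomial_function p" "\<forall>x\<in>C. ?V x = p x" using on_cell[OF C] by blast
      have "bounded C" using compact_simplex[OF simp[OF C]] compact_imp_bounded by blast
      from real_polynomial_function_lipschitz[OF p(1) this] obtain L where "L-lipschitz_on C p" ..
      then have "L-lipschitz_on C ?V" using p(2) by (simp add: lipschitz_on_def)
      then show ?thesis ..
    qed
  qed
  moreover have "negligible {x. \<not> ?V differentiable (at x)}"
  proof (rule negligible_subset)
    show "negligible (frontier \<Omega> \<union> (\<Union>K\<in>\<T>. frontier K))"
      using fin simp o(3)
      by (intro negligible_Un negligible_Union negligible_convex_frontier finite_imageI)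
         (auto intro!: negligible_convex_frontier polytope_imp_convex simplex_imp_polytope)
    show "{x. \<not> ?V differentiable (at x)} \<subseteq> frontier \<Omega> \<union> (\<Union>K\<in>\<T>. frontier K)"
    proof (rule subsetI, rule ccontr)
      fix x assume nd: "x \<in> {x. \<not> ?V differentiable (at x)}" and x: "x \<notin> frontier \<Omega> \<union> (\<Union>K\<in>\<T>. frontier K)"
      have "?V differentiable (at x)"
      proof (cases "x \<in> closure \<Omega>")
        case True
        then obtain K where K: "K \<in> \<T>" "x \<in> K" using un by blast
        then have xK: "x \<in> interior K" using x closed_simplex[OF simp[OF K(1)]] by (auto simp: frontier_def)
        obtain p where p: "real_polynomial_function p" "\<forall>x\<in>K. ?V x = p x" using on_cell[OF K(1)] by blast
        obtain D where "(p has_derivative D) (at x)"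
          using differentiable_at_real_polynomial_function[OF p(1)] differentiable_def by blast
        then have "(?V has_derivative D) (at x)"
          by (rule has_derivative_transform_within_open[OF _ open_interior xK])
             (use p(2) interior_subset[of K] in auto)
        then show ?thesis unfolding differentiable_def by blast
      next
        case False
        have "(?V has_derivative (\<lambda>h. 0)) (at x)"
        proof (rule has_derivative_transform_within_open[OF has_derivative_const[of 0]])
          show "open (- closure \<Omega>)" by (rule open_Compl[OF closed_closure])
          show "x \<in> - closure \<Omega>" using False unfolding Compl_iff .
          show "0 = ?V y" if "y \<in> - closure \<Omega>" for y
            using that closure_subset[of \<Omega>] by (auto simp: zero_extension_def)
        qed
        then show ?thesis unfolding differentiable_def by blast
      qed
      with nd show False by simp
    qed
  qed
  ultimately show ?thesis by (simp add: lip_ae_diff_def zero_extension_def)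
qed

lemma fe_weak_gradient:
  assumes \<Omega>: "convex_polytopal_domain \<Omega>" and \<T>: "simplicial_partition \<Omega> \<T>"
    and v: "v \<in> fe_space \<Omega> \<T> r"
  shows "has_weak_gradient \<Omega> v (classical_gradient (zero_extension \<Omega> v))"
    and "weakly_diff \<Omega> v"
    and "(LINT x|lebesgue. (norm (classical_gradient (zero_extension \<Omega> v) x))\<^sup>2) = real_grad_inner \<Omega> v v"
proof -
  have o: "open \<Omega>" "bounded \<Omega>" "convex \<Omega>" using \<Omega> by (auto simp: convex_polytopal_domain_def)
  have M: "\<Omega> \<in> sets lebesgue" using o(1) by (simp add: borel_open)
  let ?V = "zero_extension \<Omega> v"
  note V = fe_zero_extension_lip_ae_diff[OF assms]
  show w: "has_weak_gradient \<Omega> v (classical_gradient ?V)"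
    by (rule weak_gradient_cong[OF has_weak_gradient_classical_gradient[OF o(1,2) V]]) (simp add: zero_extension_def)
  have si: "square_integrable \<Omega> (classical_gradient ?V)"
    using integrable_lebesgue_on_subset[OF integrable_gradient_square[OF V o(2)] M] classical_gradient_measurable[OF V]
    by (simp add: square_integrable_def measurable_restrict_space1)
  show wd: "weakly_diff \<Omega> v" using w si by (auto simp: weakly_diff_def)
  have "(LINT x|lebesgue. (norm (classical_gradient ?V x))\<^sup>2)
      = (LINT x|lebesgue. indicator \<Omega> x *\<^sub>R (norm (classical_gradient ?V x))\<^sup>2)"
  proof (rule integral_cong_AE)
    show "(\<lambda>x. (norm (classical_gradient ?V x))\<^sup>2) \<in> borel_measurable lebesgue"
      using integrable_gradient_square[OF V o(2)] by (rule borel_measurable_integrable)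
    then show "(\<lambda>x. indicator \<Omega> x *\<^sub>R (norm (classical_gradient ?V x))\<^sup>2) \<in> borel_measurable lebesgue"
      by (intro borel_measurable_scaleR borel_measurable_indicator M)
    have "AE x in lebesgue. x \<notin> frontier \<Omega>"
      using negligible_convex_frontier[OF o(3)] by (intro AE_not_in) (simp add: negligible_iff_null_sets)
    then show "AE x in lebesgue. (norm (classical_gradient ?V x))\<^sup>2 = indicator \<Omega> x *\<^sub>R (norm (classical_gradient ?V x))\<^sup>2"
    proof eventually_elim
      case (elim x)
      show ?case
      proof (cases "x \<in> \<Omega>")
        case False
        with elim have "x \<notin> closure \<Omega>" using o(1) by (auto simp: frontier_def interior_open)
        then show ?thesis using classical_gradient_outside[OF V] by simp
      qed simp
    qed
  qed
  also have "\<dots> = (LINT x|lebesgue_on \<Omega>. (norm (classical_gradient ?V x))\<^sup>2)"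
    using M by (simp add: integral_restrict_space)
  also have "\<dots> = real_grad_inner \<Omega> v v"
    unfolding real_grad_inner_def dot_square_norm
  proof (rule integral_cong_AE)
    show "(\<lambda>x. (norm (classical_gradient ?V x))\<^sup>2) \<in> borel_measurable (lebesgue_on \<Omega>)"
      "(\<lambda>x. (norm (grad \<Omega> v x))\<^sup>2) \<in> borel_measurable (lebesgue_on \<Omega>)"
      using si square_integrable_grad[OF o(1) wd] by (auto simp: square_integrable_def)
    show "AE x in lebesgue_on \<Omega>. (norm (classical_gradient ?V x))\<^sup>2 = (norm (grad \<Omega> v x))\<^sup>2"
      using grad_eq_AE[OF o(1) w] by eventually_elim simp
  qed
  finally show "(LINT x|lebesgue. (norm (classical_gradient ?V x))\<^sup>2) = real_grad_inner \<Omega> v v" .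
qed

lemma fe_poincare_sobolev:
  fixes \<Omega> :: "(real^'d) set"
  assumes \<Omega>: "convex_polytopal_domain \<Omega>" and d3: "CARD('d) \<le> 3"
  obtains P S :: real where "0 \<le> P" "0 \<le> S"
    "\<And>\<T> r v. simplicial_partition \<Omega> \<T> \<Longrightarrow> v \<in> fe_space \<Omega> \<T> r \<Longrightarrow>
       (LINT x|lebesgue_on \<Omega>. (v x)\<^sup>2) \<le> P * real_grad_inner \<Omega> v v"
    "\<And>\<T> r v. simplicial_partition \<Omega> \<T> \<Longrightarrow> v \<in> fe_space \<Omega> \<T> r \<Longrightarrow>
       (LINT x|lebesgue_on \<Omega>. v x ^ 4) \<le> S ^ 4 * (real_grad_inner \<Omega> v v)\<^sup>2"
proof -
  have o: "open \<Omega>" "bounded \<Omega>" "convex \<Omega>" using \<Omega> by (auto simp: convex_polytopal_domain_def)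
  have M: "\<Omega> \<in> sets lebesgue" using o(1) by (simp add: borel_open)
  obtain R0 where "\<Omega> \<subseteq> cball 0 R0" using bounded_subset_cball_0[OF o(2)] by blast
  then have R: "\<Omega> \<subseteq> cball 0 \<bar>R0\<bar>" by (auto simp: subset_iff)
  have ext: "(LINT x|lebesgue_on \<Omega>. v x ^ k) = (LINT x|lebesgue. zero_extension \<Omega> v x ^ k)" if "k > 0" for v k
  proof -
    have "(LINT x|lebesgue_on \<Omega>. v x ^ k) = (LINT x|lebesgue_on \<Omega>. zero_extension \<Omega> v x ^ k)"
      by (rule Bochner_Integration.integral_cong[OF refl]) (simp add: zero_extension_def)
    also have "\<dots> = (LINT x|lebesgue. zero_extension \<Omega> v x ^ k)"
      using that by (intro integral_lebesgue_on_supported[OF M]) (simp add: zero_extension_def)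
    finally show ?thesis .
  qed
  define P where "P = (2 * \<bar>R0\<bar> + 1)\<^sup>2"
  define S where "S = 2 * root 4 (16 * 16 ^ CARD('d) * (real CARD('d))\<^sup>2)
    + root 4 (2 * (real CARD('d) + (2 * \<bar>R0\<bar> + 1)\<^sup>2) * (2 * \<bar>R0\<bar> + 1)\<^sup>2)"
  show thesis
  proof (rule that[of P S])
    show "0 \<le> P" "0 \<le> S" by (simp_all add: P_def S_def)
    fix \<T> r v assume *: "simplicial_partition \<Omega> \<T>" "v \<in> fe_space \<Omega> \<T> r"
    note V = fe_zero_extension_lip_ae_diff[OF \<Omega> *]
    show "(LINT x|lebesgue_on \<Omega>. (v x)\<^sup>2) \<le> P * real_grad_inner \<Omega> v v"
      using poincare_inequality[OF V R] by (simp add: ext P_def fe_weak_gradient(3)[OF \<Omega> *])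
    show "(LINT x|lebesgue_on \<Omega>. v x ^ 4) \<le> S ^ 4 * (real_grad_inner \<Omega> v v)\<^sup>2"
      using sobolev_inequality_explicit[OF V R _ d3] by (simp add: ext S_def fe_weak_gradient(3)[OF \<Omega> *])
  qed
qed

section \<open>From the complex scheme to the real system\<close>

lemma integral_complex_split:
  fixes f g :: "'a \<Rightarrow> real"
  assumes "integrable M f" "integrable M g"
  shows "(LINT x|M. complex_of_real (f x) + \<i> * complex_of_real (g x)) =
    complex_of_real (LINT x|M. f x) + \<i> * complex_of_real (LINT x|M. g x)"
  using assms by simp

lemma real_imag_parts:
  assumes "\<i> * (complex_of_real a + \<i> * complex_of_real b) - (complex_of_real c + \<i> * complex_of_real d)
    - (complex_of_real e + \<i> * complex_of_real f) = 0"
  shows "a = d + f \<and> b = - c - e"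
  using assms by (simp add: complex_eq_iff)

lemma L2_inner_complex:
  fixes f g t :: "real^'d \<Rightarrow> real"
  assumes \<Omega>: "open \<Omega>" "bounded \<Omega>"
    and c: "continuous_on (closure \<Omega>) f" "continuous_on (closure \<Omega>) g" "continuous_on (closure \<Omega>) t"
  shows "L2_inner \<Omega> (\<lambda>x. complex_of_real (f x) + \<i> * complex_of_real (g x)) (\<lambda>x. complex_of_real (t x))
    = complex_of_real (LINT x|lebesgue_on \<Omega>. f x * t x) + \<i> * complex_of_real (LINT x|lebesgue_on \<Omega>. g x * t x)"
proof -
  have "integrable (lebesgue_on \<Omega>) (\<lambda>x. f x * t x)" "integrable (lebesgue_on \<Omega>) (\<lambda>x. g x * t x)"
    by (intro integrable_continuous_closure[OF \<Omega>] continuous_on_mult c)+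
  from integral_complex_split[OF this] show ?thesis
    by (simp add: L2_inner_def algebra_simps)
qed

lemma grad_inner_complex:
  fixes v w t :: "real^'d \<Rightarrow> real"
  assumes \<Omega>: "open \<Omega>" and wd: "weakly_diff \<Omega> v" "weakly_diff \<Omega> w" "weakly_diff \<Omega> t"
  shows "grad_inner \<Omega> (\<lambda>x. complex_of_real (v x) + \<i> * complex_of_real (w x)) (\<lambda>x. complex_of_real (t x))
    = complex_of_real (real_grad_inner \<Omega> v t) + \<i> * complex_of_real (real_grad_inner \<Omega> w t)"
proof -
  have bl: "bounded_linear complex_of_real" "bounded_linear (\<lambda>y. \<i> * complex_of_real y)"
    by (auto intro: bounded_linear_of_real bounded_linear_const_mult)
  note V = weakly_diff_linear_image[OF \<Omega> wd(1) bl(1)] and W = weakly_diff_linear_image[OF \<Omega> wd(2) bl(2)]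
    and t = weakly_diff_linear_image[OF \<Omega> wd(3) bl(1)]
  note VW = weakly_diff_add[OF \<Omega> V(1) W(1)]
  let ?f = "\<lambda>x. complex_of_real (v x) + \<i> * complex_of_real (w x)" and ?t = "\<lambda>x. complex_of_real (t x)"
  let ?r = "\<lambda>x. complex_of_real (grad \<Omega> v x \<bullet> grad \<Omega> t x) + \<i> * complex_of_real (grad \<Omega> w x \<bullet> grad \<Omega> t x)"
  have ae: "AE x in lebesgue_on \<Omega>. ?r x = (\<Sum>i\<in>UNIV. grad \<Omega> ?f x $ i * cnj (grad \<Omega> ?t x $ i))"
    using VW(2) V(2) W(2) t(2)
  proof eventually_elim
    case (elim x)
    then show ?case
      by (simp add: inner_vec_def sum_distrib_left sum.distrib[symmetric] algebra_simps)
  qed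
  have i: "integrable (lebesgue_on \<Omega>) (\<lambda>x. grad \<Omega> v x \<bullet> grad \<Omega> t x)"
     "integrable (lebesgue_on \<Omega>) (\<lambda>x. grad \<Omega> w x \<bullet> grad \<Omega> t x)"
    using wd by (auto intro!: integrable_inner_square_integrable square_integrable_grad[OF \<Omega>])
  then have r: "?r \<in> borel_measurable (lebesgue_on \<Omega>)"
    by (intro borel_measurable_integrable) simp
  have M: "\<Omega> \<in> sets lebesgue" using \<Omega> by (simp add: borel_open)
  have "grad_inner \<Omega> ?f ?t = (LINT x|lebesgue_on \<Omega>. ?r x)"
    unfolding grad_inner_def
    by (rule integral_cong_AE[OF borel_measurable_lebesgue_on_AE[OF M r ae] r]) (use ae in \<open>eventually_elim, simp\<close>)
  also have "\<dots> = complex_of_real (real_grad_inner \<Omega> v t) + \<i> * complex_of_real (real_grad_inner \<Omega> w t)"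
    using integral_complex_split[OF i] by (simp add: real_grad_inner_def)
  finally show ?thesis .
qed

lemma complex_fe_space_Re_Im:
  assumes "u \<in> complex_fe_space \<Omega> \<T> r"
  shows "(\<lambda>x. Re (u x)) \<in> fe_space \<Omega> \<T> r" "(\<lambda>x. Im (u x)) \<in> fe_space \<Omega> \<T> r"
  using assms by (auto simp: complex_fe_space_def)

lemma real_in_complex_fe_space:
  assumes "t \<in> fe_space \<Omega> \<T> r"
  shows "(\<lambda>x. complex_of_real (t x)) \<in> complex_fe_space \<Omega> \<T> r"
  unfolding complex_fe_space_def mem_Collect_eq
  by (intro exI[of _ t] exI[of _ "\<lambda>x. 0"] conjI assms fe_space_zero) simp

lemma fe_galerkin_space:
  fixes \<Omega> :: "(real^'d) set"
  assumes \<Omega>: "convex_polytopal_domain \<Omega>" and \<T>: "simplicial_partition \<Omega> \<T>" and "0 \<le> P" "0 \<le> S"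
    and "\<And>v. v \<in> fe_space \<Omega> \<T> r \<Longrightarrow> (LINT x|lebesgue_on \<Omega>. (v x)\<^sup>2) \<le> P * real_grad_inner \<Omega> v v"
    and "\<And>v. v \<in> fe_space \<Omega> \<T> r \<Longrightarrow> (LINT x|lebesgue_on \<Omega>. v x ^ 4) \<le> S ^ 4 * (real_grad_inner \<Omega> v v)\<^sup>2"
  shows "galerkin_space \<Omega> (fe_space \<Omega> \<T> r) (real_grad_inner \<Omega>) S P"
proof -
  have o: "open \<Omega>" "bounded \<Omega>" using \<Omega> by (auto simp: convex_polytopal_domain_def)
  note wd = fe_weak_gradient(2)[OF \<Omega> \<T>]
  show ?thesis
  proof
    fix v v' w :: "real^'d \<Rightarrow> real" assume "\<And>x. x \<in> \<Omega> \<Longrightarrow> v x = v' x"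
    then have "grad \<Omega> v = grad \<Omega> v'" by (rule grad_cong[OF o(1)])
    then show "real_grad_inner \<Omega> v w = real_grad_inner \<Omega> v' w" by (simp add: real_grad_inner_def)
  qed (use assms(3-) o in \<open>auto simp: fe_space_add fe_space_diff real_grad_inner_add real_grad_inner_diff wd
       real_grad_inner_nonneg real_grad_inner_sym intro: real_grad_inner_sym fe_space_continuous\<close>)
qed

lemma ritz_orthogonality:
  assumes \<Omega>: "convex_polytopal_domain \<Omega>" and \<T>: "simplicial_partition \<Omega> \<T>"
    and v: "weakly_diff \<Omega> v" and p: "is_ritz_projection \<Omega> (fe_space \<Omega> \<T> r) v p"
    and w: "w \<in> fe_space \<Omega> \<T> r"
  shows "real_grad_inner \<Omega> v w = real_grad_inner \<Omega> p w"
proof -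
  have o: "open \<Omega>" using \<Omega> by (auto simp: convex_polytopal_domain_def)
  have pX: "p \<in> fe_space \<Omega> \<T> r" and 0: "real_grad_inner \<Omega> (\<lambda>x. v x - p x) w = 0"
    using p w by (auto simp: is_ritz_projection_def)
  with real_grad_inner_diff[OF o v fe_weak_gradient(2)[OF \<Omega> \<T> pX] fe_weak_gradient(2)[OF \<Omega> \<T> w]]
  show ?thesis by simp
qed

text \<open>The Ritz projection is the orthogonal projection for the Dirichlet form; this makes the initial
gradients bounded independently of the mesh.\<close>

lemma ritz_projection_energy_le:
  assumes \<Omega>: "convex_polytopal_domain \<Omega>" and \<T>: "simplicial_partition \<Omega> \<T>"
    and v: "weakly_diff \<Omega> v" and p: "is_ritz_projection \<Omega> (fe_space \<Omega> \<T> r) v p"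
  shows "real_grad_inner \<Omega> p p \<le> real_grad_inner \<Omega> v v"
proof -
  have o: "open \<Omega>" using \<Omega> by (auto simp: convex_polytopal_domain_def)
  have pX: "p \<in> fe_space \<Omega> \<T> r" using p by (simp add: is_ritz_projection_def)
  note wp = fe_weak_gradient(2)[OF \<Omega> \<T> pX]
  have "real_grad_inner \<Omega> v p = real_grad_inner \<Omega> p p"
    by (rule ritz_orthogonality[OF \<Omega> \<T> v p pX])
  then have "real_grad_inner \<Omega> p p * real_grad_inner \<Omega> p p \<le> real_grad_inner \<Omega> v v * real_grad_inner \<Omega> p p"
    using real_grad_inner_Cauchy_Schwarz[OF o v wp] by (simp add: power2_eq_square)
  then show ?thesis
    using real_grad_inner_nonneg[OF o, of p] real_grad_inner_nonneg[OF o, of v]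
    by (cases "real_grad_inner \<Omega> p p = 0") auto
qed

lemma ritz_projection_unique:
  assumes \<Omega>: "convex_polytopal_domain \<Omega>" and \<T>: "simplicial_partition \<Omega> \<T>"
    and gs: "galerkin_space \<Omega> (fe_space \<Omega> \<T> r) (real_grad_inner \<Omega>) S P"
    and v: "weakly_diff \<Omega> v" and p: "is_ritz_projection \<Omega> (fe_space \<Omega> \<T> r) v p"
    and p': "is_ritz_projection \<Omega> (fe_space \<Omega> \<T> r) v p'" and x: "x \<in> closure \<Omega>"
  shows "p x = p' x"
proof -
  interpret galerkin_space \<Omega> "fe_space \<Omega> \<T> r" "real_grad_inner \<Omega>" S P by (rule gs)
  have X: "p \<in> fe_space \<Omega> \<T> r" "p' \<in> fe_space \<Omega> \<T> r" using p p' by (auto simp: is_ritz_projection_def)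
  let ?e = "\<lambda>x. p x - p' x"
  have eX: "?e \<in> fe_space \<Omega> \<T> r" by (rule X_diff[OF X])
  have "real_grad_inner \<Omega> v ?e = real_grad_inner \<Omega> p ?e" "real_grad_inner \<Omega> v ?e = real_grad_inner \<Omega> p' ?e"
    by (rule ritz_orthogonality[OF \<Omega> \<T> v p eX], rule ritz_orthogonality[OF \<Omega> \<T> v p' eX])
  then have "real_grad_inner \<Omega> ?e ?e = 0" using a_diff[OF X eX] by simp
  then have "(LINT x|lebesgue_on \<Omega>. (?e x)\<^sup>2) \<le> 0" using poincare[OF eX] by simp
  from continuous_integral_square_eq_0[OF open_\<Omega> bounded_\<Omega> X_cont[OF eX] this x] show ?thesis by simp
qed

text \<open>Real functions are admissible as complex test functions, and with them the passage to real and
imaginary parts commutes with both inner products.\<close>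

lemma scheme_solution_real_system:
  assumes \<Omega>: "convex_polytopal_domain \<Omega>" and \<T>: "simplicial_partition \<Omega> \<T>"
    and gs: "galerkin_space \<Omega> (fe_space \<Omega> \<T> r) (real_grad_inner \<Omega>) S P"
    and sol: "scheme_solution \<Omega> \<T> r \<alpha> \<beta> u0 \<phi>0 \<tau> N u \<phi>"
  defines "p \<equiv> \<lambda>n x. Re (u n x)" and "q \<equiv> \<lambda>n x. Im (u n x)"
  shows "n \<le> N \<Longrightarrow> p n \<in> fe_space \<Omega> \<T> r" "n \<le> N \<Longrightarrow> q n \<in> fe_space \<Omega> \<T> r" "n \<le> N \<Longrightarrow> \<phi> n \<in> fe_space \<Omega> \<T> r"
    and "n < N \<Longrightarrow> galerkin_space.cn_step \<Omega> (fe_space \<Omega> \<T> r) (real_grad_inner \<Omega>) \<tau>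
           (p n) (q n) (\<phi> n) (p (Suc n)) (q (Suc n)) (\<phi> (Suc n))"
    and "n < N \<Longrightarrow> galerkin_space.density_eq \<Omega> (fe_space \<Omega> \<T> r) (real_grad_inner \<Omega>) \<alpha> (\<beta>\<^sup>2)
           (p (Suc n)) (q (Suc n)) (\<phi> (Suc n))"
proof -
  interpret galerkin_space \<Omega> "fe_space \<Omega> \<T> r" "real_grad_inner \<Omega>" S P by (rule gs)
  note sol = sol[unfolded scheme_solution_def is_complex_ritz_projection_def is_ritz_projection_def]
  show pX: "p n \<in> fe_space \<Omega> \<T> r" and qX: "q n \<in> fe_space \<Omega> \<T> r" and \<phi>X: "\<phi> n \<in> fe_space \<Omega> \<T> r" if "n \<le> N" for n
  proof -
    have "p n \<in> fe_space \<Omega> \<T> r \<and> q n \<in> fe_space \<Omega> \<T> r \<and> \<phi> n \<in> fe_space \<Omega> \<T> r"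
    proof (cases "n = 0")
      case True
      then show ?thesis using sol by (simp add: p_def q_def)
    next
      case False
      then have "n \<in> {1..N}" using that by simp
      then show ?thesis using sol complex_fe_space_Re_Im unfolding p_def q_def by blast
    qed
    then show "p n \<in> fe_space \<Omega> \<T> r" "q n \<in> fe_space \<Omega> \<T> r" "\<phi> n \<in> fe_space \<Omega> \<T> r" by auto
  qed
  note wd = fe_weak_gradient(2)[OF \<Omega> \<T>]
  assume n: "n < N"
  then have n': "Suc n \<in> {1..N}" "n \<le> N" "Suc n \<le> N" by auto
  note X = pX[OF n'(2)] qX[OF n'(2)] \<phi>X[OF n'(2)] pX[OF n'(3)] qX[OF n'(3)] \<phi>X[OF n'(3)]
  note C = X[THEN X_cont]
  let ?p = "\<lambda>x. p (Suc n) x + p n x" and ?q = "\<lambda>x. q (Suc n) x + q n x" and ?f = "\<lambda>x. \<phi> (Suc n) x + \<phi> n x"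
  show "density_eq \<alpha> (\<beta>\<^sup>2) (p (Suc n)) (q (Suc n)) (\<phi> (Suc n))"
    unfolding density_eq_def p_def q_def cmod_power2[symmetric]
    using sol n'(1) by (simp add: real_L2_inner_def)
  have main: "I (\<lambda>x. (p (Suc n) x - p n x) * t x) / \<tau> = real_grad_inner \<Omega> ?q t / 2 + I (\<lambda>x. ?f x * ?q x * t x) / 4 \<and>
     I (\<lambda>x. (q (Suc n) x - q n x) * t x) / \<tau> = - real_grad_inner \<Omega> ?p t / 2 - I (\<lambda>x. ?f x * ?p x * t x) / 4"
    if t: "t \<in> fe_space \<Omega> \<T> r" for t
  proof -
    let ?t = "\<lambda>x. complex_of_real (t x)"
    have eq: "\<i> * L2_inner \<Omega> (backward_diff \<tau> u (Suc n)) ?t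
           - grad_inner \<Omega> (midpoint_avg u (Suc n)) ?t
           - L2_inner \<Omega> (\<lambda>x. complex_of_real (midpoint_avg \<phi> (Suc n) x) * midpoint_avg u (Suc n) x) ?t = 0"
      using sol n'(1) real_in_complex_fe_space[OF t] by blast
    have u: "u k x = complex_of_real (p k x) + \<i> * complex_of_real (q k x)" for k x
      unfolding p_def q_def by (rule complex_eq)
    have e1: "backward_diff \<tau> u (Suc n) =
       (\<lambda>x. complex_of_real ((p (Suc n) x - p n x) / \<tau>) + \<i> * complex_of_real ((q (Suc n) x - q n x) / \<tau>))"
      by (rule ext) (simp add: backward_diff_def u scaleR_conv_of_real divide_inverse algebra_simps)
    have e2: "midpoint_avg u (Suc n) = (\<lambda>x. complex_of_real (1 / 2 * ?p x) + \<i> * complex_of_real (1 / 2 * ?q x))"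
      by (rule ext) (simp add: midpoint_avg_def u complex_eq_iff algebra_simps)
    have e3: "(\<lambda>x. complex_of_real (midpoint_avg \<phi> (Suc n) x) * midpoint_avg u (Suc n) x)
      = (\<lambda>x. complex_of_real (?f x * ?p x / 4) + \<i> * complex_of_real (?f x * ?q x / 4))"
      by (rule ext) (simp add: e2, simp add: midpoint_avg_def complex_eq_iff field_simps)
    have i1: "L2_inner \<Omega> (backward_diff \<tau> u (Suc n)) ?t
       = complex_of_real (I (\<lambda>x. (p (Suc n) x - p n x) * t x) / \<tau>) + \<i> * complex_of_real (I (\<lambda>x. (q (Suc n) x - q n x) * t x) / \<tau>)"
      unfolding e1
      by (subst L2_inner_complex[OF open_\<Omega> bounded_\<Omega>])
         (simp_all add: C X_cont[OF t] divide_inverse continuous_on_diff continuous_on_mult continuous_on_const mult.commute mult.left_commute)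
    have i2: "grad_inner \<Omega> (midpoint_avg u (Suc n)) ?t
       = complex_of_real (real_grad_inner \<Omega> ?p t / 2) + \<i> * complex_of_real (real_grad_inner \<Omega> ?q t / 2)"
    proof -
      have pq: "?p \<in> fe_space \<Omega> \<T> r" "?q \<in> fe_space \<Omega> \<T> r" by (intro X_add X)+
      note w = pq[THEN wd] t[THEN wd]
      show ?thesis
        unfolding e2 grad_inner_complex[OF open_\<Omega> weakly_diff_scale(1)[OF open_\<Omega> w(1)]
            weakly_diff_scale(1)[OF open_\<Omega> w(2)] w(3)]
          real_grad_inner_scale[OF open_\<Omega> w(1,3)] real_grad_inner_scale[OF open_\<Omega> w(2,3)]
        by simp
    qed
    have i3: "L2_inner \<Omega> (\<lambda>x. complex_of_real (midpoint_avg \<phi> (Suc n) x) * midpoint_avg u (Suc n) x) ?t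
       = complex_of_real (I (\<lambda>x. ?f x * ?p x * t x) / 4) + \<i> * complex_of_real (I (\<lambda>x. ?f x * ?q x * t x) / 4)"
      unfolding e3
      by (subst L2_inner_complex[OF open_\<Omega> bounded_\<Omega>])
         (simp_all add: C X_cont[OF t] continuous_on_add continuous_on_mult continuous_on_divide)
    show ?thesis
      using real_imag_parts[OF eq[unfolded i1 i2 i3]] by simp
  qed
  then show "cn_step \<tau> (p n) (q n) (\<phi> n) (p (Suc n)) (q (Suc n)) (\<phi> (Suc n))"
    unfolding cn_step_def by blast
qed

theorem theorem4p2:
  fixes \<Omega> :: "(real^'d) set" and \<F> :: "(real^'d) set set set"
    and T \<alpha> \<beta> :: real and r :: nat
    and u0 :: "real^'d \<Rightarrow> complex" and \<phi>0 :: "real^'d \<Rightarrow> real"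
  assumes "CARD('d) = 2 \<or> CARD('d) = 3"
    and "convex_polytopal_domain \<Omega>"
    and "T > 0"
    and "\<alpha> \<ge> 0" and "\<beta> \<ge> 0"
    and "\<alpha> \<noteq> 0 \<and> \<beta> \<noteq> 0 \<or> \<alpha> = 0 \<and> \<beta> = 1"
    and "u0 \<in> sobolev_H1_0 \<Omega>" and "\<phi>0 \<in> sobolev_H1_0 \<Omega>"
    and "quasi_uniform_family \<Omega> \<F>"
    and "r \<ge> 1"
  shows "\<exists>\<tau>star>0. \<forall>\<T>\<in>\<F>. \<forall>N::nat. N \<ge> 1 \<longrightarrow> T / real N \<le> \<tau>star \<longrightarrow>
    (\<forall>u \<phi> u' \<phi>'.
       scheme_solution \<Omega> \<T> r \<alpha> \<beta> u0 \<phi>0 (T / real N) N u \<phi> \<longrightarrow>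
       scheme_solution \<Omega> \<T> r \<alpha> \<beta> u0 \<phi>0 (T / real N) N u' \<phi>' \<longrightarrow>
       (\<forall>n\<in>{1..N}. \<forall>x\<in>closure \<Omega>. u n x = u' n x \<and> \<phi> n x = \<phi>' n x))"
proof -
  note \<Omega> = assms(2)
  have o: "open \<Omega>" using \<Omega> by (auto simp: convex_polytopal_domain_def)
  have d3: "CARD('d) \<le> 3" using assms(1) by auto
  have B: "\<beta>\<^sup>2 > 0" using assms(6) by auto
  have "weakly_diff \<Omega> u0" and w\<phi>: "weakly_diff \<Omega> \<phi>0"
    using assms(7,8) by (auto simp: sobolev_H1_0_def sobolev_H1_def weakly_diff_def)
  then have wu: "weakly_diff \<Omega> (\<lambda>x. Re (u0 x))" "weakly_diff \<Omega> (\<lambda>x. Im (u0 x))"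
    using weakly_diff_linear_image(1)[OF o _ bounded_linear_Re] weakly_diff_linear_image(1)[OF o _ bounded_linear_Im] by auto
  obtain P S where PS: "0 \<le> P" "0 \<le> S"
    "\<And>\<T> r v. simplicial_partition \<Omega> \<T> \<Longrightarrow> v \<in> fe_space \<Omega> \<T> r \<Longrightarrow>
       (LINT x|lebesgue_on \<Omega>. (v x)\<^sup>2) \<le> P * real_grad_inner \<Omega> v v"
    "\<And>\<T> r v. simplicial_partition \<Omega> \<T> \<Longrightarrow> v \<in> fe_space \<Omega> \<T> r \<Longrightarrow>
       (LINT x|lebesgue_on \<Omega>. v x ^ 4) \<le> S ^ 4 * (real_grad_inner \<Omega> v v)\<^sup>2"
    using fe_poincare_sobolev[OF \<Omega> d3] by blast
  define G where "G = sqrt (real_grad_inner \<Omega> (\<lambda>x. Re (u0 x)) (\<lambda>x. Re (u0 x)) + real_grad_inner \<Omega> (\<lambda>x. Im (u0 x)) (\<lambda>x. Im (u0 x)))"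
  define F where "F = sqrt (real_grad_inner \<Omega> \<phi>0 \<phi>0)"
  have G0: "G \<ge> 0" and G2: "G\<^sup>2 = real_grad_inner \<Omega> (\<lambda>x. Re (u0 x)) (\<lambda>x. Re (u0 x)) + real_grad_inner \<Omega> (\<lambda>x. Im (u0 x)) (\<lambda>x. Im (u0 x))"
    and F0: "F \<ge> 0" and F2: "F\<^sup>2 = real_grad_inner \<Omega> \<phi>0 \<phi>0"
    using real_grad_inner_nonneg[OF o] by (simp_all add: G_def F_def add_nonneg_nonneg)
  \<comment> \<open>\<open>c \<tau> < \<beta>\<^sup>2\<close> is the smallness condition of \<open>scheme_unique\<close>; the step size bound \<open>\<beta>\<^sup>2 / (c + 1)\<close>
      satisfies it, also for \<open>c = 0\<close>.\<close>
  define c where "c = 2 * S ^ 4 * \<bar>galerkin_space.energy_bound S P (\<beta>\<^sup>2) G F\<bar>"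
  have c0: "c \<ge> 0" by (simp add: c_def)
  show ?thesis
  proof (intro exI[of _ "\<beta>\<^sup>2 / (c + 1)"] conjI ballI allI impI)
    show "\<beta>\<^sup>2 / (c + 1) > 0" using B c0 by simp
    fix \<T> and N :: nat and u \<phi> u' \<phi>' n x
    assume \<T>: "\<T> \<in> \<F>" and N: "1 \<le> N" and le: "T / real N \<le> \<beta>\<^sup>2 / (c + 1)"
      and sol: "scheme_solution \<Omega> \<T> r \<alpha> \<beta> u0 \<phi>0 (T / real N) N u \<phi>"
      and sol': "scheme_solution \<Omega> \<T> r \<alpha> \<beta> u0 \<phi>0 (T / real N) N u' \<phi>'"
      and n: "n \<in> {1..N}" and x: "x \<in> closure \<Omega>"
    have sp: "simplicial_partition \<Omega> \<T>" using assms(9) \<T> by (auto simp: quasi_uniform_family_def)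
    have gs: "galerkin_space \<Omega> (fe_space \<Omega> \<T> r) (real_grad_inner \<Omega>) S P"
      by (rule fe_galerkin_space[OF \<Omega> sp PS(1,2) PS(3,4)[OF sp]])
    interpret galerkin_space \<Omega> "fe_space \<Omega> \<T> r" "real_grad_inner \<Omega>" S P by (rule gs)
    note R = scheme_solution_real_system[OF \<Omega> sp gs sol] and R' = scheme_solution_real_system[OF \<Omega> sp gs sol']
    have \<tau>: "T / real N > 0" using assms(3) N by simp
    have "2 * S ^ 4 * energy_bound (\<beta>\<^sup>2) G F * (T / real N) \<le> c * (T / real N)"
      unfolding c_def using \<tau> by (intro mult_right_mono mult_left_mono) auto
    also have "\<dots> \<le> c * (\<beta>\<^sup>2 / (c + 1))" using le c0 by (intro mult_left_mono)
    also have "\<dots> < \<beta>\<^sup>2" using B c0 by (simp add: field_simps)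
    finally have small: "2 * S ^ 4 * energy_bound (\<beta>\<^sup>2) G F * (T / real N) < \<beta>\<^sup>2" .
    have ritz: "is_ritz_projection \<Omega> (fe_space \<Omega> \<T> r) (\<lambda>x. Re (u0 x)) (\<lambda>x. Re (u 0 x))"
      "is_ritz_projection \<Omega> (fe_space \<Omega> \<T> r) (\<lambda>x. Im (u0 x)) (\<lambda>x. Im (u 0 x))"
      "is_ritz_projection \<Omega> (fe_space \<Omega> \<T> r) \<phi>0 (\<phi> 0)"
      and ritz': "is_ritz_projection \<Omega> (fe_space \<Omega> \<T> r) (\<lambda>x. Re (u0 x)) (\<lambda>x. Re (u' 0 x))"
      "is_ritz_projection \<Omega> (fe_space \<Omega> \<T> r) (\<lambda>x. Im (u0 x)) (\<lambda>x. Im (u' 0 x))"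
      "is_ritz_projection \<Omega> (fe_space \<Omega> \<T> r) \<phi>0 (\<phi>' 0)"
      using sol sol' by (auto simp: scheme_solution_def is_complex_ritz_projection_def)
    note le_energy = ritz_projection_energy_le[OF \<Omega> sp] and uniq = ritz_projection_unique[OF \<Omega> sp gs]
    have "\<forall>x\<in>closure \<Omega>. Re (u n x) = Re (u' n x) \<and> Im (u n x) = Im (u' n x) \<and> \<phi> n x = \<phi>' n x"
    proof (rule scheme_unique[where \<tau>="T / real N" and \<alpha>=\<alpha> and B="\<beta>\<^sup>2" and G=G and F=F and N=N
          and p="\<lambda>n x. Re (u n x)" and q="\<lambda>n x. Im (u n x)" and \<phi>=\<phi>
          and p'="\<lambda>n x. Re (u' n x)" and q'="\<lambda>n x. Im (u' n x)" and \<phi>'=\<phi>'])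
      show "kinetic (\<lambda>x. Re (u 0 x)) (\<lambda>x. Im (u 0 x)) \<le> G\<^sup>2" "kinetic (\<lambda>x. Re (u' 0 x)) (\<lambda>x. Im (u' 0 x)) \<le> G\<^sup>2"
        unfolding kinetic_def G2
        by (rule add_mono[OF le_energy[OF wu(1) ritz(1)] le_energy[OF wu(2) ritz(2)]],
            rule add_mono[OF le_energy[OF wu(1) ritz'(1)] le_energy[OF wu(2) ritz'(2)]])
      show "real_grad_inner \<Omega> (\<phi> 0) (\<phi> 0) \<le> F\<^sup>2" "real_grad_inner \<Omega> (\<phi>' 0) (\<phi>' 0) \<le> F\<^sup>2"
        unfolding F2 by (rule le_energy[OF w\<phi> ritz(3)], rule le_energy[OF w\<phi> ritz'(3)])
      show "Re (u 0 x) = Re (u' 0 x)" "Im (u 0 x) = Im (u' 0 x)" "\<phi> 0 x = \<phi>' 0 x" if "x \<in> closure \<Omega>" for x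
        using uniq[OF wu(1) ritz(1) ritz'(1) that] uniq[OF wu(2) ritz(2) ritz'(2) that] uniq[OF w\<phi> ritz(3) ritz'(3) that] by auto
    qed (use R R' \<tau> assms(4) B G0 F0 small n in auto)
    with x show "u n x = u' n x" "\<phi> n x = \<phi>' n x" by (auto simp: complex_eq_iff)
  qed
qed

end
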